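(* Let $\mathcal{A}=(\mathcal{A}_L,\mathcal{A}_R,S)$ be a Hopf algebroid over a commutative ring $k$, with $\mathcal{A}_L=(A,L,s_L,t_L,\gamma_L,\pi_L)$ and $\mathcal{A}_R=(A,R,s_R,t_R,\gamma_R,\pi_R)$, such that all of the modules $A^R$, ${}^RA$, $A_L$ and ${}_LA$ are finitely generated and projective. Then the following statements are equivalent: 1.a) $s_R:R\to A$ is a Frobenius extension of $k$-algebras. 1.b) $t_R:R^{op}\to A$ is a Frobenius extension of $k$-algebras. 1.c) $s_L:L\to A$ is a Frobenius extension of $k$-algebras. 1.d) $t_L:L^{op}\to A$ is a Frobenius extension of $k$-algebras. 2.a) The right $L$-module $\mathcal{L}(\mathcal{A}^* )^L$, defined by $\lambda^*\cdot l:=\lambda^*(s_L(l)\,-)$, is free of rank 1. 2.b) $S$ is bijective and the left $L$-module ${}^L\mathcal{L}({}^*\mathcal{A})$, defined by $l\cdot{}^*\lambda:={}^*\lambda(t_L(l)\,-)$, is free of rank 1. 2.c) The left $R$-module ${}_R\mathcal{R}({}_*\mathcal{A})$, defined by $r\cdot{}_*\rho:={}_*\rho(-\,s_R(r))$, is free of rank 1. 2.d) $S$ is bijective and the right $R$-module $\mathcal{R}(\mathcal{A}_* )_R$, defined by $\rho_*\cdot r:=\rho_*(-\,t_R(r))$, is free of rank 1. 3.a) There exists $\lambda^*\in\mathcal{L}(\mathcal{A}^* )$ such that the map $\mathcal{F}:A\to\mathcal{A}^*$, $a\mapsto\lambda^*(a\,-)$, is bijective. 3.b) $S$ is bijective and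 there exists ${}^*\lambda\in\mathcal{L}({}^*\mathcal{A})$ such that the map $A\to{}^*\mathcal{A}$, $a\mapsto{}^*\lambda(a\,-)$, is bijective. 3.c) There exists ${}_*\rho\in\mathcal{R}({}_*\mathcal{A})$ such that the map $A\to{}_*\mathcal{A}$, $a\mapsto{}_*\rho(-\,a)$, is bijective. 3.d) $S$ is bijective and there exists $\rho_*\in\mathcal{R}(\mathcal{A}_* )$ such that the map $A\to\mathcal{A}_*$, $a\mapsto\rho_*(-\,a)$, is bijective. 4.a) There exists a left integral $\ell\in\mathcal{L}(\mathcal{A})$ such that the map $\mathcal{F}^*:\mathcal{A}^*\to A$, $\phi^*\mapsto \ell^{(2)}\,t_R(\phi^*(\ell^{(1)}))$, is bijective. 4.b) $S$ is bijective and there exists a left integral $\ell\in\mathcal{L}(\mathcal{A})$ such that the map ${}^*\mathcal{F}:{}^*\mathcal{A}\to A$, ${}^*\phi\mapsto \ell^{(1)}\,s_R({}^*\phi(\ell^{(2)}))$, is bijective. 4.c) There exists a right integral $\wp\in\mathcal{R}(\mathcal{A})$ such that the map ${}_*\mathcal{A}\to A$, ${}_*\phi\mapsto t_L({}_*\phi(\wp_{(2)}))\,\wp_{(1)}$, is bijective. 4.d) $S$ is bijective and there exists a right integral $\wp\in\mathcal{R}(\mathcal{A})$ such that the map $\mathcal{A}_*\to A$, $\phi_*\mapsto s_L(\phi_*(\wp_{(1)}))\,\wp_{(2)}$, is bijective. In particular, integrals $\lambda^*$, ${}^*\lambda$, ${}_*\rho$ and $\rho_*$ on $\mathcal{A}$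 satisfying the condition in 3.a), 3.b), 3.c) and 3.d), respectively, are themselves Frobenius functionals for the extensions $s_R:R\to A$, $t_R:R^{op}\to A$, $s_L:L\to A$ and $t_L:L^{op}\to A$, respectively. Moreover, under these equivalent conditions, the left integrals $\ell\in\mathcal{L}(\mathcal{A})$ satisfying the conditions in 4.a) and 4.b) can be chosen to be equal (i.e. there is a single $\ell$ for which both maps are bijective, a non-degenerate left integral), and similarly the right integrals $\wp\in\mathcal{R}(\mathcal{A})$ satisfying the conditions in 4.c) and 4.d) can be chosen to be equal (a non-degenerate right integral).
   Context: Algebras are associative unital algebras over a commutative ring $k$. **Left bialgebroid.** A left bialgebroid $(A,L,s,t,\gamma,\pi)$ consists of $k$-algebras $A$ (total) and $L$ (base), algebra homomorphisms $s:L\to A$ and $t:L^{op}\to A$ with commuting ranges, and an $L$-coring structure (coassociative coproduct $\gamma:A\to A\otimes_L A$ and counit $\pi:A\to L$, both $L$-$L$ bimodule maps) on the $L$-$L$ bimodule $A$ with actions $l\cdot a\cdot l'=s(l)t(l')a$. Writing $\gamma(a)=a_{(1)}\otimes a_{(2)}$, it is required that $a_{(1)}t(l)\otimes a_{(2)}=a_{(1)}\otimes a_{(2)}s(l)$, $\gamma(1)=1\otimes 1$, $\gamma(aa')=\gamma(a)\gamma(a')$, $\pi(1)=1$, $\pi(a\,s(\pi(a')))=\pi(aa')=\pi(a\,t(\pi(a')))$. **Right bialgebroid.** $(A,R,s,t,\gamma,\pi)$ is a right bialgebroid if $(A^{op},R,t,s,\gamma,\pi)$ is a left bialgebroid. Explicitly: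 $s:R\to A$, $t:R^{op}\to A$ are algebra maps with commuting ranges; $(A,\gamma,\pi)$ is an $R$-coring for the bimodule $r\cdot a\cdot r'=a\,s(r')t(r)$; and, with $\gamma(a)=a^{(1)}\otimes a^{(2)}$: $s(r)a^{(1)}\otimes a^{(2)}=a^{(1)}\otimes t(r)a^{(2)}$, $\gamma(1)=1\otimes1$, $\gamma(aa')=\gamma(a)\gamma(a')$, $\pi(1)=1$, $\pi(s(\pi(a))a')=\pi(aa')=\pi(t(\pi(a))a')$. **Module notation.** For $B\in\{L,R\}$ with $s=s_B,t=t_B$: ${}_BA$ is $A$ with left action $b\cdot a=s(b)a$; $A_B$ has right action $a\cdot b=t(b)a$; $A^B$ has right action $a\cdot b=a\,s(b)$; ${}^BA$ has left action $b\cdot a=a\,t(b)$. In a tensor product the displayed module structures are the ones balanced over $B$ (or $B^{op}$), e.g. $A_L\otimes{}_LA$ has $t_L(l)a\otimes b=a\otimes s_L(l)b$, $A^R\otimes{}^RA$ has $as_R(r)\otimes b=a\otimes bt_R(r)$. **Hopf algebroid.** $\mathcal{A}=(\mathcal{A}_L,\mathcal{A}_R,S)$ consists of a left bialgebroid $\mathcal{A}_L=(A,L,s_L,t_L,\gamma_L,\pi_L)$ and a right bialgebroid $\mathcal{A}_R=(A,R,s_R,t_R,\gamma_R,\pi_R)$ on the same total algebra $A$ and a $k$-linear map $S:A\to A$ (antipode, not assumed bijective) such that (i) $s_L\pi_Lt_R=t_R$, $t_L\pi_Ls_R=s_R$, $s_R\pi_Rt_L=t_L$, $t_R\pi_Rs_L=s_L$;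 (ii) $(\gamma_L\otimes{}^RA)\gamma_R=(A_L\otimes\gamma_R)\gamma_L$ as maps $A\to A_L\otimes{}_LA^R\otimes{}^RA$, and $(\gamma_R\otimes{}_LA)\gamma_L=(A^R\otimes\gamma_L)\gamma_R$ as maps $A\to A^R\otimes{}^RA_L\otimes{}_LA$; (iii) $S(t_L(l')\,a\,t_L(l))=s_L(l)S(a)s_L(l')$ and $S(t_R(r')\,a\,t_R(r))=s_R(r)S(a)s_R(r')$; (iv) $S(a_{(1)})a_{(2)}=s_R\pi_R(a)$ and $a^{(1)}S(a^{(2)})=s_L\pi_L(a)$, where $\gamma_L(a)=a_{(1)}\otimes a_{(2)}$ and $\gamma_R(a)=a^{(1)}\otimes a^{(2)}$. **Duals.** ${}_*\mathcal{A}={}_L\mathrm{Hom}({}_LA,L)$, $\mathcal{A}_*=\mathrm{Hom}_L(A_L,L)$, $\mathcal{A}^*=\mathrm{Hom}_R(A^R,R)$, ${}^*\mathcal{A}={}_R\mathrm{Hom}({}^RA,R)$. The notation $\phi(a\,-)$ means $b\mapsto\phi(ab)$, and $\phi(-\,a)$ means $b\mapsto\phi(ba)$. **Integrals in $\mathcal{A}$.** $\mathcal{L}(\mathcal{A})=\{\ell\in A\mid a\ell=s_L(\pi_L(a))\,\ell\ \ \forall a\in A\}$; $\mathcal{R}(\mathcal{A})=\{\wp\in A\mid \wp a=\wp\,s_R(\pi_R(a))\ \ \forall a\in A\}$. **Integrals on $\mathcal{A}$.** $\mathcal{R}({}_*\mathcal{A})=\{{}_*\rho\in{}_*\mathcal{A}\mid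 t_L({}_*\rho(a_{(2)}))a_{(1)}=s_L({}_*\rho(a))\ \forall a\}$; $\mathcal{R}(\mathcal{A}_* )=\{\rho_*\in\mathcal{A}_*\mid s_L(\rho_*(a_{(1)}))a_{(2)}=t_L(\rho_*(a))\ \forall a\}$; $\mathcal{L}(\mathcal{A}^* )=\{\lambda^*\in\mathcal{A}^*\mid a^{(2)}t_R(\lambda^*(a^{(1)}))=s_R(\lambda^*(a))\ \forall a\}$; $\mathcal{L}({}^*\mathcal{A})=\{{}^*\lambda\in{}^*\mathcal{A}\mid a^{(1)}s_R({}^*\lambda(a^{(2)}))=t_R({}^*\lambda(a))\ \forall a\}$. **Frobenius extension.** A monomorphism of $k$-algebras $s:B\to A$ is a Frobenius extension if $A$ is finitely generated and projective as a left $B$-module and the bimodules ${}_AA_B$ and ${}_A[{}_B\mathrm{Hom}(A,B)]_B$ (with $a\cdot\phi\cdot b=\phi(-\,a)b$) are isomorphic. Equivalently, there is a Frobenius system $(\psi,\sum_iu_i\otimes v_i)$ consisting of a $B$-$B$ bimodule map $\psi:A\to B$ (a Frobenius functional) and an element $\sum_iu_i\otimes v_i\in A\otimes_BA$ with $\sum_i s(\psi(au_i))v_i=a=\sum_iu_i\,s(\psi(v_ia))$ for all $a\in A$. *)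

theory Defs
  imports "HOL-Library.Poly_Mapping"
begin

text \<open>
  Unital associative rings are types of sort \<open>{ring, monoid_mult}\<close>; unlike \<open>ring_1\<close>, this
  sort does not exclude the zero ring.
\<close>

subsection \<open>Opposite rings, algebras and modules\<close>

datatype 'a opp = Opp (unopp: 'a)

instantiation opp :: (times) times
begin
definition "x * y = Opp (unopp y * unopp x)"
instance ..
end

instance opp :: (semigroup_mult) semigroup_mult
  by standard (simp add: times_opp_def mult.assoc)

instantiation opp :: (monoid_mult) monoid_mult
begin
definition "1 = Opp 1"
instance
  by standard (simp_all add: one_opp_def times_opp_def)
end

instantiation opp :: (ring) ring
begin
definition "0 = Opp 0"
definition "x + y = Opp (unopp x + unopp y)"
definition "- x = Opp (- unopp x)"
definition "x - y = Opp (unopp x - unopp y)"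
instance
  by standard
    (simp_all add: zero_opp_def plus_opp_def uminus_opp_def minus_opp_def times_opp_def
      algebra_simps)
end

definition k_algebra ::
  "('k::{comm_ring,monoid_mult} \<Rightarrow> 'a::{ring,monoid_mult} \<Rightarrow> 'a) \<Rightarrow> bool" where
  "k_algebra kA \<longleftrightarrow>
    (\<forall>c x y. kA c (x + y) = kA c x + kA c y) \<and>
    (\<forall>c d x. kA (c + d) x = kA c x + kA d x) \<and>
    (\<forall>c d x. kA (c * d) x = kA c (kA d x)) \<and>
    (\<forall>x. kA 1 x = x) \<and>
    (\<forall>c x y. kA c (x * y) = kA c x * y \<and> kA c (x * y) = x * kA c y)"

definition k_opp :: "('k \<Rightarrow> 'b \<Rightarrow> 'b) \<Rightarrow> 'k \<Rightarrow> 'b opp \<Rightarrow> 'b opp" where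
  "k_opp kB c x = Opp (kB c (unopp x))"

definition algebra_hom ::
  "('k \<Rightarrow> 'b::{ring,monoid_mult} \<Rightarrow> 'b) \<Rightarrow> ('k \<Rightarrow> 'a::{ring,monoid_mult} \<Rightarrow> 'a) \<Rightarrow> ('b \<Rightarrow> 'a) \<Rightarrow> bool"
  where
  "algebra_hom kB kA f \<longleftrightarrow>
    (\<forall>x y. f (x + y) = f x + f y) \<and> (\<forall>x y. f (x * y) = f x * f y) \<and> f 1 = 1 \<and>
    (\<forall>c x. f (kB c x) = kA c (f x))"

text \<open>
  A left module over \<open>'b\<close> is an abelian group \<open>'m\<close> with an action \<open>'b \<Rightarrow> 'm \<Rightarrow> 'm\<close>; a right
  module over \<open>'b\<close> is a left module over \<open>'b opp\<close>.
\<close>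

definition module_map ::
  "('b \<Rightarrow> 'm \<Rightarrow> 'm) \<Rightarrow> ('b \<Rightarrow> 'n \<Rightarrow> 'n) \<Rightarrow> ('m::ab_group_add \<Rightarrow> 'n::ab_group_add) \<Rightarrow> bool" where
  "module_map act act' f \<longleftrightarrow>
    (\<forall>x y. f (x + y) = f x + f y) \<and> (\<forall>b x. f (act b x) = act' b (f x))"

definition finitely_generated :: "('b \<Rightarrow> 'm \<Rightarrow> 'm::ab_group_add) \<Rightarrow> bool" where
  "finitely_generated act \<longleftrightarrow> (\<exists>G. finite G \<and> (\<forall>m. \<exists>c. m = (\<Sum>g\<in>G. act (c g) g)))"

text \<open>
  Projective: a direct summand of a free module.  It suffices to consider the free module
  \<open>'m \<Rightarrow>\<^sub>0 'b\<close> on the set of all elements of the module.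
\<close>

definition projective ::
  "('b::{ring,monoid_mult} \<Rightarrow> 'm \<Rightarrow> 'm::ab_group_add) \<Rightarrow> bool" where
  "projective act \<longleftrightarrow>
    (\<exists>(i :: 'm \<Rightarrow> ('m \<Rightarrow>\<^sub>0 'b)) p.
       module_map act (\<lambda>b. Poly_Mapping.map ((*) b)) i \<and>
       module_map (\<lambda>b. Poly_Mapping.map ((*) b)) act p \<and> (\<forall>m. p (i m) = m))"

text \<open>
  Free of rank 1, for a module carried by the set \<open>M\<close>: there is a basis with one element.
  This formulation is the same for left and right actions.
\<close>

definition free_rank_one :: "('b \<Rightarrow> 'm \<Rightarrow> 'm) \<Rightarrow> 'm set \<Rightarrow> bool" where
  "free_rank_one act M \<longleftrightarrow> (\<exists>x\<in>M. bij_betw (\<lambda>b. act b x) UNIV M)"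


subsection \<open>Tensor products over a noncommutative ring\<close>

text \<open>
  Elements of a tensor product are classes of lists: the list
  \<open>[(x\<^sub>1, y\<^sub>1), \<dots>, (x\<^sub>n, y\<^sub>n)]\<close> stands for \<open>x\<^sub>1 \<otimes> y\<^sub>1 + \<dots> + x\<^sub>n \<otimes> y\<^sub>n\<close>.
  \<open>formal_sum_eq E\<close> is the least congruence on formal sums containing \<open>E\<close>.
\<close>

inductive formal_sum_eq :: "('x list \<Rightarrow> 'x list \<Rightarrow> bool) \<Rightarrow> 'x list \<Rightarrow> 'x list \<Rightarrow> bool"
  for E where
  base: "E xs ys \<Longrightarrow> formal_sum_eq E xs ys"
| refl: "formal_sum_eq E xs xs"
| sym: "formal_sum_eq E xs ys \<Longrightarrow> formal_sum_eq E ys xs"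
| trans: "formal_sum_eq E xs ys \<Longrightarrow> formal_sum_eq E ys zs \<Longrightarrow> formal_sum_eq E xs zs"
| append: "formal_sum_eq E xs xs' \<Longrightarrow> formal_sum_eq E ys ys' \<Longrightarrow>
    formal_sum_eq E (xs @ ys) (xs' @ ys')"
| commute: "formal_sum_eq E (xs @ ys) (ys @ xs)"

text \<open>
  The tensor product balanced by \<open>x\<cdot>b \<otimes> y = x \<otimes> b\<cdot>y\<close>, where \<open>x\<cdot>b = ra b x\<close> and
  \<open>b\<cdot>y = la b y\<close>.  The zero relations make the commutative monoid of classes a group, with
  \<open>- (x \<otimes> y) = (- x) \<otimes> y\<close>.
\<close>

inductive tensor_rel ::
  "('b \<Rightarrow> 'x \<Rightarrow> 'x) \<Rightarrow> ('b \<Rightarrow> 'y \<Rightarrow> 'y) \<Rightarrow>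
   ('x::ab_group_add \<times> 'y::ab_group_add) list \<Rightarrow> ('x \<times> 'y) list \<Rightarrow> bool"
  for ra la where
  "tensor_rel ra la [(x + x', y)] [(x, y), (x', y)]"
| "tensor_rel ra la [(x, y + y')] [(x, y), (x, y')]"
| "tensor_rel ra la [(0, y)] []"
| "tensor_rel ra la [(x, 0)] []"
| "tensor_rel ra la [(ra b x, y)] [(x, la b y)]"

inductive tensor3_rel ::
  "('b \<Rightarrow> 'x \<Rightarrow> 'x) \<Rightarrow> ('b \<Rightarrow> 'y \<Rightarrow> 'y) \<Rightarrow> ('c \<Rightarrow> 'y \<Rightarrow> 'y) \<Rightarrow> ('c \<Rightarrow> 'z \<Rightarrow> 'z) \<Rightarrow>
   ('x::ab_group_add \<times> 'y::ab_group_add \<times> 'z::ab_group_add) list \<Rightarrow> ('x \<times> 'y \<times> 'z) list \<Rightarrow> bool"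
  for ra la ra' la' where
  "tensor3_rel ra la ra' la' [(x + x', y, z)] [(x, y, z), (x', y, z)]"
| "tensor3_rel ra la ra' la' [(x, y + y', z)] [(x, y, z), (x, y', z)]"
| "tensor3_rel ra la ra' la' [(x, y, z + z')] [(x, y, z), (x, y, z')]"
| "tensor3_rel ra la ra' la' [(0, y, z)] []"
| "tensor3_rel ra la ra' la' [(x, 0, z)] []"
| "tensor3_rel ra la ra' la' [(x, y, 0)] []"
| "tensor3_rel ra la ra' la' [(ra b x, y, z)] [(x, la b y, z)]"
| "tensor3_rel ra la ra' la' [(x, ra' c y, z)] [(x, y, la' c z)]"

definition tensor ::
  "('b \<Rightarrow> 'x \<Rightarrow> 'x) \<Rightarrow> ('b \<Rightarrow> 'y \<Rightarrow> 'y) \<Rightarrow>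
   ('x::ab_group_add \<times> 'y::ab_group_add) list \<Rightarrow> ('x \<times> 'y) list set" where
  "tensor ra la xs = {ys. formal_sum_eq (tensor_rel ra la) xs ys}"

definition tensor3 ::
  "('b \<Rightarrow> 'x \<Rightarrow> 'x) \<Rightarrow> ('b \<Rightarrow> 'y \<Rightarrow> 'y) \<Rightarrow> ('c \<Rightarrow> 'y \<Rightarrow> 'y) \<Rightarrow> ('c \<Rightarrow> 'z \<Rightarrow> 'z) \<Rightarrow>
   ('x::ab_group_add \<times> 'y::ab_group_add \<times> 'z::ab_group_add) list \<Rightarrow> ('x \<times> 'y \<times> 'z) list set"
  where
  "tensor3 ra la ra' la' xs = {ys. formal_sum_eq (tensor3_rel ra la ra' la') xs ys}"

text \<open>
  Sweedler notation: \<open>sw (\<gamma> a)\<close> is a representative \<open>a\<^sub>1 \<otimes> a\<^sub>2\<close> (summation understood) of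
  \<open>\<gamma> a\<close>.  It is only used in expressions that do not depend on its choice.
\<close>

definition sw :: "'x list set \<Rightarrow> 'x list" where
  "sw T = (SOME xs. xs \<in> T)"


subsection \<open>Bialgebroids\<close>

text \<open>\<open>A\<^sub>L \<otimes> \<^sub>LA\<close>, \<open>s, t\<close> being the source and target maps of a left bialgebroid.\<close>

definition tensorL ::
  "('l \<Rightarrow> 'a) \<Rightarrow> ('l \<Rightarrow> 'a) \<Rightarrow> ('a::ring \<times> 'a) list \<Rightarrow> ('a \<times> 'a) list set" where
  "tensorL s t = tensor (\<lambda>l x. t l * x) (\<lambda>l y. s l * y)"

text \<open>\<open>A\<^sup>R \<otimes> \<^sup>RA\<close>, \<open>s, t\<close> being the source and target maps of a right bialgebroid.\<close>

definition tensorR ::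
  "('r \<Rightarrow> 'a) \<Rightarrow> ('r \<Rightarrow> 'a) \<Rightarrow> ('a::ring \<times> 'a) list \<Rightarrow> ('a \<times> 'a) list set" where
  "tensorR s t = tensor (\<lambda>r x. x * s r) (\<lambda>r y. y * t r)"

definition left_bialgebroid ::
  "('k::{comm_ring,monoid_mult} \<Rightarrow> 'a \<Rightarrow> 'a) \<Rightarrow> ('k \<Rightarrow> 'l \<Rightarrow> 'l) \<Rightarrow>
   ('l::{ring,monoid_mult} \<Rightarrow> 'a::{ring,monoid_mult}) \<Rightarrow> ('l \<Rightarrow> 'a) \<Rightarrow>
   ('a \<Rightarrow> ('a \<times> 'a) list set) \<Rightarrow> ('a \<Rightarrow> 'l) \<Rightarrow> bool" where
  "left_bialgebroid kA kL s t \<gamma> \<pi> \<longleftrightarrow>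
    k_algebra kA \<and> k_algebra kL \<and>
    algebra_hom kL kA s \<and> algebra_hom (k_opp kL) kA (t \<circ> unopp) \<and>
    (\<forall>l l'. s l * t l' = t l' * s l) \<and>
    (\<forall>a. \<gamma> a \<in> range (tensorL s t)) \<and>
    (\<forall>a b. \<gamma> (a + b) = tensorL s t (sw (\<gamma> a) @ sw (\<gamma> b))) \<and>
    (\<forall>l l' a. \<gamma> (s l * t l' * a) = tensorL s t [(s l * x, t l' * y). (x, y) \<leftarrow> sw (\<gamma> a)]) \<and>
    (\<forall>a b. \<pi> (a + b) = \<pi> a + \<pi> b) \<and>
    (\<forall>l l' a. \<pi> (s l * t l' * a) = l * \<pi> a * l') \<and>
    (\<forall>a. tensor3 (\<lambda>l x. t l * x) (\<lambda>l y. s l * y) (\<lambda>l x. t l * x) (\<lambda>l y. s l * y)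
           [(x', x'', y). (x, y) \<leftarrow> sw (\<gamma> a), (x', x'') \<leftarrow> sw (\<gamma> x)] =
         tensor3 (\<lambda>l x. t l * x) (\<lambda>l y. s l * y) (\<lambda>l x. t l * x) (\<lambda>l y. s l * y)
           [(x, y', y''). (x, y) \<leftarrow> sw (\<gamma> a), (y', y'') \<leftarrow> sw (\<gamma> y)]) \<and>
    (\<forall>a. (\<Sum>(x, y)\<leftarrow>sw (\<gamma> a). s (\<pi> x) * y) = a) \<and>
    (\<forall>a. (\<Sum>(x, y)\<leftarrow>sw (\<gamma> a). t (\<pi> y) * x) = a) \<and>
    (\<forall>l a. tensorL s t [(x * t l, y). (x, y) \<leftarrow> sw (\<gamma> a)] =
           tensorL s t [(x, y * s l). (x, y) \<leftarrow> sw (\<gamma> a)]) \<and>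
    \<gamma> 1 = tensorL s t [(1, 1)] \<and>
    (\<forall>a b. \<gamma> (a * b) =
       tensorL s t [(x * x', y * y'). (x, y) \<leftarrow> sw (\<gamma> a), (x', y') \<leftarrow> sw (\<gamma> b)]) \<and>
    \<pi> 1 = 1 \<and>
    (\<forall>a b. \<pi> (a * s (\<pi> b)) = \<pi> (a * b)) \<and>
    (\<forall>a b. \<pi> (a * t (\<pi> b)) = \<pi> (a * b))"

definition right_bialgebroid ::
  "('k::{comm_ring,monoid_mult} \<Rightarrow> 'a \<Rightarrow> 'a) \<Rightarrow> ('k \<Rightarrow> 'r \<Rightarrow> 'r) \<Rightarrow>
   ('r::{ring,monoid_mult} \<Rightarrow> 'a::{ring,monoid_mult}) \<Rightarrow> ('r \<Rightarrow> 'a) \<Rightarrow>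
   ('a \<Rightarrow> ('a \<times> 'a) list set) \<Rightarrow> ('a \<Rightarrow> 'r) \<Rightarrow> bool" where
  "right_bialgebroid kA kR s t \<gamma> \<pi> \<longleftrightarrow>
    k_algebra kA \<and> k_algebra kR \<and>
    algebra_hom kR kA s \<and> algebra_hom (k_opp kR) kA (t \<circ> unopp) \<and>
    (\<forall>r r'. s r * t r' = t r' * s r) \<and>
    (\<forall>a. \<gamma> a \<in> range (tensorR s t)) \<and>
    (\<forall>a b. \<gamma> (a + b) = tensorR s t (sw (\<gamma> a) @ sw (\<gamma> b))) \<and>
    (\<forall>r r' a. \<gamma> (a * s r' * t r) = tensorR s t [(x * t r, y * s r'). (x, y) \<leftarrow> sw (\<gamma> a)]) \<and>
    (\<forall>a b. \<pi> (a + b) = \<pi> a + \<pi> b) \<and>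
    (\<forall>r r' a. \<pi> (a * s r' * t r) = r * \<pi> a * r') \<and>
    (\<forall>a. tensor3 (\<lambda>r x. x * s r) (\<lambda>r y. y * t r) (\<lambda>r x. x * s r) (\<lambda>r y. y * t r)
           [(x', x'', y). (x, y) \<leftarrow> sw (\<gamma> a), (x', x'') \<leftarrow> sw (\<gamma> x)] =
         tensor3 (\<lambda>r x. x * s r) (\<lambda>r y. y * t r) (\<lambda>r x. x * s r) (\<lambda>r y. y * t r)
           [(x, y', y''). (x, y) \<leftarrow> sw (\<gamma> a), (y', y'') \<leftarrow> sw (\<gamma> y)]) \<and>
    (\<forall>a. (\<Sum>(x, y)\<leftarrow>sw (\<gamma> a). y * t (\<pi> x)) = a) \<and>
    (\<forall>a. (\<Sum>(x, y)\<leftarrow>sw (\<gamma> a). x * s (\<pi> y)) = a) \<and>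
    (\<forall>r a. tensorR s t [(s r * x, y). (x, y) \<leftarrow> sw (\<gamma> a)] =
           tensorR s t [(x, t r * y). (x, y) \<leftarrow> sw (\<gamma> a)]) \<and>
    \<gamma> 1 = tensorR s t [(1, 1)] \<and>
    (\<forall>a b. \<gamma> (a * b) =
       tensorR s t [(x * x', y * y'). (x, y) \<leftarrow> sw (\<gamma> a), (x', y') \<leftarrow> sw (\<gamma> b)]) \<and>
    \<pi> 1 = 1 \<and>
    (\<forall>a b. \<pi> (s (\<pi> a) * b) = \<pi> (a * b)) \<and>
    (\<forall>a b. \<pi> (t (\<pi> a) * b) = \<pi> (a * b))"


subsection \<open>Hopf algebroids\<close>

definition hopf_algebroid ::
  "('k::{comm_ring,monoid_mult} \<Rightarrow> 'a \<Rightarrow> 'a) \<Rightarrow> ('k \<Rightarrow> 'l \<Rightarrow> 'l) \<Rightarrow> ('k \<Rightarrow> 'r \<Rightarrow> 'r) \<Rightarrow>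
   ('l::{ring,monoid_mult} \<Rightarrow> 'a::{ring,monoid_mult}) \<Rightarrow> ('l \<Rightarrow> 'a) \<Rightarrow>
   ('a \<Rightarrow> ('a \<times> 'a) list set) \<Rightarrow> ('a \<Rightarrow> 'l) \<Rightarrow>
   ('r::{ring,monoid_mult} \<Rightarrow> 'a) \<Rightarrow> ('r \<Rightarrow> 'a) \<Rightarrow>
   ('a \<Rightarrow> ('a \<times> 'a) list set) \<Rightarrow> ('a \<Rightarrow> 'r) \<Rightarrow> ('a \<Rightarrow> 'a) \<Rightarrow> bool" where
  "hopf_algebroid kA kL kR sL tL \<gamma>L \<pi>L sR tR \<gamma>R \<pi>R S \<longleftrightarrow>
    left_bialgebroid kA kL sL tL \<gamma>L \<pi>L \<and>
    right_bialgebroid kA kR sR tR \<gamma>R \<pi>R \<and>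
    (\<forall>a b. S (a + b) = S a + S b) \<and> (\<forall>c a. S (kA c a) = kA c (S a)) \<and>
    sL \<circ> \<pi>L \<circ> tR = tR \<and> tL \<circ> \<pi>L \<circ> sR = sR \<and> sR \<circ> \<pi>R \<circ> tL = tL \<and> tR \<circ> \<pi>R \<circ> sL = sL \<and>
    (\<forall>a. tensor3 (\<lambda>l x. tL l * x) (\<lambda>l y. sL l * y) (\<lambda>r x. x * sR r) (\<lambda>r y. y * tR r)
           [(x', x'', y). (x, y) \<leftarrow> sw (\<gamma>R a), (x', x'') \<leftarrow> sw (\<gamma>L x)] =
         tensor3 (\<lambda>l x. tL l * x) (\<lambda>l y. sL l * y) (\<lambda>r x. x * sR r) (\<lambda>r y. y * tR r)
           [(x, y', y''). (x, y) \<leftarrow> sw (\<gamma>L a), (y', y'') \<leftarrow> sw (\<gamma>R y)]) \<and>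
    (\<forall>a. tensor3 (\<lambda>r x. x * sR r) (\<lambda>r y. y * tR r) (\<lambda>l x. tL l * x) (\<lambda>l y. sL l * y)
           [(x', x'', y). (x, y) \<leftarrow> sw (\<gamma>L a), (x', x'') \<leftarrow> sw (\<gamma>R x)] =
         tensor3 (\<lambda>r x. x * sR r) (\<lambda>r y. y * tR r) (\<lambda>l x. tL l * x) (\<lambda>l y. sL l * y)
           [(x, y', y''). (x, y) \<leftarrow> sw (\<gamma>R a), (y', y'') \<leftarrow> sw (\<gamma>L y)]) \<and>
    (\<forall>l l' a. S (tL l' * a * tL l) = sL l * S a * sL l') \<and>
    (\<forall>r r' a. S (tR r' * a * tR r) = sR r * S a * sR r') \<and>
    (\<forall>a. (\<Sum>(x, y)\<leftarrow>sw (\<gamma>L a). S x * y) = sR (\<pi>R a)) \<and>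
    (\<forall>a. (\<Sum>(x, y)\<leftarrow>sw (\<gamma>R a). x * S y) = sL (\<pi>L a))"

text \<open>
  The four duals; in the names, the position of the asterisk in \<open>\<^sub>*A\<close>, \<open>A\<^sub>*\<close>, \<open>A\<^sup>*\<close>, \<open>\<^sup>*A\<close> is
  spelled out.
\<close>

definition lower_left_dual :: "('l \<Rightarrow> 'a) \<Rightarrow> ('a::ring \<Rightarrow> 'l::ring) set" where
  "lower_left_dual sL =
    {\<phi>. (\<forall>a b. \<phi> (a + b) = \<phi> a + \<phi> b) \<and> (\<forall>l a. \<phi> (sL l * a) = l * \<phi> a)}"

definition lower_right_dual :: "('l \<Rightarrow> 'a) \<Rightarrow> ('a::ring \<Rightarrow> 'l::ring) set" where
  "lower_right_dual tL =
    {\<phi>. (\<forall>a b. \<phi> (a + b) = \<phi> a + \<phi> b) \<and> (\<forall>l a. \<phi> (tL l * a) = \<phi> a * l)}"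

definition upper_right_dual :: "('r \<Rightarrow> 'a) \<Rightarrow> ('a::ring \<Rightarrow> 'r::ring) set" where
  "upper_right_dual sR =
    {\<phi>. (\<forall>a b. \<phi> (a + b) = \<phi> a + \<phi> b) \<and> (\<forall>r a. \<phi> (a * sR r) = \<phi> a * r)}"

definition upper_left_dual :: "('r \<Rightarrow> 'a) \<Rightarrow> ('a::ring \<Rightarrow> 'r::ring) set" where
  "upper_left_dual tR =
    {\<phi>. (\<forall>a b. \<phi> (a + b) = \<phi> a + \<phi> b) \<and> (\<forall>r a. \<phi> (a * tR r) = r * \<phi> a)}"

definition left_integrals :: "('l \<Rightarrow> 'a) \<Rightarrow> ('a \<Rightarrow> 'l) \<Rightarrow> 'a::ring set" where
  "left_integrals sL \<pi>L = {\<iota>. \<forall>a. a * \<iota> = sL (\<pi>L a) * \<iota>}"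

definition right_integrals :: "('r \<Rightarrow> 'a) \<Rightarrow> ('a \<Rightarrow> 'r) \<Rightarrow> 'a::ring set" where
  "right_integrals sR \<pi>R = {\<kappa>. \<forall>a. \<kappa> * a = \<kappa> * sR (\<pi>R a)}"

text \<open>The integrals on a Hopf algebroid are named after the dual that contains them.\<close>

definition lower_left_integrals ::
  "('l \<Rightarrow> 'a) \<Rightarrow> ('l \<Rightarrow> 'a) \<Rightarrow> ('a \<Rightarrow> ('a \<times> 'a) list set) \<Rightarrow> ('a::ring \<Rightarrow> 'l::ring) set" where
  "lower_left_integrals sL tL \<gamma>L =
    {\<rho> \<in> lower_left_dual sL. \<forall>a. (\<Sum>(x, y)\<leftarrow>sw (\<gamma>L a). tL (\<rho> y) * x) = sL (\<rho> a)}"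

definition lower_right_integrals ::
  "('l \<Rightarrow> 'a) \<Rightarrow> ('l \<Rightarrow> 'a) \<Rightarrow> ('a \<Rightarrow> ('a \<times> 'a) list set) \<Rightarrow> ('a::ring \<Rightarrow> 'l::ring) set" where
  "lower_right_integrals sL tL \<gamma>L =
    {\<rho> \<in> lower_right_dual tL. \<forall>a. (\<Sum>(x, y)\<leftarrow>sw (\<gamma>L a). sL (\<rho> x) * y) = tL (\<rho> a)}"

definition upper_right_integrals ::
  "('r \<Rightarrow> 'a) \<Rightarrow> ('r \<Rightarrow> 'a) \<Rightarrow> ('a \<Rightarrow> ('a \<times> 'a) list set) \<Rightarrow> ('a::ring \<Rightarrow> 'r::ring) set" where
  "upper_right_integrals sR tR \<gamma>R =
    {\<Lambda> \<in> upper_right_dual sR. \<forall>a. (\<Sum>(x, y)\<leftarrow>sw (\<gamma>R a). y * tR (\<Lambda> x)) = sR (\<Lambda> a)}"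

definition upper_left_integrals ::
  "('r \<Rightarrow> 'a) \<Rightarrow> ('r \<Rightarrow> 'a) \<Rightarrow> ('a \<Rightarrow> ('a \<times> 'a) list set) \<Rightarrow> ('a::ring \<Rightarrow> 'r::ring) set" where
  "upper_left_integrals sR tR \<gamma>R =
    {\<Lambda> \<in> upper_left_dual tR. \<forall>a. (\<Sum>(x, y)\<leftarrow>sw (\<gamma>R a). x * sR (\<Lambda> y)) = tR (\<Lambda> a)}"


subsection \<open>Frobenius extensions\<close>

text \<open>
  \<open>\<Phi>\<close> is the isomorphism of \<open>A\<close>-\<open>B\<close> bimodules from \<open>A\<close> to the left \<open>B\<close>-module maps \<open>A \<rightarrow> B\<close>, the
  latter with \<open>a \<cdot> \<phi> \<cdot> b = (\<lambda>x. \<phi> (x * a) * b)\<close>.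
\<close>

definition frobenius_extension ::
  "('k::{comm_ring,monoid_mult} \<Rightarrow> 'b \<Rightarrow> 'b) \<Rightarrow> ('k \<Rightarrow> 'a \<Rightarrow> 'a) \<Rightarrow>
   ('b::{ring,monoid_mult} \<Rightarrow> 'a::{ring,monoid_mult}) \<Rightarrow> bool" where
  "frobenius_extension kB kA s \<longleftrightarrow>
    algebra_hom kB kA s \<and> inj s \<and>
    finitely_generated (\<lambda>b a. s b * a) \<and> projective (\<lambda>b a. s b * a) \<and>
    (\<exists>\<Phi>. bij_betw \<Phi> UNIV {\<phi>. module_map (\<lambda>b a. s b * a) (*) \<phi>} \<and>
         (\<forall>x y. \<Phi> (x + y) = (\<lambda>z. \<Phi> x z + \<Phi> y z)) \<and>
         (\<forall>a x b. \<Phi> (a * x * s b) = (\<lambda>z. \<Phi> x (z * a) * b)))"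

text \<open>The list \<open>uv\<close> represents the element \<open>\<Sum>\<^sub>i u\<^sub>i \<otimes> v\<^sub>i\<close> of \<open>A \<otimes>\<^sub>B A\<close>.\<close>

definition frobenius_functional ::
  "('b::{ring,monoid_mult} \<Rightarrow> 'a::{ring,monoid_mult}) \<Rightarrow> ('a \<Rightarrow> 'b) \<Rightarrow> bool" where
  "frobenius_functional s \<psi> \<longleftrightarrow>
    (\<forall>x y. \<psi> (x + y) = \<psi> x + \<psi> y) \<and>
    (\<forall>b x b'. \<psi> (s b * x * s b') = b * \<psi> x * b') \<and>
    (\<exists>uv. \<forall>a. (\<Sum>(u, v)\<leftarrow>uv. s (\<psi> (a * u)) * v) = a \<and>
              (\<Sum>(u, v)\<leftarrow>uv. u * s (\<psi> (v * a))) = a)"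

end

theory Submission
  imports Defs
begin

text \<open>
  Put \<open>B = s\<^sub>L(L) = t\<^sub>R(R)\<close> and \<open>C = t\<^sub>L(L) = s\<^sub>R(R)\<close>.  These are commuting subrings of \<open>A\<close>
  that are exchanged by \<open>S\<close>, and composing with \<open>s\<close> or \<open>t\<close> turns functionals on \<open>A\<close> into additive maps
  \<open>A \<rightarrow> A\<close> with values in \<open>B\<close> or \<open>C\<close>; both \<open>s\<^sub>R\<close> and \<open>t\<^sub>L\<close> are then the inclusion of \<open>C\<close>, both
  \<open>t\<^sub>R\<close> and \<open>s\<^sub>L\<close> the inclusion of \<open>B\<close>.  The Hopf algebroid data become invariant under passing to the
  opposite-coopposite structure (exchanging \<open>B\<close> and \<open>C\<close>) and, if \<open>S\<close> is bijective, to the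
  coopposite one, so that only the conditions labelled a) have to be compared.

  All of them are equivalent to the existence of an integral \<open>\<Lambda>\<close> on \<open>A\<close> and a left integral \<open>l\<close> in \<open>A\<close>
  with \<open>\<Lambda>(l) = 1\<close> and \<open>\<Lambda>(S(l) b) = s\<^sub>R \<pi>\<^sub>R(b)\<close>.  Such a pair makes \<open>S\<close> bijective with inverse
  \<open>b \<mapsto> l\<^sup>2 t\<^sub>R(\<Lambda>(b l\<^sup>1))\<close>, and \<open>a \<mapsto> \<Lambda>(S(a) -)\<close> is inverse to \<open>\<phi> \<mapsto> l\<^sup>2 t\<^sub>R(\<phi>(l\<^sup>1))\<close>.
  To obtain it, one projects functionals onto integrals by the map \<open>P\<close> of the Hopf module
  structure of \<open>A\<^sup>*\<close>: if \<open>\<psi>\<close> is a Frobenius functional with system \<open>u\<^sub>i \<otimes> v\<^sub>i\<close>, then \<open>\<Lambda> = P \<psi>\<close> and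
  \<open>l = \<Sum>\<^sub>i u\<^sub>i t\<^sub>L \<pi>\<^sub>L(v\<^sub>i)\<close> work; if the integrals are free on \<open>\<Lambda>\<close>, then \<open>l\<close> is obtained by
  writing \<open>s\<^sub>R \<pi>\<^sub>R\<close> as \<open>\<Lambda>(S(l) -)\<close>.
\<close>

section \<open>Bilinear sums and pairs of commuting subrings\<close>

text \<open>This is why functionals are translated by \<open>S a\<close> and not by
  \<open>a\<close>: with the action \<Phi>(S(a) -) the functionals form a Hopf module whose
  coinvariants are the integrals, and the projection onto them can be written with \<open>S\<close>
  applied twice and with no inverse. Two dual bases over the same subring \<open>C\<close> enter:
  one of A as a right \<open>C\<close>-module, to expand functionals, and one of A as a left
  \<open>C\<close>-module, to turn the convolution action of functionals into a coaction. They come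
  from two of the four finiteness hypotheses; the other two do the same for \<open>B\<close>. The
  integral built from a Frobenius system represents a counit: \<psi>(a l) = t_L \<pi>_L(a), just as
  S(l) has to represent s_R \<pi>_R through \<Lambda>.\<close>

definition psum :: "('x \<times> 'y) list \<Rightarrow> ('x \<Rightarrow> 'y \<Rightarrow> 'z::ab_group_add) \<Rightarrow> 'z" where
  "psum xs f = (\<Sum>(x, y)\<leftarrow>xs. f x y)"

lemma psum_Nil [simp]: "psum [] f = 0"
  and psum_Cons: "psum ((x, y) # xs) f = f x y + psum xs f"
  by (simp_all add: psum_def)

lemma psum_add: "psum xs (\<lambda>x y. f x y + h x y) = psum xs f + psum xs h"
  by (induction xs) (auto simp: psum_Cons algebra_simps)

lemma psum_zero [simp]: "psum xs (\<lambda>x y. 0) = 0"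
  by (induction xs) (auto simp: psum_Cons)

lemma psum_hom:
  fixes h :: "'b::ab_group_add \<Rightarrow> 'c::ab_group_add"
  assumes "\<And>x y. h (x + y) = h x + h y"
  shows "h (psum xs f) = psum xs (\<lambda>x y. h (f x y))"
proof -
  have "h 0 = 0"
    using assms[of 0 0] by simp
  then show ?thesis
    by (induction xs) (auto simp: psum_Cons assms)
qed

lemma psum_commute:
  "psum xs (\<lambda>x y. psum ys (\<lambda>x' y'. f x y x' y')) =
   psum ys (\<lambda>x' y'. psum xs (\<lambda>x y. f x y x' y'))"
  by (induction xs) (auto simp: psum_Cons psum_add)

lemma psum_in:
  assumes "(0::'b::ab_group_add) \<in> X" "\<And>x y. x \<in> X \<Longrightarrow> y \<in> X \<Longrightarrow> x + y \<in> X" "\<And>x y. f x y \<in> X"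
  shows "psum xs f \<in> X"
  by (induction xs) (auto simp: psum_Cons assms)

lemma psum_swap: "psum (map prod.swap xs) f = psum xs (\<lambda>x y. f y x)"
  by (induction xs) (auto simp: psum_Cons)

definition biadditive :: "('a::ab_group_add \<Rightarrow> 'a \<Rightarrow> 'a) \<Rightarrow> bool" where
  "biadditive f \<longleftrightarrow>
    (\<forall>x x' y. f (x + x') y = f x y + f x' y) \<and> (\<forall>x y y'. f x (y + y') = f x y + f x y')"

definition triadditive :: "('a::ab_group_add \<Rightarrow> 'a \<Rightarrow> 'a \<Rightarrow> 'a) \<Rightarrow> bool" where
  "triadditive f \<longleftrightarrow>
    (\<forall>x x' y z. f (x + x') y z = f x y z + f x' y z) \<and>
    (\<forall>x y y' z. f x (y + y') z = f x y z + f x y' z) \<and>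
    (\<forall>x y z z'. f x y (z + z') = f x y z + f x y z')"

text \<open>
  Since \<open>S\<close> sends \<open>t\<^sub>L(l)\<close> to \<open>s\<^sub>L(l)\<close> and \<open>t\<^sub>R(r)\<close> to \<open>s\<^sub>R(r)\<close>, the tensor relations over \<open>L\<close> and \<open>R\<close>
  can be written without mentioning \<open>L\<close> and \<open>R\<close>.  Elements of a tensor product are handled through the
  values of balanced maps on a representing list of pairs.
\<close>

definition balanced ::
  "('a \<Rightarrow> 'a \<Rightarrow> 'a) \<Rightarrow> 'a set \<Rightarrow> ('a \<Rightarrow> 'a) \<Rightarrow> ('a::ab_group_add \<Rightarrow> 'a \<Rightarrow> 'a) \<Rightarrow> bool" where
  "balanced m C S f \<longleftrightarrow> biadditive f \<and> (\<forall>c\<in>C. \<forall>x y. f (m c x) y = f x (m (S c) y))"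

definition balanced_LL ::
  "('a \<Rightarrow> 'a \<Rightarrow> 'a) \<Rightarrow> 'a set \<Rightarrow> ('a \<Rightarrow> 'a) \<Rightarrow> ('a::ab_group_add \<Rightarrow> 'a \<Rightarrow> 'a \<Rightarrow> 'a) \<Rightarrow> bool" where
  "balanced_LL m C S f \<longleftrightarrow> triadditive f \<and>
    (\<forall>c\<in>C. \<forall>x y z. f (m c x) y z = f x (m (S c) y) z) \<and>
    (\<forall>c\<in>C. \<forall>x y z. f x (m c y) z = f x y (m (S c) z))"

text \<open>The relation over \<open>B\<close> is the tensor relation over R: for b = t_R(r) one has
  S b = s_R(r). The two letters give the order in which the base rings L and R occur between the
  three factors.\<close>

definition balanced_LR ::
  "('a \<Rightarrow> 'a \<Rightarrow> 'a) \<Rightarrow> 'a set \<Rightarrow> 'a set \<Rightarrow> ('a \<Rightarrow> 'a) \<Rightarrow> ('a::ab_group_add \<Rightarrow> 'a \<Rightarrow> 'a \<Rightarrow> 'a) \<Rightarrow> bool"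
  where
  "balanced_LR m B C S f \<longleftrightarrow> triadditive f \<and>
    (\<forall>c\<in>C. \<forall>x y z. f (m c x) y z = f x (m (S c) y) z) \<and>
    (\<forall>b\<in>B. \<forall>x y z. f x (m y (S b)) z = f x y (m z b))"

definition balanced_RL ::
  "('a \<Rightarrow> 'a \<Rightarrow> 'a) \<Rightarrow> 'a set \<Rightarrow> 'a set \<Rightarrow> ('a \<Rightarrow> 'a) \<Rightarrow> ('a::ab_group_add \<Rightarrow> 'a \<Rightarrow> 'a \<Rightarrow> 'a) \<Rightarrow> bool"
  where
  "balanced_RL m B C S f \<longleftrightarrow> triadditive f \<and>
    (\<forall>b\<in>B. \<forall>x y z. f (m x (S b)) y z = f x (m y b) z) \<and>
    (\<forall>c\<in>C. \<forall>x y z. f x (m c y) z = f x y (m (S c) z))"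

text \<open>The multiplication is a parameter, so that the reversed multiplication can be put in its
  place. \<open>S\<close> is only assumed to be compatible with factors from \<open>B\<close> and
  \<open>C\<close>; its anti-multiplicativity on all of A needs the antipode axioms and is
  \<open>S_mult\<close>. The square of \<open>S\<close> need not be the identity on \<open>B\<close>
  or \<open>C\<close>.\<close>

locale base_pair =
  fixes m :: "'a::ab_group_add \<Rightarrow> 'a \<Rightarrow> 'a" (infixl \<open>\<odot>\<close> 70) and u :: 'a (\<open>\<one>\<close>)
    and B C :: "'a set" and S :: "'a \<Rightarrow> 'a"
  assumes assoc: "(x \<odot> y) \<odot> z = x \<odot> (y \<odot> z)"
    and one_left [simp]: "\<one> \<odot> x = x" and one_right [simp]: "x \<odot> \<one> = x"
    and distl: "x \<odot> (y + z) = x \<odot> y + x \<odot> z" and distr: "(x + y) \<odot> z = x \<odot> z + y \<odot> z"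
    and B_one [simp]: "\<one> \<in> B" and C_one [simp]: "\<one> \<in> C"
    and B_add [simp]: "b \<in> B \<Longrightarrow> b' \<in> B \<Longrightarrow> b + b' \<in> B"
    and C_add [simp]: "c \<in> C \<Longrightarrow> c' \<in> C \<Longrightarrow> c + c' \<in> C"
    and B_minus [simp]: "b \<in> B \<Longrightarrow> - b \<in> B"
    and C_minus [simp]: "c \<in> C \<Longrightarrow> - c \<in> C"
    and B_mult [simp]: "b \<in> B \<Longrightarrow> b' \<in> B \<Longrightarrow> b \<odot> b' \<in> B"
    and C_mult [simp]: "c \<in> C \<Longrightarrow> c' \<in> C \<Longrightarrow> c \<odot> c' \<in> C"
    and comm: "b \<in> B \<Longrightarrow> c \<in> C \<Longrightarrow> b \<odot> c = c \<odot> b"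
    and S_add: "S (x + y) = S x + S y"
    and S_one [simp]: "S \<one> = \<one>"
    and S_image_B: "S ` B = C" and S_image_C: "S ` C = B"
    and S_inj_B: "inj_on S B" and S_inj_C: "inj_on S C"
    and S_lin_C: "c \<in> C \<Longrightarrow> c' \<in> C \<Longrightarrow> S (c' \<odot> a \<odot> c) = S c \<odot> S a \<odot> S c'"
    and S_lin_B: "b \<in> B \<Longrightarrow> b' \<in> B \<Longrightarrow> S (b' \<odot> a \<odot> b) = S b \<odot> S a \<odot> S b'"
begin

lemma opposite: "base_pair (\<lambda>x y. y \<odot> x) \<one> C B S"
  by unfold_locales
    (simp_all add: distl distr S_add S_image_B S_image_C S_inj_B S_inj_C comm
       flip: assoc, simp_all only: assoc S_lin_C[unfolded assoc] S_lin_B[unfolded assoc])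

end

section \<open>Bialgebroids and Hopf algebroids over a pair of subrings\<close>

context base_pair begin

lemma zero_left [simp]: "0 \<odot> x = 0" and zero_right [simp]: "x \<odot> 0 = 0"
  using distr[of 0 0 x] distl[of x 0 0] by simp_all

lemma S_zero [simp]: "S 0 = 0"
  using S_add[of 0 0] by simp

lemma B_zero [simp]: "0 \<in> B" and C_zero [simp]: "0 \<in> C"
  using B_add[of \<one> "- \<one>"] C_add[of \<one> "- \<one>"] by simp_all

lemma S_B [simp]: "b \<in> B \<Longrightarrow> S b \<in> C" and S_C [simp]: "c \<in> C \<Longrightarrow> S c \<in> B"
  using S_image_B S_image_C by auto

lemma S_C_left: "c \<in> C \<Longrightarrow> S (c \<odot> x) = S x \<odot> S c"
  and S_B_left: "b \<in> B \<Longrightarrow> S (b \<odot> x) = S x \<odot> S b"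
  and S_B_right: "b \<in> B \<Longrightarrow> S (x \<odot> b) = S b \<odot> S x"
  using S_lin_C[of \<one> c x] S_lin_B[of \<one> b x] S_lin_B[of b \<one> x] by simp_all

text \<open>Since S t_R = s_R and S t_L = s_L, the map \<open>iB\<close> passes from s_R(r) to
  t_R(r), and \<open>iC\<close> passes from s_L(l) to t_L(l).\<close>

definition iB :: "'a \<Rightarrow> 'a" where "iB = inv_into B S"
definition iC :: "'a \<Rightarrow> 'a" where "iC = inv_into C S"

lemma iB_in [simp]: "c \<in> C \<Longrightarrow> iB c \<in> B" and S_iB [simp]: "c \<in> C \<Longrightarrow> S (iB c) = c"
  and iC_in [simp]: "b \<in> B \<Longrightarrow> iC b \<in> C" and S_iC [simp]: "b \<in> B \<Longrightarrow> S (iC b) = b"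
  unfolding iB_def iC_def by (simp_all add: inv_into_into f_inv_into_f S_image_B S_image_C)

lemma iB_S [simp]: "b \<in> B \<Longrightarrow> iB (S b) = b" and iC_S [simp]: "c \<in> C \<Longrightarrow> iC (S c) = c"
  unfolding iB_def iC_def using S_inj_B S_inj_C by simp_all

lemma iB_eqI: "b \<in> B \<Longrightarrow> S b = c \<Longrightarrow> iB c = b" and iC_eqI: "c \<in> C \<Longrightarrow> S c = b \<Longrightarrow> iC b = c"
  by auto

lemma iB_add: "c \<in> C \<Longrightarrow> c' \<in> C \<Longrightarrow> iB (c + c') = iB c + iB c'"
  and iC_add: "b \<in> B \<Longrightarrow> b' \<in> B \<Longrightarrow> iC (b + b') = iC b + iC b'"
  by (rule iB_eqI iC_eqI; simp add: S_add)+

lemma iB_mult: "c \<in> C \<Longrightarrow> c' \<in> C \<Longrightarrow> iB (c \<odot> c') = iB c' \<odot> iB c"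
  and iC_mult: "b \<in> B \<Longrightarrow> b' \<in> B \<Longrightarrow> iC (b \<odot> b') = iC b' \<odot> iC b"
  by (rule iB_eqI iC_eqI; simp add: S_B_left S_C_left)+

lemma iB_one [simp]: "iB \<one> = \<one>" and iC_one [simp]: "iC \<one> = \<one>"
  by (rule iB_eqI iC_eqI; simp)+

lemma iB_zero [simp]: "iB 0 = 0" and iC_zero [simp]: "iC 0 = 0"
  by (rule iB_eqI iC_eqI; simp)+

lemma comm_left: "b \<in> B \<Longrightarrow> c \<in> C \<Longrightarrow> b \<odot> (c \<odot> x) = c \<odot> (b \<odot> x)"
  by (metis assoc comm)

lemma psum_left: "psum xs (\<lambda>x y. z \<odot> f x y) = z \<odot> psum xs f"
  by (rule psum_hom[symmetric]) (rule distl)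

lemma psum_right: "psum xs (\<lambda>x y. f x y \<odot> z) = psum xs f \<odot> z"
  by (rule psum_hom[symmetric, of "\<lambda>x. x \<odot> z"]) (rule distr)

lemma psum_S: "psum xs (\<lambda>x y. S (f x y)) = S (psum xs f)"
  by (rule psum_hom[symmetric]) (rule S_add)

end

text \<open>\<open>\<epsilon>\<close> stands for s_L \<pi>_L, so that \<open>inv_into C S\<close>
  composed with it is t_L \<pi>_L. Equations in the tensor product are tested on all balanced maps
  with values in A, which avoids a type of tensors.\<close>

locale left_bialg = base_pair +
  fixes g :: "'a \<Rightarrow> ('a \<times> 'a) list" and \<epsilon> :: "'a \<Rightarrow> 'a"
  assumes g_add: "balanced m C S f \<Longrightarrow> psum (g (a + a')) f = psum (g a) f + psum (g a') f"
    and g_B_left: "balanced m C S f \<Longrightarrow> b \<in> B \<Longrightarrow> psum (g (b \<odot> a)) f = psum (g a) (\<lambda>x y. f (b \<odot> x) y)"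
    and g_C_left: "balanced m C S f \<Longrightarrow> c \<in> C \<Longrightarrow> psum (g (c \<odot> a)) f = psum (g a) (\<lambda>x y. f x (c \<odot> y))"
    and eps_add: "\<epsilon> (a + a') = \<epsilon> a + \<epsilon> a'"
    and eps_in [simp]: "\<epsilon> a \<in> B"
    and eps_B: "b \<in> B \<Longrightarrow> \<epsilon> (b \<odot> a) = b \<odot> \<epsilon> a"
    and eps_C: "c \<in> C \<Longrightarrow> \<epsilon> (c \<odot> a) = \<epsilon> a \<odot> S c"
    and coassoc: "balanced_LL m C S h \<Longrightarrow>
      psum (g a) (\<lambda>x y. psum (g x) (\<lambda>x' x''. h x' x'' y)) =
      psum (g a) (\<lambda>x y. psum (g y) (\<lambda>y' y''. h x y' y''))"
    and counit_left: "psum (g a) (\<lambda>x y. \<epsilon> x \<odot> y) = a"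
    and counit_right': "psum (g a) (\<lambda>x y. inv_into C S (\<epsilon> y) \<odot> x) = a"
    and takeuchi: "balanced m C S f \<Longrightarrow> c \<in> C \<Longrightarrow>
      psum (g a) (\<lambda>x y. f (x \<odot> c) y) = psum (g a) (\<lambda>x y. f x (y \<odot> S c))"
    and g_one: "balanced m C S f \<Longrightarrow> psum (g \<one>) f = f \<one> \<one>"
    and g_mult: "balanced m C S f \<Longrightarrow>
      psum (g (a \<odot> a')) f = psum (g a) (\<lambda>x y. psum (g a') (\<lambda>x' y'. f (x \<odot> x') (y \<odot> y')))"
    and eps_one [simp]: "\<epsilon> \<one> = \<one>"
    and eps_mult_B: "\<epsilon> (a \<odot> \<epsilon> a') = \<epsilon> (a \<odot> a')"
    and eps_mult_C': "\<epsilon> (a \<odot> inv_into C S (\<epsilon> a')) = \<epsilon> (a \<odot> a')"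
begin

abbreviation bal where "bal \<equiv> balanced m C S"
abbreviation D where "D a f \<equiv> psum (g a) f"

lemmas counit_right = counit_right'[folded iC_def]
lemmas eps_mult_C = eps_mult_C'[folded iC_def]

lemma eps_of_B [simp]: "b \<in> B \<Longrightarrow> \<epsilon> b = b"
  using eps_B[of b \<one>] by simp

lemma eps_of_C [simp]: "c \<in> C \<Longrightarrow> \<epsilon> c = S c"
  using eps_C[of c \<one>] by simp

lemma eps_zero [simp]: "\<epsilon> 0 = 0"
  by (rule eps_of_B) simp

lemma balI:
  assumes "\<And>x x' y. f (x + x') y = f x y + f x' y" "\<And>x y y'. f x (y + y') = f x y + f x y'"
    "\<And>c x y. c \<in> C \<Longrightarrow> f (c \<odot> x) y = f x (S c \<odot> y)"
  shows "bal f"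
  using assms by (simp add: balanced_def biadditive_def)

lemma balD:
  assumes "bal f"
  shows "f (x + x') y = f x y + f x' y" "f x (y + y') = f x y + f x y'"
    "c \<in> C \<Longrightarrow> f (c \<odot> x) y = f x (S c \<odot> y)"
  using assms by (simp_all add: balanced_def biadditive_def)

lemma g_of_B: "bal f \<Longrightarrow> b \<in> B \<Longrightarrow> D b f = f b \<one>"
  using g_B_left[of f b \<one>] g_one[of "\<lambda>x y. f (b \<odot> x) y"]
  by (simp add: balanced_def biadditive_def distl comm_left)

lemma g_of_C: "bal f \<Longrightarrow> c \<in> C \<Longrightarrow> D c f = f \<one> c"
  using g_C_left[of f c \<one>] g_one[of "\<lambda>x y. f x (c \<odot> y)"]
  by (simp add: balanced_def biadditive_def distl comm_left)

lemma bal_shift: "bal f \<Longrightarrow> bal (\<lambda>x y. f (x \<odot> p) (y \<odot> q))"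
  by (simp add: balanced_def biadditive_def distr assoc)

text \<open>The Takeuchi condition is what makes multiplication by a fixed coproduct respect the
  tensor relation.\<close>

lemma bal_mult: "bal f \<Longrightarrow> bal (\<lambda>x' y'. D a (\<lambda>x y. f (x \<odot> x') (y \<odot> y')))"
proof (rule balI)
  fix c x' y' assume f: "bal f" and "c \<in> C"
  then show "D a (\<lambda>x y. f (x \<odot> (c \<odot> x')) (y \<odot> y')) = D a (\<lambda>x y. f (x \<odot> x') (y \<odot> (S c \<odot> y')))"
    using takeuchi[OF bal_shift[OF f, of x' y']] by (simp add: assoc)
qed (simp_all add: balD distl psum_add)

lemma g_mult': "bal f \<Longrightarrow>
  D (a \<odot> a') f = D a' (\<lambda>x' y'. D a (\<lambda>x y. f (x \<odot> x') (y \<odot> y')))"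
  by (simp add: g_mult psum_commute[of "g a"])

lemma g_B_right: "bal f \<Longrightarrow> b \<in> B \<Longrightarrow> D (a \<odot> b) f = D a (\<lambda>x y. f (x \<odot> b) y)"
  by (simp add: g_mult' g_of_B[OF bal_mult])

lemma g_C_right: "bal f \<Longrightarrow> c \<in> C \<Longrightarrow> D (a \<odot> c) f = D a (\<lambda>x y. f x (y \<odot> c))"
  by (simp add: g_mult' g_of_C[OF bal_mult])

lemma g_zero [simp]: "bal f \<Longrightarrow> D 0 f = 0"
  using g_add[of f 0 0] by simp

lemma g_psum: "bal f \<Longrightarrow> D (psum xs h) f = psum xs (\<lambda>x y. D (h x y) f)"
  by (rule psum_hom[of "\<lambda>a. D a f"]) (rule g_add)

end

text \<open>
  The lists \<open>hR a\<close> represent \<open>\<gamma>\<^sub>R(a)\<close> with its legs exchanged: this turns the right bialgebroid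
  into a left one over the reversed multiplication with the same \<open>B\<close> and \<open>C\<close>.
\<close>

locale hopf =
  left_bialg m u B C S gL eL + R: left_bialg "\<lambda>x y. m y x" u C B S hR eR
  for m :: "'a::ab_group_add \<Rightarrow> 'a \<Rightarrow> 'a" (infixl \<open>\<odot>\<close> 70) and u :: 'a (\<open>\<one>\<close>)
    and B C :: "'a set" and S :: "'a \<Rightarrow> 'a"
    and gL hR :: "'a \<Rightarrow> ('a \<times> 'a) list" and eL eR :: "'a \<Rightarrow> 'a" +
  assumes mixed_LR: "balanced_LR m B C S h \<Longrightarrow>
      psum (hR a) (\<lambda>y x. psum (gL x) (\<lambda>x' x''. h x' x'' y)) =
      psum (gL a) (\<lambda>x y. psum (hR y) (\<lambda>y'' y'. h x y' y''))"
    and mixed_RL: "balanced_RL m B C S h \<Longrightarrow>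
      psum (gL a) (\<lambda>x y. psum (hR x) (\<lambda>x'' x'. h x' x'' y)) =
      psum (hR a) (\<lambda>y x. psum (gL y) (\<lambda>y' y''. h x y' y''))"
    and antipode_L: "psum (gL a) (\<lambda>x y. S x \<odot> y) = eR a"
    and antipode_R: "psum (hR a) (\<lambda>y x. x \<odot> S y) = eL a"

lemma (in hopf) opposite: "hopf (\<lambda>x y. y \<odot> x) \<one> C B S hR gL eR eL"
proof -
  interpret L': left_bialg "\<lambda>x y. y \<odot> x" u C B S hR eR
    by (rule R.left_bialg_axioms)
  interpret R': left_bialg "\<lambda>x y. x \<odot> y" u B C S gL eL
    by (rule left_bialg_axioms)
  show ?thesis
  proof
    fix h :: "'a \<Rightarrow> 'a \<Rightarrow> 'a \<Rightarrow> 'a" and a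
    assume h: "balanced_LR (\<lambda>x y. y \<odot> x) C B S h"
    \<comment> \<open>Reversing the three legs compensates for reversing the multiplication, so the
      same mixed law applies, read from right to left.\<close>
    have "balanced_LR (\<odot>) B C S (\<lambda>x y z. h z y x)"
      using h unfolding balanced_LR_def triadditive_def by simp
    from mixed_LR[OF this, of a, symmetric]
    show "psum (gL a) (\<lambda>y x. psum (hR x) (\<lambda>x' x''. h x' x'' y)) =
      psum (hR a) (\<lambda>x y. psum (gL y) (\<lambda>y'' y'. h x y' y''))" .
  next
    fix h :: "'a \<Rightarrow> 'a \<Rightarrow> 'a \<Rightarrow> 'a" and a
    assume h: "balanced_RL (\<lambda>x y. y \<odot> x) C B S h"
    have "balanced_RL (\<odot>) B C S (\<lambda>x y z. h z y x)"
      using h unfolding balanced_RL_def triadditive_def by simp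
    from mixed_RL[OF this, of a, symmetric]
    show "psum (hR a) (\<lambda>x y. psum (gL x) (\<lambda>x'' x'. h x' x'' y)) =
      psum (gL a) (\<lambda>y x. psum (hR y) (\<lambda>y' y''. h x y' y''))" .
  qed (simp_all add: antipode_L antipode_R)
qed

section \<open>The antipode reverses products and coproducts\<close>

context hopf begin

abbreviation balR where "balR f \<equiv> balanced (\<lambda>x y. y \<odot> x) B S (\<lambda>y x. f x y)"
abbreviation DR where "DR a f \<equiv> psum (hR a) (\<lambda>y x. f x y)"

lemma balRI:
  assumes "\<And>x x' y. f (x + x') y = f x y + f x' y" "\<And>x y y'. f x (y + y') = f x y + f x y'"
    "\<And>b x y. b \<in> B \<Longrightarrow> f (x \<odot> S b) y = f x (y \<odot> b)"
  shows "balR f"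
  using assms by (simp add: balanced_def biadditive_def)

lemma balRD:
  assumes "balR f"
  shows "f (x + x') y = f x y + f x' y" "f x (y + y') = f x y + f x y'"
    "b \<in> B \<Longrightarrow> f (x \<odot> S b) y = f x (y \<odot> b)"
  using assms by (simp_all add: balanced_def biadditive_def)

lemma gR_add: "balR f \<Longrightarrow> DR (a + a') f = DR a f + DR a' f"
  by (rule R.g_add)
lemma gR_C_right: "balR f \<Longrightarrow> c \<in> C \<Longrightarrow> DR (a \<odot> c) f = DR a (\<lambda>x y. f x (y \<odot> c))"
  by (rule R.g_B_left)
lemma gR_B_right: "balR f \<Longrightarrow> b \<in> B \<Longrightarrow> DR (a \<odot> b) f = DR a (\<lambda>x y. f (x \<odot> b) y)"
  by (rule R.g_C_left)
lemma gR_C_left: "balR f \<Longrightarrow> c \<in> C \<Longrightarrow> DR (c \<odot> a) f = DR a (\<lambda>x y. f x (c \<odot> y))"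
  by (rule R.g_B_right)
lemma gR_B_left: "balR f \<Longrightarrow> b \<in> B \<Longrightarrow> DR (b \<odot> a) f = DR a (\<lambda>x y. f (b \<odot> x) y)"
  by (rule R.g_C_right)
lemma takeuchiR: "balR f \<Longrightarrow> b \<in> B \<Longrightarrow> DR a (\<lambda>x y. f x (b \<odot> y)) = DR a (\<lambda>x y. f (S b \<odot> x) y)"
  by (rule R.takeuchi)
lemma gR_mult: "balR f \<Longrightarrow>
    DR (a \<odot> a') f = DR a (\<lambda>x y. DR a' (\<lambda>x' y'. f (x \<odot> x') (y \<odot> y')))"
  by (subst R.g_mult') simp_all
lemma gR_of_C: "balR f \<Longrightarrow> c \<in> C \<Longrightarrow> DR c f = f \<one> c"
  by (rule R.g_of_B)
lemma counitR_left: "DR a (\<lambda>x y. y \<odot> iB (eR x)) = a"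
  unfolding iB_def by (rule R.counit_right')
lemma counitR_right: "DR a (\<lambda>x y. x \<odot> eR y) = a"
  by (rule R.counit_left)
lemma eR_add: "eR (a + a') = eR a + eR a'"
  by (rule R.eps_add)
lemma eR_in [simp]: "eR a \<in> C"
  by (rule R.eps_in)
lemma eR_C: "c \<in> C \<Longrightarrow> eR (a \<odot> c) = eR a \<odot> c"
  by (rule R.eps_B)
lemma eR_B: "b \<in> B \<Longrightarrow> eR (a \<odot> b) = S b \<odot> eR a"
  by (rule R.eps_C)
lemma eR_eR: "eR (eR a \<odot> b) = eR (a \<odot> b)"
  by (rule R.eps_mult_B)
lemma eR_iB_eR: "eR (iB (eR a) \<odot> b) = eR (a \<odot> b)"
  unfolding iB_def by (rule R.eps_mult_C')

lemma S_eR_right: "S (y \<odot> iB (eR x)) = eR x \<odot> S y"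
  by (simp add: S_B_right)

text \<open>The Takeuchi condition carries \<open>c\<close> to the second leg as
  \<open>iB c\<close>, and \<open>S\<close> turns it into a right factor \<open>c\<close>; what is
  left is a counit expansion of \<open>S b\<close>.\<close>

lemma eR_mult: "DR b (\<lambda>x y. eR (c \<odot> x) \<odot> S y) = S b \<odot> c" if "c \<in> C" for b c
proof -
  have bal: "balR (\<lambda>x y. eR x \<odot> S y)"
    by (rule balRI) (simp_all add: eR_add S_add distl distr eR_C S_B_right assoc)
  have "DR b (\<lambda>x y. eR (c \<odot> x) \<odot> S y) = DR b (\<lambda>x y. eR x \<odot> S (iB c \<odot> y))"
    using takeuchiR[OF bal, of "iB c"] that by simp
  also have "\<dots> = DR b (\<lambda>x y. S (y \<odot> iB (eR x)) \<odot> c)"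
    using that by (simp add: S_B_left S_B_right assoc)
  also have "\<dots> = S b \<odot> c"
    unfolding psum_right psum_S counitR_left ..
  finally show ?thesis .
qed

text \<open>The convolution argument for Hopf algebras: both sides are inverse to multiplication.
  Counits are opened as \<open>p \<odot> S q\<close>, mixed coassociativity regroups the legs, and
  the product of a coproduct with its antipode then closes up.\<close>

lemma S_mult: "S (a \<odot> b) = S b \<odot> S a"
proof -
  have bal: "bal (\<lambda>x y. S x \<odot> eL y)"
    by (rule balI) (simp_all add: S_add eps_add distl distr S_C_left eps_B assoc)
  have "S (a \<odot> b) = D (a \<odot> b) (\<lambda>x y. S (iC (eL y) \<odot> x))"
    by (simp only: psum_S counit_right)
  also have "\<dots> = D (a \<odot> b) (\<lambda>x y. S x \<odot> eL y)"
    by (simp add: S_C_left)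
  also have "\<dots> = D b (\<lambda>x' y'. D a (\<lambda>x y. S (x \<odot> x') \<odot> eL (y \<odot> eL y')))"
    by (simp add: g_mult'[OF bal] eps_mult_B)
  \<comment> \<open>The counit of the second leg of \<open>a\<close> is opened by
    \<open>antipode_R\<close>; \<open>eL y'\<close> can be kept inside because it lies in
    \<open>B\<close>.\<close>
  also have "\<dots> = D b (\<lambda>x' y'. D a (\<lambda>x y. DR y (\<lambda>p q. S (x \<odot> x') \<odot> (p \<odot> (eL y' \<odot> S q)))))"
  proof -
    have "balR (\<lambda>p q. p \<odot> S q)"
      by (rule balRI) (simp_all add: S_add distl distr S_B_right assoc)
    then have "DR (y \<odot> eL y') (\<lambda>p q. p \<odot> S q) = DR y (\<lambda>p q. p \<odot> (eL y' \<odot> S q))" for y y'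
      by (simp add: gR_B_right assoc)
    then have "eL (y \<odot> eL y') = DR y (\<lambda>p q. p \<odot> (eL y' \<odot> S q))" for y y'
      by (simp only: antipode_R)
    then show ?thesis
      by (simp only: psum_left)
  qed
  also have "\<dots> = D b (\<lambda>x' y'. DR a (\<lambda>x q. D x (\<lambda>x1 x2. S (x1 \<odot> x') \<odot> (x2 \<odot> (eL y' \<odot> S q)))))"
  proof -
    have "balanced_LR m B C S (\<lambda>x p q. S (x \<odot> x') \<odot> (p \<odot> (eL y' \<odot> S q)))" for x' y'
      unfolding balanced_LR_def triadditive_def
      by (auto simp: S_add distl distr S_C_left S_B_right assoc comm_left)
    from mixed_LR[OF this] show ?thesis
      by simp
  qed
  also have "\<dots> = DR a (\<lambda>x q. D b (\<lambda>x' y'. D x (\<lambda>x1 x2. S (x1 \<odot> x') \<odot> (x2 \<odot> (eL y' \<odot> S q)))))"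
    by (rule psum_commute)
  \<comment> \<open>The counit \<open>eL y'\<close> is opened in the same way, which produces the
    factors \<open>S q' \<odot> S q\<close> in the order of the claim.\<close>
  also have "\<dots> = DR a (\<lambda>x q. D b (\<lambda>x' y'. DR y' (\<lambda>p' q'.
      D x (\<lambda>x1 x2. S (x1 \<odot> x') \<odot> (x2 \<odot> (p' \<odot> (S q' \<odot> S q)))))))"
  proof -
    have "D x (\<lambda>x1 x2. S (x1 \<odot> x') \<odot> (x2 \<odot> (eL y' \<odot> S q))) = DR y' (\<lambda>p' q'.
        D x (\<lambda>x1 x2. S (x1 \<odot> x') \<odot> (x2 \<odot> (p' \<odot> (S q' \<odot> S q)))))" for x x' y' q
    proof -
      have "DR y' (\<lambda>p' q'. p' \<odot> (S q' \<odot> S q)) = eL y' \<odot> S q"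
        by (simp add: psum_right antipode_R flip: assoc)
      then show ?thesis
        unfolding psum_commute[of "hR y'"] by (simp only: psum_left)
    qed
    then show ?thesis
      by simp
  qed
  also have "\<dots> = DR a (\<lambda>x q. DR b (\<lambda>x' q'. D x' (\<lambda>x1' x2'.
      D x (\<lambda>x1 x2. S (x1 \<odot> x1') \<odot> (x2 \<odot> (x2' \<odot> (S q' \<odot> S q)))))))"
  proof -
    have "balanced_LR m B C S (\<lambda>x' p' q'. D x (\<lambda>x1 x2. S (x1 \<odot> x') \<odot> (x2 \<odot> (p' \<odot> (S q' \<odot> S q)))))" for x q
    proof -
      have "D x (\<lambda>x1 x2. S (x1 \<odot> (c \<odot> x')) \<odot> (x2 \<odot> z)) = D x (\<lambda>x1 x2. S (x1 \<odot> x') \<odot> (x2 \<odot> (S c \<odot> z)))"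
        if "c \<in> C" for c x' z
      proof -
        have "bal (\<lambda>x1 x2. S (x1 \<odot> x') \<odot> (x2 \<odot> z))"
          by (rule balI) (simp_all add: S_add distl distr S_C_left assoc)
        from takeuchi[OF this that, of x] show ?thesis
          by (simp add: assoc)
      qed
      then show ?thesis
        unfolding balanced_LR_def triadditive_def
        by (auto simp: S_add distl distr S_B_right assoc psum_add)
    qed
    from mixed_LR[OF this] show ?thesis
      by simp
  qed
  \<comment> \<open>The double sum over left coproducts is the left coproduct of
    \<open>x \<odot> x'\<close>, so the antipode axiom closes it to a counit.\<close>
  also have "\<dots> = DR a (\<lambda>x q. DR b (\<lambda>x' q'. eR (x \<odot> x') \<odot> (S q' \<odot> S q)))"
  proof -
    have "bal (\<lambda>x y. S x \<odot> y)"
      by (rule balI) (simp_all add: S_add distl distr S_C_left assoc)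
    from g_mult'[OF this] have "eR (x \<odot> x') = D x' (\<lambda>x1' x2'. D x (\<lambda>x1 x2. S (x1 \<odot> x1') \<odot> (x2 \<odot> x2')))" for x x'
      by (simp add: antipode_L)
    then show ?thesis
      by (simp add: assoc flip: psum_right)
  qed
  also have "\<dots> = DR a (\<lambda>x q. S b \<odot> eR x \<odot> S q)"
    using eR_mult[OF eR_in] by (simp add: eR_eR psum_right flip: assoc)
  also have "\<dots> = DR a (\<lambda>x q. S b \<odot> S (q \<odot> iB (eR x)))"
    by (simp add: S_eR_right assoc)
  also have "\<dots> = S b \<odot> S a"
    unfolding psum_left psum_S counitR_left ..
  finally show ?thesis .
qed

lemma eR_of_B [simp]: "b \<in> B \<Longrightarrow> eR b = S b"
  by (rule R.eps_of_C)

lemma eR_of_C [simp]: "c \<in> C \<Longrightarrow> eR c = c"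
  by (rule R.eps_of_B)

text \<open>Apply \<open>eR\<close> to \<open>antipode_R\<close>: under \<open>eR\<close> the first
  leg can be replaced by its own counit, which \<open>S\<close> absorbs into the second leg, and the
  counit law finishes.\<close>

lemma eR_S: "eR (S a) = S (eL a)"
proof -
  have "S (eL a) = eR (DR a (\<lambda>x y. x \<odot> S y))"
    by (simp add: antipode_R)
  also have "\<dots> = DR a (\<lambda>x y. eR (x \<odot> S y))"
    by (rule psum_hom) (rule eR_add)
  also have "\<dots> = DR a (\<lambda>x y. eR (S (y \<odot> iB (eR x))))"
    by (simp add: S_eR_right eR_eR)
  also have "\<dots> = eR (S (DR a (\<lambda>x y. y \<odot> iB (eR x))))"
    by (rule psum_hom[symmetric, of "\<lambda>x. eR (S x)"]) (simp add: S_add eR_add)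
  finally show ?thesis
    by (simp add: counitR_left)
qed

lemma coassocR:
  assumes "balanced_LL (\<lambda>x y. y \<odot> x) B S (\<lambda>z y x. h x y z)"
  shows "DR a (\<lambda>x y. DR x (\<lambda>x' x''. h x' x'' y)) = DR a (\<lambda>x y. DR y (\<lambda>y' y''. h x y' y''))"
  using R.coassoc[OF assms, of a] by simp

text \<open>The coalgebra counterpart of \<open>S_mult\<close>: the flipped image of the left
  coproduct under \<open>S\<close> is a convolution inverse of the right coproduct, and so is the
  right coproduct of \<open>S a\<close>.\<close>

lemma gR_S: "DR (S a) f = D a (\<lambda>x y. f (S y) (S x))" if f: "balR f"
proof -
  \<comment> \<open>The pair (s, t) multiplied by the expected right coproduct of
    \<open>S w\<close>.\<close>
  define K where "K s t w = D w (\<lambda>w1 w2. f (s \<odot> S w2) (t \<odot> S w1))" for s t w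
  have K_bal: "bal (\<lambda>w1 w2. f (s \<odot> S w2) (t \<odot> S w1))" for s t
    by (rule balI) (simp_all add: S_add distl balRD[OF f] S_mult flip: assoc)
  have K_add: "K (s + s') t w = K s t w + K s' t w" "K s (t + t') w = K s t w + K s t' w"
    "K s t (w + w') = K s t w + K s t w'" for s s' t t' w w'
    using K_bal by (simp_all add: K_def distr balRD[OF f] psum_add g_add)
  have K_B: "K s t (w \<odot> b) = K s (t \<odot> S b) w" if "b \<in> B" for s t w b
    using g_B_right[OF K_bal that] by (simp add: K_def S_mult assoc)
  have K_C: "K (s \<odot> S b) t w = K s (t \<odot> b) w" if "b \<in> B" for s t w b
    using takeuchi[OF K_bal, of "iC b" w s t] that by (simp add: K_def S_mult assoc)
  have K_balR: "balR (\<lambda>s t. K s t w)" for w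
    by (rule balRI) (simp_all add: K_add K_C)
  \<comment> \<open>A counit is opened into a right coproduct times the expected coproduct of
    \<open>S w\<close>; the first factor can then be merged with that of \<open>S x\<close> by
    multiplicativity.\<close>
  have expand: "f (s \<odot> eL y) t = DR y (\<lambda>v w. DR v (\<lambda>p q. K (s \<odot> p) (t \<odot> q) w))" for s t y
  proof -
    have collapse: "DR r (\<lambda>q w. K (s \<odot> p) (t \<odot> q) w) = f (s \<odot> p \<odot> S r) t" for p r
    proof -
      have RL: "balanced_RL m B C S (\<lambda>q w1 w2. f (s \<odot> p \<odot> S w2) (t \<odot> q \<odot> S w1))"
        unfolding balanced_RL_def triadditive_def
        by (simp add: S_add distl distr balRD[OF f] S_mult flip: assoc)
      have "DR r (\<lambda>q w. K (s \<odot> p) (t \<odot> q) w) = D r (\<lambda>r1 r2. DR r1 (\<lambda>q w1. f (s \<odot> p \<odot> S r2) (t \<odot> q \<odot> S w1)))"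
        unfolding K_def by (rule mixed_RL[OF RL, symmetric])
      also have "\<dots> = D r (\<lambda>r1 r2. f (s \<odot> p \<odot> S r2) (t \<odot> DR r1 (\<lambda>q w1. q \<odot> S w1)))"
        by (simp add: psum_hom[of "\<lambda>z. f _ (t \<odot> z)"] distl balRD[OF f] assoc)
      also have "\<dots> = D r (\<lambda>r1 r2. f (s \<odot> p \<odot> S (eL r1 \<odot> r2)) t)"
        by (simp add: antipode_R S_mult balRD[OF f] flip: assoc)
      also have "\<dots> = f (s \<odot> p \<odot> S (D r (\<lambda>r1 r2. eL r1 \<odot> r2))) t"
        by (rule psum_hom[of "\<lambda>z. f (s \<odot> p \<odot> S z) t", symmetric]) (simp add: distl balRD[OF f] S_add)
      finally show ?thesis
        by (simp only: counit_left)
    qed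
    have "f (s \<odot> eL y) t = f (s \<odot> DR y (\<lambda>p r. p \<odot> S r)) t"
      by (simp only: antipode_R)
    also have "\<dots> = DR y (\<lambda>p r. f (s \<odot> p \<odot> S r) t)"
      by (simp add: psum_hom[of "\<lambda>z. f (s \<odot> z) t"] distl balRD[OF f] assoc)
    also have "\<dots> = DR y (\<lambda>p r. DR r (\<lambda>q w. K (s \<odot> p) (t \<odot> q) w))"
      by (simp add: collapse)
    also have "\<dots> = DR y (\<lambda>v w. DR v (\<lambda>p q. K (s \<odot> p) (t \<odot> q) w))"
    proof (rule coassocR[symmetric])
      show "balanced_LL (\<lambda>x y. y \<odot> x) B S (\<lambda>z y x. K (s \<odot> x) (t \<odot> y) z)"
        unfolding balanced_LL_def triadditive_def
        by (simp add: K_add distl K_B K_C flip: assoc)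
    qed
    finally show ?thesis .
  qed
  have bal: "bal (\<lambda>x y. S x \<odot> eL y)"
    by (rule balI) (simp_all add: S_add eps_add distl distr S_C_left eps_B assoc)
  have "DR (S a) f = DR (D a (\<lambda>x y. S (iC (eL y) \<odot> x))) f"
    by (simp only: psum_S counit_right)
  also have "\<dots> = D a (\<lambda>x y. DR (S x \<odot> eL y) f)"
    by (simp add: R.g_psum[OF f] S_C_left)
  also have "\<dots> = D a (\<lambda>x y. DR (S x) (\<lambda>s t. f (s \<odot> eL y) t))"
    by (simp add: gR_B_right[OF f])
  also have "\<dots> = D a (\<lambda>x y. DR y (\<lambda>v w. DR (S x) (\<lambda>s t. DR v (\<lambda>p q. K (s \<odot> p) (t \<odot> q) w))))"
    by (simp add: expand psum_commute[of "hR (S _)"])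
  also have "\<dots> = D a (\<lambda>x y. DR y (\<lambda>v w. DR (S x \<odot> v) (\<lambda>s t. K s t w)))"
    by (simp add: gR_mult[OF K_balR])
  also have "\<dots> = DR a (\<lambda>x w. D x (\<lambda>x v. DR (S x \<odot> v) (\<lambda>s t. K s t w)))"
  proof (rule mixed_LR[symmetric])
    show "balanced_LR m B C S (\<lambda>x v w. DR (S x \<odot> v) (\<lambda>s t. K s t w))"
      unfolding balanced_LR_def triadditive_def
      using gR_C_right[OF K_balR] gR_add[OF K_balR]
      by (simp add: distl distr S_add K_add psum_add K_B S_mult flip: assoc)
  qed
  \<comment> \<open>The product \<open>S x \<odot> v\<close> has closed up to \<open>eR x\<close>,
    which lies in \<open>C\<close> and has a trivial right coproduct.\<close>
  also have "\<dots> = DR a (\<lambda>x w. DR (eR x) (\<lambda>s t. K s t w))"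
    by (simp add: antipode_L flip: R.g_psum[OF K_balR])
  also have "\<dots> = DR a (\<lambda>x w. D (w \<odot> iB (eR x)) (\<lambda>w1 w2. f (S w2) (S w1)))"
    using K_bal[of \<one> \<one>]
    by (simp only: gR_of_C[OF K_balR eR_in]) (simp add: K_def g_B_right S_mult)
  also have "\<dots> = D a (\<lambda>x y. f (S y) (S x))"
    using K_bal[of \<one> \<one>] by (simp add: counitR_left flip: g_psum)
  finally show ?thesis .
qed

end

context hopf begin

lemma eL_S: "eL (S a) = S (eR a)"
proof -
  interpret O: hopf "\<lambda>x y. y \<odot> x" u C B S hR gL eR eL by (rule opposite)
  show ?thesis by (rule O.eR_S)
qed

end

section \<open>Integrals\<close>

definition right_dual :: "('a \<Rightarrow> 'a \<Rightarrow> 'a) \<Rightarrow> 'a set \<Rightarrow> ('a::ab_group_add \<Rightarrow> 'a) set" where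
  "right_dual m C =
    {\<Phi>. (\<forall>x y. \<Phi> (x + y) = \<Phi> x + \<Phi> y) \<and> (\<forall>x. \<Phi> x \<in> C) \<and> (\<forall>x. \<forall>c\<in>C. \<Phi> (m x c) = m (\<Phi> x) c)}"

lemma right_dualD:
  assumes "\<Phi> \<in> right_dual m C"
  shows "\<Phi> (x + y) = \<Phi> x + \<Phi> y" "\<Phi> x \<in> C" "c \<in> C \<Longrightarrow> \<Phi> (m x c) = m (\<Phi> x) c"
  using assms by (simp_all add: right_dual_def)

lemma right_dualI:
  assumes "\<And>x y. \<Phi> (x + y) = \<Phi> x + \<Phi> y" "\<And>x. \<Phi> x \<in> C" "\<And>x c. c \<in> C \<Longrightarrow> \<Phi> (m x c) = m (\<Phi> x) c"
  shows "\<Phi> \<in> right_dual m C"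
  using assms by (simp add: right_dual_def)

context hopf begin

abbreviation Dr where "Dr \<equiv> right_dual m C"

text \<open>The action of a functional on A through the right coproduct. With \<open>b\<close> fixed
  to a left integral it is the map of condition 4.a); an integral is a functional that coincides
  with its own action.\<close>

definition G where "G \<Phi> b = DR b (\<lambda>x y. y \<odot> iB (\<Phi> x))"

definition intOn where "intOn = {\<Lambda> \<in> Dr. \<forall>a. DR a (\<lambda>x y. y \<odot> iB (\<Lambda> x)) = \<Lambda> a}"

definition intIn where "intIn = {l. \<forall>a. a \<odot> l = eL a \<odot> l}"

lemma intOn_iff: "\<Lambda> \<in> intOn \<longleftrightarrow> \<Lambda> \<in> Dr \<and> (\<forall>a. G \<Lambda> a = \<Lambda> a)"
  by (auto simp: intOn_def G_def)

lemma intOn_Dr: "\<Lambda> \<in> intOn \<Longrightarrow> \<Lambda> \<in> Dr" and G_intOn: "\<Lambda> \<in> intOn \<Longrightarrow> G \<Lambda> a = \<Lambda> a"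
  by (simp_all add: intOn_iff)

lemma eR_Dr: "eR \<in> Dr"
  by (rule right_dualI) (simp_all add: eR_add eR_C)

lemma G_eR [simp]: "G eR b = b"
  by (simp add: G_def counitR_left)

lemma gR_S_mult: "DR (S a \<odot> b) f = D a (\<lambda>x y. DR b (\<lambda>p q. f (S y \<odot> p) (S x \<odot> q)))" if "balR f"
  using gR_S[of "\<lambda>s t. DR b (\<lambda>p q. f (s \<odot> p) (t \<odot> q))" a] R.bal_mult[OF that, of b]
  by (simp add: gR_mult[OF that])

context
  fixes \<Phi> assumes \<Phi>: "\<Phi> \<in> Dr"
begin

lemma bal_G: "balR (\<lambda>x y. y \<odot> iB (\<Phi> x))"
  by (rule balRI) (simp_all add: right_dualD[OF \<Phi>] iB_add distl distr iB_mult assoc)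

lemma G_add: "G \<Phi> (a + b) = G \<Phi> a + G \<Phi> b"
  by (simp add: G_def gR_add[OF bal_G])

lemma G_C_right: "c \<in> C \<Longrightarrow> G \<Phi> (b \<odot> c) = G \<Phi> b \<odot> c"
  by (simp add: G_def gR_C_right[OF bal_G] assoc right_dualD[OF \<Phi>] comm flip: psum_right)

lemma G_C_left: "c \<in> C \<Longrightarrow> G \<Phi> (c \<odot> b) = c \<odot> G \<Phi> b"
  by (simp add: G_def gR_C_left[OF bal_G] assoc psum_left)

text \<open>\<open>eR\<close> turns each summand into \<Phi>(x eR(y)), so the counit law applies;
  hence the action of a functional determines the functional.\<close>

lemma eR_G: "eR (G \<Phi> b) = \<Phi> b"
proof -
  have "eR (G \<Phi> b) = DR b (\<lambda>x y. eR (y \<odot> iB (\<Phi> x)))"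
    unfolding G_def by (rule psum_hom) (rule eR_add)
  also have "\<dots> = DR b (\<lambda>x y. \<Phi> (x \<odot> eR y))"
    by (simp add: eR_B right_dualD[OF \<Phi>])
  also have "\<dots> = \<Phi> (DR b (\<lambda>x y. x \<odot> eR y))"
    by (rule psum_hom[symmetric]) (rule right_dualD[OF \<Phi>])
  finally show ?thesis
    by (simp only: counitR_right)
qed

text \<open>By coassociativity the action of a functional is a comodule map.\<close>

lemma gR_G: "DR (G \<Phi> b) f = DR b (\<lambda>x y. f (G \<Phi> x) y)" if f: "balR f"
proof -
  have "DR (G \<Phi> b) f = DR b (\<lambda>x y. DR y (\<lambda>y1 y2. f (y1 \<odot> iB (\<Phi> x)) y2))"
    unfolding G_def R.g_psum[OF f] by (simp add: gR_B_right[OF f] right_dualD[OF \<Phi>])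
  also have "\<dots> = DR b (\<lambda>x y. DR x (\<lambda>x1 x2. f (x2 \<odot> iB (\<Phi> x1)) y))"
  proof (rule coassocR[symmetric])
    show "balanced_LL (\<lambda>x y. y \<odot> x) B S (\<lambda>z y x. f (y \<odot> iB (\<Phi> x)) z)"
      unfolding balanced_LL_def triadditive_def
      by (simp add: right_dualD[OF \<Phi>] iB_add distl distr balRD[OF f] iB_mult assoc)
         (metis assoc comm balRD(3)[OF f] right_dualD(2)[OF \<Phi>] S_B iB_in)
  qed
  also have "\<dots> = DR b (\<lambda>x y. f (G \<Phi> x) y)"
    unfolding G_def by (simp add: psum_hom[of "\<lambda>z. f z _"] balRD[OF f])
  finally show ?thesis .
qed

lemma Dr_S: "(\<lambda>x. \<Phi> (a \<odot> x)) \<in> Dr"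
  by (rule right_dualI) (simp_all add: distl right_dualD[OF \<Phi>] flip: assoc)

end

text \<open>The right coproduct of \<open>S y \<odot> b\<close> splits by \<open>gR_S\<close>, and
  mixed coassociativity brings together \<open>x1 \<odot> S x2\<close>, which is a counit.
  Translation by \<open>S a\<close> is thus expressed through the action of \<Phi> without inverting
  \<open>S\<close>.\<close>

lemma G_translate: "G (\<lambda>x. \<Phi> (S a \<odot> x)) b = DR a (\<lambda>x y. x \<odot> G \<Phi> (S y \<odot> b))"
  if \<Phi>: "\<Phi> \<in> Dr"
proof -
  have bal: "balR (\<lambda>p q. q \<odot> iB (\<Phi> (z \<odot> p)))" for z
    by (rule bal_G[OF Dr_S[OF \<Phi>]])
  have shift: "e \<odot> DR b (\<lambda>p q. q \<odot> iB (\<Phi> (z \<odot> p))) = DR b (\<lambda>p q. q \<odot> iB (\<Phi> (z \<odot> (S e \<odot> p))))"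
    if "e \<in> B" for e z
    using takeuchiR[OF bal that] by (simp add: assoc psum_left)
  have "DR a (\<lambda>x y. x \<odot> G \<Phi> (S y \<odot> b)) =
      DR a (\<lambda>x y. D y (\<lambda>y1 y2. DR b (\<lambda>p q. x \<odot> (S y1 \<odot> (q \<odot> iB (\<Phi> (S y2 \<odot> p)))))))"
    by (simp add: G_def gR_S_mult[OF bal_G[OF \<Phi>]] psum_left assoc)
  also have "\<dots> = D a (\<lambda>x y. DR x (\<lambda>x1 x2. DR b (\<lambda>p q. x1 \<odot> (S x2 \<odot> (q \<odot> iB (\<Phi> (S y \<odot> p)))))))"
  proof (rule mixed_RL[symmetric])
    show "balanced_RL (\<odot>) B C S (\<lambda>x y1 y2. DR b (\<lambda>p q. x \<odot> (S y1 \<odot> (q \<odot> iB (\<Phi> (S y2 \<odot> p))))))"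
      unfolding balanced_RL_def triadditive_def
      by (simp add: right_dualD[OF \<Phi>] iB_add distl distr S_add psum_add psum_left S_mult assoc shift)
  qed
  also have "\<dots> = D a (\<lambda>x y. eL x \<odot> DR b (\<lambda>p q. q \<odot> iB (\<Phi> (S y \<odot> p))))"
    unfolding assoc[symmetric, of _ "S _"] psum_left psum_right antipode_R ..
  also have "\<dots> = D a (\<lambda>x y. DR b (\<lambda>p q. q \<odot> iB (\<Phi> (S (eL x \<odot> y) \<odot> p))))"
    by (simp add: shift S_mult assoc)
  also have "\<dots> = DR b (\<lambda>p q. q \<odot> iB (\<Phi> (S (D a (\<lambda>x y. eL x \<odot> y)) \<odot> p)))"
    by (rule psum_hom[symmetric, of "\<lambda>z. DR b (\<lambda>p q. q \<odot> iB (\<Phi> (S z \<odot> p)))"])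
      (simp add: right_dualD[OF \<Phi>] iB_add distl distr S_add psum_add)
  also have "\<dots> = G (\<lambda>x. \<Phi> (S a \<odot> x)) b"
    by (simp only: counit_left G_def)
  finally show ?thesis ..
qed

lemma intIn_D: "l \<in> intIn \<Longrightarrow> a \<odot> l = eL a \<odot> l"
  by (simp add: intIn_def)

text \<open>The elements \<open>a\<close> and \<open>iC (eL a)\<close> have the same counit, so they
  act equally on a left integral.\<close>

lemma intIn_D': "l \<in> intIn \<Longrightarrow> a \<odot> l = iC (eL a) \<odot> l"
  using intIn_D[of l "iC (eL a)"] intIn_D[of l a] by simp

text \<open>A counit inserted into \<open>S a\<close> acts on \<open>l\<close> like the element
  itself, so it can be replaced by that element and spread over both legs of \<open>l\<close> by
  multiplicativity. On the first leg it then meets its antipode.\<close>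

lemma intIn_shift: "DR l (\<lambda>x y. f x (a \<odot> y)) = DR l (\<lambda>x y. f (S a \<odot> x) y)"
  if l: "l \<in> intIn" and f: "balR f"
proof -
  have fl: "balR (\<lambda>x y. f (p \<odot> x) (q \<odot> y))" for p q
    by (rule balRI) (simp_all add: distl balRD[OF f] flip: assoc)
  have shift: "DR l (\<lambda>x y. f (p \<odot> (p' \<odot> (S b \<odot> x))) (q \<odot> y)) =
      DR l (\<lambda>x y. f (p \<odot> (p' \<odot> x)) (q \<odot> (b \<odot> y)))" if "b \<in> B" for p p' q b
    using takeuchiR[OF fl that, of l "p \<odot> p'" q] by (simp add: assoc)
  have fl1: "balR (\<lambda>x y. f (p \<odot> x) y)" for p
    using fl[of p \<one>] by simp
  have "DR l (\<lambda>x y. f (S a \<odot> x) y) = DR l (\<lambda>x y. f (S (D a (\<lambda>p q. iC (eL q) \<odot> p)) \<odot> x) y)"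
    by (simp only: counit_right)
  also have "\<dots> = D a (\<lambda>p q. DR l (\<lambda>x y. f (S (iC (eL q) \<odot> p) \<odot> x) y))"
    by (rule psum_hom[of "\<lambda>z. DR l (\<lambda>x y. f (S z \<odot> x) y)"])
      (simp add: S_add distr balRD[OF f] psum_add)
  also have "\<dots> = D a (\<lambda>p q. DR (eL q \<odot> l) (\<lambda>x y. f (S p \<odot> x) y))"
    by (simp add: gR_B_left[OF fl1] S_C_left assoc)
  also have "\<dots> = D a (\<lambda>p q. DR q (\<lambda>q1 q2. DR l (\<lambda>x y. f (S p \<odot> (q1 \<odot> x)) (q2 \<odot> y))))"
    by (simp only: intIn_D[OF l, symmetric] gR_mult[OF fl1])
  also have "\<dots> = DR a (\<lambda>z q2. D z (\<lambda>p q1. DR l (\<lambda>x y. f (S p \<odot> (q1 \<odot> x)) (q2 \<odot> y))))"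
  proof (rule mixed_LR[symmetric])
    show "balanced_LR (\<odot>) B C S (\<lambda>p q1 q2. DR l (\<lambda>x y. f (S p \<odot> (q1 \<odot> x)) (q2 \<odot> y)))"
      unfolding balanced_LR_def triadditive_def
      by (simp add: S_add distl distr balRD[OF f] psum_add S_mult assoc shift)
  qed
  also have "\<dots> = DR a (\<lambda>z q2. DR l (\<lambda>x y. f (eR z \<odot> x) (q2 \<odot> y)))"
  proof -
    have "D z (\<lambda>p q1. DR l (\<lambda>x y. f (S p \<odot> (q1 \<odot> x)) (q2 \<odot> y))) = DR l (\<lambda>x y. f (eR z \<odot> x) (q2 \<odot> y))" for z q2
      unfolding antipode_L[symmetric] assoc[symmetric]
      by (rule psum_hom[of "\<lambda>w. DR l (\<lambda>x y. f (w \<odot> x) (q2 \<odot> y))", symmetric])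
        (simp add: distr balRD[OF f] psum_add)
    then show ?thesis
      by simp
  qed
  also have "\<dots> = DR a (\<lambda>z q2. DR l (\<lambda>x y. f x ((q2 \<odot> iB (eR z)) \<odot> y)))"
  proof -
    have "DR l (\<lambda>x y. f (eR z \<odot> x) (q \<odot> y)) = DR l (\<lambda>x y. f x (q \<odot> (iB (eR z) \<odot> y)))" for z q
      using shift[of "iB (eR z)" \<one> \<one> q] by simp
    then show ?thesis
      by (simp add: assoc)
  qed
  also have "\<dots> = DR l (\<lambda>x y. f x (DR a (\<lambda>z q2. q2 \<odot> iB (eR z)) \<odot> y))"
    by (rule psum_hom[of "\<lambda>w. DR l (\<lambda>x y. f x (w \<odot> y))", symmetric])
      (simp add: distr balRD[OF f] psum_add)
  finally show ?thesis
    by (simp only: counitR_left)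
qed

text \<open>The action \<open>G\<close> of any functional is left \<open>C\<close>-linear, and an
  integral is its own action.\<close>

lemma intOn_C_left: "\<Lambda> \<in> intOn \<Longrightarrow> c \<in> C \<Longrightarrow> \<Lambda> (c \<odot> a) = c \<odot> \<Lambda> a"
  by (metis G_C_left G_intOn intOn_Dr)

lemma intOn_B_left: "b \<in> B \<Longrightarrow> \<Lambda> \<in> intOn \<Longrightarrow> (\<lambda>x. \<Lambda> (b \<odot> x)) \<in> intOn"
  by (simp add: intOn_iff Dr_S) (simp add: G_def gR_B_left[OF bal_G, symmetric])

text \<open>Invariance under the right coproduct implies invariance under the left one: on
  \<open>C\<close> the map \<open>S\<close> agrees with \<open>eL\<close>, so the integral property
  can be inserted under \<open>eL\<close>, and mixed coassociativity reduces the sum to the left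
  counit law.\<close>

lemma intOn_L: "D z (\<lambda>x y. S (\<Lambda> x) \<odot> y) = \<Lambda> z" if "\<Lambda> \<in> intOn"
proof -
  have \<Lambda>: "\<Lambda> \<in> Dr" "\<And>a. DR a (\<lambda>x y. y \<odot> iB (\<Lambda> x)) = \<Lambda> a"
    using that by (simp_all add: intOn_def)
  have bal: "bal (\<lambda>x y. eL x \<odot> y)"
    by (rule balI) (simp_all add: eps_add distl distr eps_C assoc)
  have "D z (\<lambda>x y. S (\<Lambda> x) \<odot> y) = D z (\<lambda>x y. eL (DR x (\<lambda>p q. q \<odot> iB (\<Lambda> p))) \<odot> y)"
    by (simp add: \<Lambda> right_dualD[OF \<Lambda>(1)])
  also have "\<dots> = D z (\<lambda>x y. DR x (\<lambda>p q. eL (q \<odot> iB (\<Lambda> p)) \<odot> y))"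
    by (simp add: psum_hom[of "\<lambda>w. eL w \<odot> _"] distr eps_add)
  also have "\<dots> = DR z (\<lambda>p r. D r (\<lambda>q y. eL (q \<odot> iB (\<Lambda> p)) \<odot> y))"
  proof (rule mixed_RL)
    show "balanced_RL (\<odot>) B C S (\<lambda>p q y. eL (q \<odot> iB (\<Lambda> p)) \<odot> y)"
      unfolding balanced_RL_def triadditive_def
      by (simp add: right_dualD[OF \<Lambda>(1)] iB_add distl distr eps_add iB_mult eps_C assoc)
  qed
  also have "\<dots> = DR z (\<lambda>p r. D (r \<odot> iB (\<Lambda> p)) (\<lambda>q y. eL q \<odot> y))"
    by (simp add: g_B_right[OF bal] right_dualD[OF \<Lambda>(1)])
  also have "\<dots> = \<Lambda> z"
    by (simp add: counit_left \<Lambda>)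
  finally show ?thesis .
qed

definition dual_pair where
  "dual_pair \<Lambda> l \<longleftrightarrow> \<Lambda> \<in> intOn \<and> l \<in> intIn \<and> \<Lambda> l = \<one> \<and> (\<forall>b. \<Lambda> (S l \<odot> b) = eR b)"

text \<open>\<open>G_translate\<close> at \<open>l\<close>, where the translate is \<open>eR\<close>
  and \<open>G eR\<close> is the identity. So the pairs of \<open>x\<close> and \<open>S y\<close>,
  over the legs of \<open>l\<close>, form a dual basis for \<Lambda>.\<close>

lemma intOn_dual_basis:
  assumes "\<Lambda> \<in> intOn" "\<And>x. \<Lambda> (S l \<odot> x) = eR x"
  shows "DR l (\<lambda>x y. x \<odot> \<Lambda> (S y \<odot> a)) = a"
  using G_translate[OF intOn_Dr[OF assms(1)], of l a] by (simp add: assms G_intOn)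

lemma S_G: "\<Phi> \<in> Dr \<Longrightarrow> S (G \<Phi> l) = DR l (\<lambda>x y. \<Phi> x \<odot> S y)"
  by (simp add: G_def S_B_right right_dualD flip: psum_S)

text \<open>Left linearity of \<Lambda> and right linearity of \<Phi> reduce the left side to \<Phi>
  of the dual basis expansion of \<open>b\<close>. Every functional is thereby represented by an
  element of the form \<open>S a\<close>.\<close>

lemma intOn_S_G: "\<Lambda> (S (G \<Phi> l) \<odot> b) = \<Phi> b"
  if \<Lambda>: "\<Lambda> \<in> intOn" and \<Lambda>_S_l: "\<And>b. \<Lambda> (S l \<odot> b) = eR b" and \<Phi>: "\<Phi> \<in> Dr"
proof -
  note \<Lambda>_D = right_dualD[OF intOn_Dr[OF \<Lambda>]]
  have "\<Lambda> (S (G \<Phi> l) \<odot> b) = DR l (\<lambda>x y. \<Lambda> (\<Phi> x \<odot> S y \<odot> b))"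
    by (simp add: S_G[OF \<Phi>] psum_hom[of "\<lambda>w. \<Lambda> (w \<odot> b)"] distr \<Lambda>_D)
  also have "\<dots> = DR l (\<lambda>x y. \<Phi> (x \<odot> \<Lambda> (S y \<odot> b)))"
    by (simp add: intOn_C_left[OF \<Lambda>] right_dualD[OF \<Phi>] \<Lambda>_D assoc)
  also have "\<dots> = \<Phi> (DR l (\<lambda>x y. x \<odot> \<Lambda> (S y \<odot> b)))"
    by (simp add: psum_hom[of \<Phi>] right_dualD[OF \<Phi>])
  also have "\<dots> = \<Phi> (G (\<lambda>x. \<Lambda> (S l \<odot> x)) b)"
    by (simp add: G_translate[OF intOn_Dr[OF \<Lambda>]] G_intOn[OF \<Lambda>])
  finally show ?thesis
    by (simp add: \<Lambda>_S_l)
qed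

section \<open>Bijectivity of the antipode\<close>

context
  fixes \<Lambda> l
  assumes \<Lambda>: "\<Lambda> \<in> intOn" and l: "l \<in> intIn" and \<Lambda>_l: "\<Lambda> l = \<one>"
begin

lemmas \<Lambda>_dual = intOn_Dr[OF \<Lambda>]
lemmas \<Lambda>_D = right_dualD[OF \<Lambda>_dual]

text \<open>Invariance of \<Lambda> under the left coproduct splits \<open>b \<odot> x\<close>, so
  that a leg of \<open>l\<close> meets its antipode and closes up to a counit. That counit is
  absorbed by \<open>l\<close>, and the normalisation of \<Lambda> on \<open>l\<close> leaves the
  counit law for \<open>b\<close>.\<close>

lemma S_right_inverse: "S (G (\<lambda>x. \<Lambda> (b \<odot> x)) l) = b"
proof -
  have bal: "bal (\<lambda>x y. S (\<Lambda> x) \<odot> y)"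
    by (rule balI) (simp_all add: \<Lambda>_D S_add distl distr intOn_C_left[OF \<Lambda>] S_C_left assoc)
  have bal': "bal (\<lambda>b1 b2. S (\<Lambda> (b1 \<odot> x)) \<odot> (b2 \<odot> z))" for x z
    by (rule balI) (simp_all add: \<Lambda>_D S_add distl distr intOn_C_left[OF \<Lambda>] S_C_left assoc)
  have shift: "D b (\<lambda>b1 b2. S (\<Lambda> (b1 \<odot> (c \<odot> x))) \<odot> (b2 \<odot> z)) = D b (\<lambda>b1 b2. S (\<Lambda> (b1 \<odot> x)) \<odot> (b2 \<odot> (S c \<odot> z)))"
    if "c \<in> C" for c x z
    using takeuchi[OF bal' that, of b x z] by (simp add: assoc)
  have "S (G (\<lambda>x. \<Lambda> (b \<odot> x)) l) = DR l (\<lambda>x y. D (b \<odot> x) (\<lambda>p q. S (\<Lambda> p) \<odot> q) \<odot> S y)"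
    by (simp add: S_G Dr_S[OF \<Lambda>_dual] intOn_L[OF \<Lambda>])
  also have "\<dots> = DR l (\<lambda>x y. D x (\<lambda>x1 x2. D b (\<lambda>b1 b2. S (\<Lambda> (b1 \<odot> x1)) \<odot> (b2 \<odot> (x2 \<odot> S y)))))"
    by (simp add: g_mult'[OF bal] assoc flip: psum_right)
  also have "\<dots> = D l (\<lambda>x y. DR y (\<lambda>y' y''. D b (\<lambda>b1 b2. S (\<Lambda> (b1 \<odot> x)) \<odot> (b2 \<odot> (y' \<odot> S y'')))))"
  proof (rule mixed_LR)
    show "balanced_LR (\<odot>) B C S (\<lambda>x1 x2 y. D b (\<lambda>b1 b2. S (\<Lambda> (b1 \<odot> x1)) \<odot> (b2 \<odot> (x2 \<odot> S y))))"
      unfolding balanced_LR_def triadditive_def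
      by (simp add: \<Lambda>_D S_add distl distr psum_add shift assoc S_mult)
  qed
  also have "\<dots> = D l (\<lambda>x y. D b (\<lambda>b1 b2. S (\<Lambda> (b1 \<odot> x)) \<odot> (b2 \<odot> eL y)))"
    unfolding psum_commute[of "hR _"] by (simp only: psum_left antipode_R)
  also have "\<dots> = D l (\<lambda>x y. D b (\<lambda>b1 b2. S (\<Lambda> (b1 \<odot> (iC (eL y) \<odot> x))) \<odot> b2))"
    using shift[of "iC (eL _)" _ \<one>] by simp
  also have "\<dots> = D b (\<lambda>b1 b2. S (\<Lambda> (b1 \<odot> D l (\<lambda>x y. iC (eL y) \<odot> x))) \<odot> b2)"
    by (rule psum_hom[of "\<lambda>w. D b (\<lambda>b1 b2. S (\<Lambda> (b1 \<odot> w)) \<odot> b2)", symmetric])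
      (simp add: \<Lambda>_D S_add distl distr psum_add)
  also have "\<dots> = D b (\<lambda>b1 b2. eL b1 \<odot> b2)"
  proof -
    have "\<Lambda> (b1 \<odot> l) = iC (eL b1)" for b1
      by (subst intIn_D'[OF l]) (simp add: intOn_C_left[OF \<Lambda>] \<Lambda>_l)
    then show ?thesis
      by (simp add: counit_right)
  qed
  finally show ?thesis
    by (simp only: counit_left)
qed

text \<open>By \<open>intIn_shift\<close> the translation by \<open>S a\<close> on the first leg of
  \<open>l\<close> becomes a left factor \<open>a\<close>, which comes out of the sum.\<close>

lemma G_translate_l: "G (\<lambda>x. \<Lambda> (S a \<odot> x)) l = a"
proof -
  have "G (\<lambda>x. \<Lambda> (S a \<odot> x)) l = DR l (\<lambda>x y. a \<odot> y \<odot> iB (\<Lambda> x))"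
    unfolding G_def by (rule intIn_shift[OF l bal_G[OF \<Lambda>_dual], symmetric])
  also have "\<dots> = a \<odot> G \<Lambda> l"
    by (simp add: G_def assoc psum_left)
  finally show ?thesis
    by (simp add: G_intOn[OF \<Lambda>] \<Lambda>_l)
qed

lemma antipode_bij: "bij S"
  by (rule o_bij[of "\<lambda>b. G (\<lambda>x. \<Lambda> (b \<odot> x)) l"]) (simp_all add: fun_eq_iff G_translate_l S_right_inverse)

end

section \<open>Bijections attached to a dual pair\<close>

context
  fixes \<Lambda> l
  assumes dual_pair: "dual_pair \<Lambda> l"
begin

lemma \<Lambda>_intOn: "\<Lambda> \<in> intOn" and l_intIn: "l \<in> intIn" and \<Lambda>_l: "\<Lambda> l = \<one>"
  and \<Lambda>_S_l: "\<Lambda> (S l \<odot> b) = eR b"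
  using dual_pair by (simp_all add: dual_pair_def)

lemmas \<Lambda>_Dr = intOn_Dr[OF \<Lambda>_intOn]
lemmas \<Lambda>_S_G = intOn_S_G[OF \<Lambda>_intOn \<Lambda>_S_l]
lemmas G_translate_l' = G_translate_l[OF \<Lambda>_intOn l_intIn \<Lambda>_l]

lemma bij_G_l: "bij_betw (\<lambda>\<Phi>. G \<Phi> l) Dr UNIV"
  by (rule bij_betw_byWitness[of _ "\<lambda>a x. \<Lambda> (S a \<odot> x)"])
    (auto simp: \<Lambda>_S_G G_translate_l' Dr_S[OF \<Lambda>_Dr])

lemma bij_\<Lambda>: "bij_betw (\<lambda>a x. \<Lambda> (a \<odot> x)) UNIV Dr"
proof (rule bij_betw_byWitness[of _ "\<lambda>\<Phi>. S (G \<Phi> l)"])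
  show "\<forall>a\<in>UNIV. S (G (\<lambda>x. \<Lambda> (a \<odot> x)) l) = a"
    by (simp add: S_right_inverse[OF \<Lambda>_intOn l_intIn \<Lambda>_l])
  show "\<forall>\<Phi>\<in>Dr. (\<lambda>x. \<Lambda> (S (G \<Phi> l) \<odot> x)) = \<Phi>"
    by (simp add: \<Lambda>_S_G)
qed (auto simp: Dr_S[OF \<Lambda>_Dr])

lemmas G_dual_basis = intOn_dual_basis[OF \<Lambda>_intOn \<Lambda>_S_l]

text \<open>This is the map of condition 4.b) for the same \<open>l\<close>, with \<omega> = t_R
  composed with the functional and S t_R = s_R. It is proved directly with the dual basis formed
  from the legs of \<open>l\<close>, and not through the coopposite structure, which would not
  provide a common integral.\<close>

lemma bij_right_B: "bij_betw (\<lambda>\<omega>. DR l (\<lambda>x y. x \<odot> S (\<omega> y))) (right_dual m B) UNIV"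
proof (rule bij_betw_byWitness[of _ "\<lambda>b y. iB (\<Lambda> (S y \<odot> b))"])
  show "\<forall>b\<in>UNIV. DR l (\<lambda>x y. x \<odot> S (iB (\<Lambda> (S y \<odot> b)))) = b"
    by (simp add: right_dualD[OF \<Lambda>_Dr] G_dual_basis)
  show "\<forall>\<omega>\<in>right_dual m B. (\<lambda>y. iB (\<Lambda> (S y \<odot> DR l (\<lambda>p q. p \<odot> S (\<omega> q))))) = \<omega>"
  proof (intro ballI ext)
    fix \<omega> y assume \<omega>: "\<omega> \<in> right_dual m B"
    note \<omega>_D = right_dualD[OF \<omega>]
    have "\<Lambda> (S y \<odot> DR l (\<lambda>p q. p \<odot> S (\<omega> q))) = DR l (\<lambda>p q. \<Lambda> (S y \<odot> p) \<odot> S (\<omega> q))"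
      by (subst psum_hom[of "\<lambda>w. \<Lambda> (S y \<odot> w)"])
        (simp_all add: distl right_dualD[OF \<Lambda>_Dr] \<omega>_D flip: assoc)
    also have "\<dots> = DR l (\<lambda>p q. S (\<omega> (q \<odot> iB (\<Lambda> (S y \<odot> p)))))"
      by (simp add: \<omega>_D right_dualD[OF \<Lambda>_Dr] S_B_right)
    also have "\<dots> = S (\<omega> (G (\<lambda>x. \<Lambda> (S y \<odot> x)) l))"
      unfolding G_def by (rule psum_hom[symmetric, of "\<lambda>w. S (\<omega> w)"]) (simp add: \<omega>_D S_add)
    finally show "iB (\<Lambda> (S y \<odot> DR l (\<lambda>p q. p \<odot> S (\<omega> q)))) = \<omega> y"
      by (simp add: G_translate_l' \<omega>_D)
  qed
  show "range (\<lambda>b y. iB (\<Lambda> (S y \<odot> b))) \<subseteq> right_dual m B"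
    by (auto intro!: right_dualI simp: right_dualD[OF \<Lambda>_Dr] S_add distr iB_add S_mult assoc
      intOn_C_left[OF \<Lambda>_intOn] iB_mult)
qed simp

end

end

section \<open>The projection onto the integrals\<close>

lemma sum_hom:
  fixes h :: "'b::ab_group_add \<Rightarrow> 'c::ab_group_add"
  assumes "\<And>x y. h (x + y) = h x + h y"
  shows "h (\<Sum>i<n. f i) = (\<Sum>i<(n::nat). h (f i))"
proof -
  have "h 0 = 0"
    using assms[of 0 0] by simp
  then show ?thesis
    by (induction n) (simp_all add: assms)
qed

lemma psum_sum: "psum xs (\<lambda>x y. \<Sum>i<(n::nat). f i x y) = (\<Sum>i<n. psum xs (f i))"
  by (induction n) (simp_all add: psum_add)

definition frobenius_form :: "('a \<Rightarrow> 'a \<Rightarrow> 'a) \<Rightarrow> 'a set \<Rightarrow> ('a::ab_group_add \<Rightarrow> 'a) \<Rightarrow> bool" where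
  "frobenius_form m C \<psi> \<longleftrightarrow> \<psi> \<in> right_dual m C \<and> (\<forall>c\<in>C. \<forall>x. \<psi> (m c x) = m c (\<psi> x)) \<and>
    (\<exists>uv. \<forall>a. psum uv (\<lambda>u v. m (\<psi> (m a u)) v) = a \<and> psum uv (\<lambda>u v. m u (\<psi> (m v a))) = a)"

abbreviation (input) left_dual :: "('a \<Rightarrow> 'a \<Rightarrow> 'a) \<Rightarrow> 'a set \<Rightarrow> ('a::ab_group_add \<Rightarrow> 'a) set" where
  "left_dual m C \<equiv> right_dual (\<lambda>x y. m y x) C"

context base_pair begin

lemma sum_left: "(\<Sum>i<(n::nat). z \<odot> f i) = z \<odot> (\<Sum>i<n. f i)"
  by (rule sum_hom[symmetric]) (rule distl)

lemma sum_right: "(\<Sum>i<(n::nat). f i \<odot> z) = (\<Sum>i<n. f i) \<odot> z"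
  by (rule sum_hom[symmetric, of "\<lambda>x. x \<odot> z"]) (rule distr)

lemma C_sum: "(\<And>i. f i \<in> C) \<Longrightarrow> (\<Sum>i<(n::nat). f i) \<in> C"
  by (induction n) simp_all

lemma C_psum: "(\<And>x y. f x y \<in> C) \<Longrightarrow> psum xs f \<in> C"
  by (rule psum_in) simp_all

lemma right_dual_sum:
  assumes "\<And>i. \<Phi> i \<in> right_dual m C"
  shows "(\<lambda>x. \<Sum>i<(n::nat). \<Phi> i x) \<in> right_dual m C"
  by (rule right_dualI) (simp_all add: right_dualD[OF assms] sum.distrib sum_right C_sum)

end

text \<open>\<open>b\<close> and \<open>\<beta>\<close> form a dual basis of A as a right
  \<open>C\<close>-module, \<open>F\<close> and \<open>e\<close> one of A as a left
  \<open>C\<close>-module. The common length \<open>n\<close> is achieved by padding with zeros in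
  \<open>hopf_fgpI\<close>.\<close>

locale hopf_fgp = hopf +
  fixes n :: nat and b :: "nat \<Rightarrow> 'a" and \<beta> :: "nat \<Rightarrow> 'a \<Rightarrow> 'a"
    and e :: "nat \<Rightarrow> 'a" and F :: "nat \<Rightarrow> 'a \<Rightarrow> 'a"
  assumes beta_dual: "\<beta> i \<in> right_dual m C" and right_basis: "(\<Sum>i<n. b i \<odot> \<beta> i a) = a"
    and F_dual: "F i \<in> left_dual m C" and left_basis: "(\<Sum>i<n. F i a \<odot> e i) = a"
begin

text \<open>The analogue of \<open>G\<close> for the left coproduct and left linear functionals.
  Mixed coassociativity makes it commute with the right coproduct.\<close>

definition H where "H f z = D z (\<lambda>x y. S (f x) \<odot> y)"

context
  fixes f assumes f: "f \<in> left_dual m C"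
begin

lemmas f_D = right_dualD[OF f]

lemma bal_H: "bal (\<lambda>x y. S (f x) \<odot> y)"
  by (rule balI) (simp_all add: f_D S_add distl distr S_C_left assoc)

lemma H_add: "H f (a + a') = H f a + H f a'"
  by (simp add: H_def g_add[OF bal_H])

lemma H_C_left: "c \<in> C \<Longrightarrow> H f (c \<odot> a) = c \<odot> H f a"
  by (simp add: H_def g_C_left[OF bal_H] comm_left f_D psum_left)

lemma H_C_right: "c \<in> C \<Longrightarrow> H f (a \<odot> c) = H f a \<odot> c"
  by (simp add: H_def g_C_right[OF bal_H] assoc[symmetric] psum_right)

lemma gR_H: "DR (H f z) h = DR z (\<lambda>x y. h (H f x) y)" if h: "balR h"
proof -
  have "DR (H f z) h = D z (\<lambda>x y. DR y (\<lambda>y1 y2. h (S (f x) \<odot> y1) y2))"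
    unfolding H_def R.g_psum[OF h] by (simp add: gR_B_left[OF h] f_D)
  also have "\<dots> = DR z (\<lambda>x y. D x (\<lambda>x1 x2. h (S (f x1) \<odot> x2) y))"
  proof (rule mixed_LR[symmetric])
    show "balanced_LR (\<odot>) B C S (\<lambda>x y1 y2. h (S (f x) \<odot> y1) y2)"
      unfolding balanced_LR_def triadditive_def
      by (simp add: f_D S_add distl distr balRD[OF h] S_mult assoc) (simp add: balRD[OF h] flip: assoc)
  qed
  also have "\<dots> = DR z (\<lambda>x y. h (H f x) y)"
    unfolding H_def by (simp add: psum_hom[of "\<lambda>w. h w _"] balRD[OF h])
  finally show ?thesis .
qed

lemma eR_H_Dr: "(\<lambda>x. eR (H f x)) \<in> Dr"
  by (rule right_dualI) (simp_all add: H_add eR_add H_C_right eR_C)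

context
  fixes \<Phi> assumes \<Phi>: "\<Phi> \<in> Dr"
begin

lemma eR_H_G_Dr: "(\<lambda>x. eR (H f (G \<Phi> x))) \<in> Dr"
  by (rule right_dualI) (simp_all add: H_add eR_add H_C_right eR_C G_add[OF \<Phi>] G_C_right[OF \<Phi>])

text \<open>Both \<open>H f\<close> and \<open>G \<Phi>\<close> commute with the right coproduct on
  its first leg; by the counit law a map with this property is the action of its composite with
  \<open>eR\<close>.\<close>

lemma G_eR_H_G: "G (\<lambda>x. eR (H f (G \<Phi> x))) a = H f (G \<Phi> a)"
proof -
  have "H f (G \<Phi> a) = DR (H f (G \<Phi> a)) (\<lambda>x y. y \<odot> iB (eR x))"
    by (simp only: counitR_left)
  also have "\<dots> = DR (G \<Phi> a) (\<lambda>x y. y \<odot> iB (eR (H f x)))"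
    by (rule gR_H) (rule bal_G[OF eR_Dr])
  also have "\<dots> = G (\<lambda>x. eR (H f (G \<Phi> x))) a"
    unfolding G_def[of "\<lambda>x. eR (H f (G \<Phi> x))"] by (rule gR_G[OF \<Phi>]) (rule bal_G[OF eR_H_Dr])
  finally show ?thesis ..
qed

end

end

lemma G_sum: "G (\<lambda>x. \<Sum>i<(k::nat). \<Phi> i x) a = (\<Sum>i<k. G (\<Phi> i) a)" if "\<And>i. \<Phi> i \<in> Dr"
proof (induction k)
  case (Suc k)
  have "(\<Sum>i<k. \<Phi> i x) \<in> C" for x
    by (rule C_sum) (rule right_dualD[OF that])
  then show ?case
    using Suc by (simp add: G_def iB_add right_dualD[OF that] distl psum_add)
qed (simp add: G_def)

lemma G_plus: "\<Phi> \<in> Dr \<Longrightarrow> \<Psi> \<in> Dr \<Longrightarrow> G (\<lambda>x. \<Phi> x + \<Psi> x) a = G \<Phi> a + G \<Psi> a"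
  by (simp add: G_def iB_add right_dualD distl psum_add)

lemma G_zero_fun [simp]: "G (\<lambda>x. 0) a = 0"
  by (simp add: G_def)

lemma G_zero [simp]: "\<Phi> \<in> Dr \<Longrightarrow> G \<Phi> 0 = 0"
  using G_add[of \<Phi> 0 0] by simp

lemma right_expand: "\<Phi> a = (\<Sum>i<n. \<Phi> (b i) \<odot> \<beta> i a)" if "\<Phi> \<in> Dr"
proof -
  have "\<Phi> a = \<Phi> (\<Sum>i<n. b i \<odot> \<beta> i a)"
    by (simp add: right_basis)
  also have "\<dots> = (\<Sum>i<n. \<Phi> (b i) \<odot> \<beta> i a)"
    by (subst sum_hom[of \<Phi>]) (simp_all add: right_dualD[OF that] right_dualD[OF beta_dual])
  finally show ?thesis .
qed

lemma G_right_expand: "G \<Phi> a = (\<Sum>i<n. G \<Phi> (b i) \<odot> \<beta> i a)" if "\<Phi> \<in> Dr"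
proof -
  have "G \<Phi> a = G \<Phi> (\<Sum>i<n. b i \<odot> \<beta> i a)"
    by (simp add: right_basis)
  also have "\<dots> = (\<Sum>i<n. G \<Phi> (b i) \<odot> \<beta> i a)"
    by (subst sum_hom[of "G \<Phi>"]) (simp_all add: G_add[OF that] G_C_right[OF that] right_dualD[OF beta_dual])
  finally show ?thesis .
qed

lemmas F_D = right_dualD[OF F_dual]

lemma G_left_expand: "G \<Phi> a = (\<Sum>i<n. F i a \<odot> G \<Phi> (e i))" if "\<Phi> \<in> Dr"
proof -
  have "G \<Phi> a = G \<Phi> (\<Sum>i<n. F i a \<odot> e i)"
    by (simp add: left_basis)
  also have "\<dots> = (\<Sum>i<n. F i a \<odot> G \<Phi> (e i))"
    by (subst sum_hom[of "G \<Phi>"]) (simp_all add: G_add[OF that] G_C_left[OF that] F_D)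
  finally show ?thesis .
qed

text \<open>The Hopf module projection that multiplies the coaction component by the antipode of the
  other component. The coaction sends \<Phi> to the sum over k of eR(H(F_k)(G \<Phi>(-))) tensored
  with e_k. Since \<open>a\<close> acts by \<Phi>(S(a) -), acting by S(e_k) produces the double
  antipode.\<close>

definition P where "P \<Phi> x = (\<Sum>k<n. eR (H (F k) (G \<Phi> (S (S (e k)) \<odot> x))))"

lemma P_Dr: "P \<Phi> \<in> Dr" if "\<Phi> \<in> Dr"
  unfolding P_def
  by (rule right_dual_sum) (rule Dr_S[OF eR_H_G_Dr[OF F_dual that]])

text \<open>The basis that defines the coaction is summed out, leaving an expression with values in
  \<open>C\<close>; that \<open>P \<Phi>\<close> is an integral will follow from this alone.\<close>

lemma G_P: "G (P \<Phi>) x = (\<Sum>j<n. D (G \<Phi> (e j)) (\<lambda>p q. eR (iB (F j (S (S p) \<odot> x)) \<odot> q)))"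
  if \<Phi>: "\<Phi> \<in> Dr"
proof -
  \<comment> \<open>The coefficient \<open>F k r\<close> is moved onto \<open>e k\<close>, where the
    sum reassembles \<open>r\<close>. Coassociativity then brings \<open>S q\<close> and
    \<open>s\<close> together, and the antipode axiom applies.\<close>
  have collapse: "(\<Sum>k<n. D (e k) (\<lambda>p q. S q \<odot> (\<phi> p \<odot> H (F k) z))) = D z (\<lambda>p q. eR (iB (\<phi> p) \<odot> q))"
    if \<phi>: "\<And>p q. \<phi> (p + q) = \<phi> p + \<phi> q" "\<And>p. \<phi> p \<in> C"
      "\<And>c p. c \<in> C \<Longrightarrow> \<phi> (c \<odot> p) = S (S c) \<odot> \<phi> p" for \<phi> z
  proof -
    have bal: "bal (\<lambda>p q. S q \<odot> (\<phi> p \<odot> r))" for r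
      by (rule balI) (simp_all add: \<phi> S_add distl distr S_mult assoc)
    have bal': "bal (\<lambda>p q. S p \<odot> q)"
      by (rule balI) (simp_all add: S_add distl distr S_mult assoc)
    have "D (e k) (\<lambda>p q. S q \<odot> (\<phi> p \<odot> H (F k) z)) =
        D z (\<lambda>r s. D (e k) (\<lambda>p q. S (F k r \<odot> q) \<odot> (\<phi> p \<odot> s)))" for k
      by (subst psum_commute) (simp add: H_def S_mult assoc F_D comm_left \<phi> flip: psum_left)
    also have "\<dots> k = D z (\<lambda>r s. D (F k r \<odot> e k) (\<lambda>p q. S q \<odot> (\<phi> p \<odot> s)))" for k
      by (simp add: g_C_left[OF bal] F_D)
    finally have "(\<Sum>k<n. D (e k) (\<lambda>p q. S q \<odot> (\<phi> p \<odot> H (F k) z))) =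
        D z (\<lambda>r s. \<Sum>k<n. D (F k r \<odot> e k) (\<lambda>p q. S q \<odot> (\<phi> p \<odot> s)))"
      by (simp add: psum_sum)
    also have "\<dots> = D z (\<lambda>r s. D (\<Sum>k<n. F k r \<odot> e k) (\<lambda>p q. S q \<odot> (\<phi> p \<odot> s)))"
      by (subst sum_hom[of "\<lambda>w. D w (\<lambda>p q. S q \<odot> (\<phi> p \<odot> _))"]) (simp_all add: g_add[OF bal])
    also have "\<dots> = D z (\<lambda>p r. D r (\<lambda>q s. S q \<odot> (\<phi> p \<odot> s)))"
      unfolding left_basis
    proof (rule coassoc)
      show "balanced_LL (\<odot>) C S (\<lambda>p q s. S q \<odot> (\<phi> p \<odot> s))"
        unfolding balanced_LL_def triadditive_def
        by (simp add: \<phi> S_add distl distr S_mult assoc) (simp add: comm_left[of "S _" "\<phi> _"] \<phi>)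
    qed
    also have "\<dots> = D z (\<lambda>p r. D (iB (\<phi> p) \<odot> r) (\<lambda>q s. S q \<odot> s))"
      by (simp add: g_B_left[OF bal'] \<phi> S_mult assoc)
    finally show ?thesis
      by (simp add: antipode_L)
  qed
  have "G (P \<Phi>) x = (\<Sum>k<n. G (\<lambda>x. eR (H (F k) (G \<Phi> (S (S (e k)) \<odot> x)))) x)"
    unfolding P_def by (rule G_sum) (rule Dr_S[OF eR_H_G_Dr[OF F_dual \<Phi>]])
  also have "\<dots> = (\<Sum>k<n. DR (S (e k)) (\<lambda>p q. p \<odot> H (F k) (G \<Phi> (S q \<odot> x))))"
    by (simp add: G_translate[OF eR_H_G_Dr[OF F_dual \<Phi>]] G_eR_H_G[OF F_dual \<Phi>])
  also have "\<dots> = (\<Sum>k<n. D (e k) (\<lambda>p q. S q \<odot> H (F k) (G \<Phi> (S (S p) \<odot> x))))"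
  proof -
    have "balR (\<lambda>p q. p \<odot> H (F k) (G \<Phi> (S q \<odot> x)))" for k
      by (rule balRI) (simp_all add: distl distr S_add G_add[OF \<Phi>] H_add[OF F_dual] S_mult assoc
        G_C_left[OF \<Phi>] H_C_left[OF F_dual])
    from gR_S[OF this] show ?thesis
      by simp
  qed
  \<comment> \<open>Expanding \<open>G \<Phi>\<close> in the left basis moves the dependence on
    \<open>p\<close> into a coefficient in \<open>C\<close> with the twisted linearity that
    \<open>collapse\<close> asks for.\<close>
  also have "\<dots> = (\<Sum>k<n. \<Sum>j<n. D (e k) (\<lambda>p q. S q \<odot> (F j (S (S p) \<odot> x) \<odot> H (F k) (G \<Phi> (e j)))))"
  proof -
    have "S q \<odot> H (F k) (G \<Phi> y) = (\<Sum>j<n. S q \<odot> (F j y \<odot> H (F k) (G \<Phi> (e j))))" for k q y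
      unfolding sum_left
      by (subst G_left_expand[OF \<Phi>], subst sum_hom[of "H (F k)"])
        (simp_all add: H_add[OF F_dual] H_C_left[OF F_dual] F_D)
    then show ?thesis
      by (simp only: psum_sum)
  qed
  also have "\<dots> = (\<Sum>j<n. \<Sum>k<n. D (e k) (\<lambda>p q. S q \<odot> (F j (S (S p) \<odot> x) \<odot> H (F k) (G \<Phi> (e j)))))"
    by (rule sum.swap)
  also have "\<dots> = (\<Sum>j<n. D (G \<Phi> (e j)) (\<lambda>p q. eR (iB (F j (S (S p) \<odot> x)) \<odot> q)))"
    by (subst collapse) (simp_all add: S_add distr F_D S_mult assoc)
  finally show ?thesis .
qed

text \<open>The right side of \<open>G_P\<close> lies in \<open>C\<close>, where \<open>eR\<close>
  is the identity, while \<open>eR\<close> recovers a functional from its action. So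
  \<open>P \<Phi>\<close> and its action coincide.\<close>

lemma P_eq: "P \<Phi> x = (\<Sum>j<n. D (G \<Phi> (e j)) (\<lambda>p q. eR (iB (F j (S (S p) \<odot> x)) \<odot> q)))"
  if \<Phi>: "\<Phi> \<in> Dr"
proof -
  have "G (P \<Phi>) x \<in> C"
    by (simp add: G_P[OF \<Phi>] C_sum C_psum)
  then show ?thesis
    using eR_G[OF P_Dr[OF \<Phi>], of x] by (simp add: G_P[OF \<Phi>])
qed

lemma P_intOn: "\<Phi> \<in> Dr \<Longrightarrow> P \<Phi> \<in> intOn"
  by (simp add: intOn_iff P_Dr G_P P_eq)

lemma bal_P: "bal (\<lambda>p q. eR (iB (F j (S (S p) \<odot> x)) \<odot> q))"
  by (rule balI) (simp_all add: S_add distl distr F_D iB_add eR_add S_mult iB_mult assoc)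

end

section \<open>The fundamental theorem of Hopf modules for functionals\<close>

context hopf_fgp begin

lemma P_C_mult: "P (\<lambda>x. c \<odot> \<Phi> x) x = P \<Phi> (S c \<odot> x)" if \<Phi>: "\<Phi> \<in> Dr" and c: "c \<in> C"
proof -
  have c\<Phi>: "(\<lambda>x. c \<odot> \<Phi> x) \<in> Dr"
    by (rule right_dualI) (simp_all add: right_dualD[OF \<Phi>] c distl assoc)
  have "G (\<lambda>x. c \<odot> \<Phi> x) y = G \<Phi> y \<odot> iB c" for y
    by (simp add: G_def iB_mult c right_dualD[OF \<Phi>] flip: psum_right assoc)
  then show ?thesis
    by (simp add: P_eq[OF c\<Phi>] P_eq[OF \<Phi>] g_B_right[OF bal_P] c S_mult assoc)
qed

lemma P_plus: "P (\<lambda>x. \<Phi> x + \<Psi> x) a = P \<Phi> a + P \<Psi> a" if "\<Phi> \<in> Dr" "\<Psi> \<in> Dr"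
  by (simp add: P_def G_plus[OF that] H_add[OF F_dual] eR_add sum.distrib)

lemma P_zero [simp]: "P (\<lambda>x. 0) a = 0"
  using g_zero[OF bal_H[OF F_dual]] by (simp add: P_def H_def)

lemma zero_Dr: "(\<lambda>x. 0) \<in> Dr"
  by (rule right_dualI) simp_all

lemma plus_Dr: "\<Phi> \<in> Dr \<Longrightarrow> \<Psi> \<in> Dr \<Longrightarrow> (\<lambda>x. \<Phi> x + \<Psi> x) \<in> Dr"
  by (rule right_dualI) (simp_all add: right_dualD distr algebra_simps)

lemma P_sum: "P (\<lambda>x. \<Sum>i<(k::nat). \<Phi> i x) a = (\<Sum>i<k. P (\<Phi> i) a)" if "\<And>i. \<Phi> i \<in> Dr"
  by (induction k) (simp_all add: P_plus that right_dual_sum)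

lemma P_psum:
  assumes "\<And>p q. \<Psi> p q \<in> Dr"
  shows "P (\<lambda>x. psum xs (\<lambda>p q. \<Psi> p q x)) a = psum xs (\<lambda>p q. P (\<Psi> p q) a)"
proof -
  have Dr: "(\<lambda>x. psum ys (\<lambda>p q. \<Psi> p q x)) \<in> Dr" for ys
    by (induction ys) (auto simp: psum_Cons zero_Dr intro!: plus_Dr assms)
  show ?thesis
    by (induction xs) (auto simp: psum_Cons P_plus assms Dr)
qed

text \<open>When a coinvariant is translated by \<open>a\<close> and projected back, the antipode of
  one leg of \<open>a\<close> meets the other leg, and only a counit of \<open>a\<close>
  survives.\<close>

lemma P_translate: "P (\<lambda>x. \<Lambda> (S a \<odot> x)) x = \<Lambda> (S (eR a) \<odot> x)" if \<Lambda>: "\<Lambda> \<in> intOn"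
proof -
  note \<Lambda>_Dr = intOn_Dr[OF \<Lambda>]
  note \<Lambda>_D = right_dualD[OF \<Lambda>_Dr]
  have G: "G (\<lambda>x. \<Lambda> (S a \<odot> x)) y = DR a (\<lambda>p q. p \<odot> \<Lambda> (S q \<odot> y))" for a y
    using G_translate[OF \<Lambda>_Dr, of a y] by (simp add: G_intOn[OF \<Lambda>])
  have bal: "balR (\<lambda>p q. p \<odot> \<Lambda> (S q \<odot> y))" for y
    by (rule balRI) (simp_all add: \<Lambda>_D S_add distl distr S_mult intOn_C_left[OF \<Lambda>] assoc)
  have *: "D (G (\<lambda>x. \<Lambda> (S a \<odot> x)) (e j)) (\<lambda>p q. eR (iB (F j (S (S p) \<odot> x)) \<odot> q)) =
      D a (\<lambda>p q. \<Lambda> (S q \<odot> (F j (S (S p) \<odot> x) \<odot> e j)))" for j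
  proof -
    have "D (G (\<lambda>x. \<Lambda> (S a \<odot> x)) (e j)) (\<lambda>p q. eR (iB (F j (S (S p) \<odot> x)) \<odot> q)) =
        DR a (\<lambda>p q. D p (\<lambda>p1 p2. eR (iB (F j (S (S p1) \<odot> x)) \<odot> (p2 \<odot> \<Lambda> (S q \<odot> e j)))))"
      by (simp add: G g_psum[OF bal_P] g_C_right[OF bal_P] \<Lambda>_D)
    also have "\<dots> = D a (\<lambda>p q. DR q (\<lambda>q1 q2. eR (iB (F j (S (S p) \<odot> x)) \<odot> (q1 \<odot> \<Lambda> (S q2 \<odot> e j)))))"
    proof (rule mixed_LR)
      show "balanced_LR (\<odot>) B C S (\<lambda>p q1 q2. eR (iB (F j (S (S p) \<odot> x)) \<odot> (q1 \<odot> \<Lambda> (S q2 \<odot> e j))))"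
        unfolding balanced_LR_def triadditive_def
        by (simp add: \<Lambda>_D S_add distl distr S_mult intOn_C_left[OF \<Lambda>] assoc eR_add F_D iB_add iB_mult)
    qed
    also have "\<dots> = D a (\<lambda>p q. eR (DR (iB (F j (S (S p) \<odot> x)) \<odot> q) (\<lambda>q1 q2. q1 \<odot> \<Lambda> (S q2 \<odot> e j))))"
      by (simp add: gR_B_left[OF bal] F_D psum_hom[of eR] eR_add assoc)
    also have "\<dots> = D a (\<lambda>p q. \<Lambda> (S (iB (F j (S (S p) \<odot> x)) \<odot> q) \<odot> e j))"
      by (simp add: eR_G[OF Dr_S[OF \<Lambda>_Dr]] flip: G)
    finally show ?thesis
      by (simp add: S_mult F_D assoc)
  qed
  have "P (\<lambda>x. \<Lambda> (S a \<odot> x)) x = D a (\<lambda>p q. \<Sum>j<n. \<Lambda> (S q \<odot> (F j (S (S p) \<odot> x) \<odot> e j)))"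
    by (simp add: P_eq[OF Dr_S[OF \<Lambda>_Dr]] * psum_sum)
  also have "\<dots> = D a (\<lambda>p q. \<Lambda> (S q \<odot> (\<Sum>j<n. F j (S (S p) \<odot> x) \<odot> e j)))"
    by (subst sum_hom[of "\<lambda>w. \<Lambda> (S _ \<odot> w)"]) (simp_all add: distl \<Lambda>_D)
  also have "\<dots> = D a (\<lambda>p q. \<Lambda> (S (S p \<odot> q) \<odot> x))"
    by (simp add: left_basis S_mult assoc)
  also have "\<dots> = \<Lambda> (S (D a (\<lambda>p q. S p \<odot> q)) \<odot> x)"
    by (rule psum_hom[symmetric, of "\<lambda>w. \<Lambda> (S w \<odot> x)"]) (simp add: S_add distr \<Lambda>_D)
  finally show ?thesis
    by (simp add: antipode_L)
qed

text \<open>The reconstruction half of the fundamental theorem: a functional is a sum of translates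
  of integrals. Its main use is at \<Phi> = \<open>eR\<close>, where \<open>G eR\<close> is the
  identity and the translating elements are S(b_i).\<close>

lemma P_expand: "\<Phi> x = (\<Sum>i<n. P (\<beta> i) (S (G \<Phi> (b i)) \<odot> x))" if \<Phi>: "\<Phi> \<in> Dr"
proof -
  \<comment> \<open>A summand of \<open>P_eq\<close> with an extra factor \<open>w\<close>. It is
    balanced in \<open>w\<close> and \<open>t\<close>, so it can be evaluated on a right
    coproduct.\<close>
  define E where "E j w t = D t (\<lambda>p q. eR (iB (F j (S (w \<odot> S p) \<odot> x)) \<odot> q))" for j w t
  have E_bal: "bal (\<lambda>p q. eR (iB (F j (S (w \<odot> S p) \<odot> x)) \<odot> q))" for j w
    by (rule balI) (simp_all add: S_add distl distr F_D iB_add eR_add S_mult iB_mult assoc)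
  have E_add: "E j (w + w') t = E j w t + E j w' t" "E j w (t + t') = E j w t + E j w t'" for j w w' t t'
    using g_add[OF E_bal] by (simp_all add: E_def S_add distl distr F_D iB_add eR_add psum_add)
  have E_B: "E j w (t \<odot> a) = E j (w \<odot> S a) t" if "a \<in> B" for j w t a
    using g_B_right[OF E_bal that] by (simp add: E_def S_mult assoc)
  have E_balR: "balR (E j)" for j
    by (rule balRI) (simp_all add: E_add E_B)
  have "D (G (\<beta> i) (e j)) (\<lambda>p q. eR (iB (F j (S (S p) \<odot> (S y \<odot> x))) \<odot> q)) =
      DR (e j) (\<lambda>s t. E j (y \<odot> \<beta> i s) t)" for i j y
  proof -
    have "bal (\<lambda>p q. eR (iB (F j (S (S p) \<odot> (S y \<odot> x))) \<odot> q))"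
      by (rule bal_P)
    then have "D (G (\<beta> i) (e j)) (\<lambda>p q. eR (iB (F j (S (S p) \<odot> (S y \<odot> x))) \<odot> q)) =
        DR (e j) (\<lambda>s t. D (t \<odot> iB (\<beta> i s)) (\<lambda>p q. eR (iB (F j (S (S p) \<odot> (S y \<odot> x))) \<odot> q)))"
      unfolding G_def by (rule g_psum)
    also have "\<dots> = DR (e j) (\<lambda>s t. E j y (t \<odot> iB (\<beta> i s)))"
      by (simp add: E_def S_mult assoc)
    finally show ?thesis
      by (simp add: E_B right_dualD[OF beta_dual])
  qed
  then have "(\<Sum>i<n. P (\<beta> i) (S (G \<Phi> (b i)) \<odot> x)) =
      (\<Sum>i<n. \<Sum>j<n. DR (e j) (\<lambda>s t. E j (G \<Phi> (b i) \<odot> \<beta> i s) t))"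
    by (simp add: P_eq[OF beta_dual])
  also have "\<dots> = (\<Sum>j<n. DR (e j) (\<lambda>s t. \<Sum>i<n. E j (G \<Phi> (b i) \<odot> \<beta> i s) t))"
    by (subst sum.swap) (simp add: psum_sum)
  \<comment> \<open>The right dual basis is summed out inside the second argument of
    \<open>E\<close>.\<close>
  also have "\<dots> = (\<Sum>j<n. DR (e j) (\<lambda>s t. E j (G \<Phi> s) t))"
    by (subst (2) G_right_expand[OF \<Phi>]) (simp add: sum_hom[of "\<lambda>w. E _ w _"] E_add)
  also have "\<dots> = (\<Sum>j<n. DR (G \<Phi> (e j)) (\<lambda>s t. E j s t))"
    by (simp add: gR_G[OF \<Phi> E_balR])
  also have "\<dots> = (\<Sum>j<n. D (G \<Phi> (e j)) (\<lambda>y q. DR y (\<lambda>s p. eR (iB (F j (S (s \<odot> S p) \<odot> x)) \<odot> q))))"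
  proof (rule sum.cong[OF HOL.refl])
    fix j
    have "balanced_RL (\<odot>) B C S (\<lambda>s p q. eR (iB (F j (S (s \<odot> S p) \<odot> x)) \<odot> q))"
      unfolding balanced_RL_def triadditive_def
      by (simp add: S_add distl distr F_D iB_add eR_add S_mult iB_mult assoc)
    then show "DR (G \<Phi> (e j)) (\<lambda>s t. E j s t) =
        D (G \<Phi> (e j)) (\<lambda>y q. DR y (\<lambda>s p. eR (iB (F j (S (s \<odot> S p) \<odot> x)) \<odot> q)))"
      unfolding E_def by (rule mixed_RL[symmetric])
  qed
  \<comment> \<open>Mixed coassociativity has brought \<open>s\<close> and \<open>S p\<close>
    together, and they close up to the counit \<open>eL y\<close>.\<close>
  also have "\<dots> = (\<Sum>j<n. D (G \<Phi> (e j)) (\<lambda>y q. eR (iB (F j (S (eL y) \<odot> x)) \<odot> q)))"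
    by (simp add: S_add distr F_D iB_add eR_add antipode_R
      flip: psum_hom[of "\<lambda>w. eR (iB (F _ (S w \<odot> x)) \<odot> _)"])
  also have "\<dots> = (\<Sum>j<n. D (G \<Phi> (e j)) (\<lambda>y q. eR (iB (F j x) \<odot> (eL y \<odot> q))))"
    by (simp add: F_D iB_mult assoc)
  also have "\<dots> = (\<Sum>j<n. eR (iB (F j x) \<odot> G \<Phi> (e j)))"
    by (simp add: distl eR_add counit_left flip: psum_hom[of "\<lambda>w. eR (iB (F _ x) \<odot> w)"])
  \<comment> \<open>Under \<open>eR\<close> a left factor from \<open>C\<close> and its image under
    \<open>iB\<close> have the same effect.\<close>
  also have "\<dots> = (\<Sum>j<n. eR (F j x \<odot> G \<Phi> (e j)))"
    using eR_iB_eR[of "F _ x"] by (simp add: F_D)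
  also have "\<dots> = eR (\<Sum>j<n. F j x \<odot> G \<Phi> (e j))"
    by (rule sum_hom[symmetric]) (rule eR_add)
  also have "\<dots> = \<Phi> x"
    by (simp add: eR_G[OF \<Phi>] flip: G_left_expand[OF \<Phi>])
  finally show ?thesis ..
qed

text \<open>The functional is a sum of multiples of translates of \<Lambda>. Their projections
  contain only counits of the second leg of \<open>a\<close>, and the counit law reassembles
  \<open>a\<close> inside \<Phi>.\<close>

lemma P_compose: "P (\<lambda>x. \<Phi> (G (\<lambda>y. \<Lambda> (S a \<odot> y)) x)) x' = \<Lambda> (S (\<Phi> a) \<odot> x')"
  if \<Lambda>: "\<Lambda> \<in> intOn" and \<Phi>: "\<Phi> \<in> Dr"
proof -
  note \<Lambda>_Dr = intOn_Dr[OF \<Lambda>]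
  note \<Phi>_D = right_dualD[OF \<Phi>]
  note \<Lambda>_D = right_dualD[OF \<Lambda>_Dr]
  have "\<Phi> (G (\<lambda>y. \<Lambda> (S a \<odot> y)) x) = DR a (\<lambda>p q. \<Phi> p \<odot> \<Lambda> (S q \<odot> x))" for x
    by (simp add: G_translate[OF \<Lambda>_Dr] G_intOn[OF \<Lambda>] psum_hom[of \<Phi>] \<Phi>_D \<Lambda>_D)
  moreover have "(\<lambda>x. \<Phi> p \<odot> \<Lambda> (S q \<odot> x)) \<in> Dr" for p q
    by (rule right_dualI) (simp_all add: \<Phi>_D \<Lambda>_D distl flip: assoc)
  ultimately have "P (\<lambda>x. \<Phi> (G (\<lambda>y. \<Lambda> (S a \<odot> y)) x)) x' =
      DR a (\<lambda>p q. P (\<lambda>x. \<Phi> p \<odot> \<Lambda> (S q \<odot> x)) x')"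
    by (simp add: P_psum)
  also have "\<dots> = DR a (\<lambda>p q. \<Lambda> (S (\<Phi> (p \<odot> eR q)) \<odot> x'))"
    by (simp add: P_C_mult[OF Dr_S[OF \<Lambda>_Dr]] P_translate[OF \<Lambda>] \<Phi>_D S_mult assoc)
  also have "\<dots> = \<Lambda> (S (\<Phi> (DR a (\<lambda>p q. p \<odot> eR q))) \<odot> x')"
    by (rule psum_hom[symmetric, of "\<lambda>w. \<Lambda> (S (\<Phi> w) \<odot> x')"]) (simp add: \<Phi>_D S_add distr \<Lambda>_D)
  finally show ?thesis
    by (simp only: counitR_right)
qed

text \<open>Left multiplication by \<open>eL a\<close> is the action of eR(S(a) -). Once
  \<open>P_expand\<close> has decomposed this functional into translates of integrals,
  \<open>P_compose\<close> evaluates each term. The result shows that the projection of \<Phi>(a -)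
  depends only on the counit of \<open>a\<close>.\<close>

lemma P_eL: "P (\<lambda>x. \<Phi> (eL a \<odot> x)) x' = P (\<lambda>x. \<Phi> (a \<odot> x)) x'" if \<Phi>: "\<Phi> \<in> Dr"
proof -
  note \<Phi>_D = right_dualD[OF \<Phi>]
  have P_Dr': "(\<lambda>y. P (\<beta> i) (S z \<odot> y)) \<in> Dr" for i z
    by (rule Dr_S[OF P_Dr[OF beta_dual]])
  have "eL a \<odot> x = G (\<lambda>y. eR (S a \<odot> y)) x" for x
    by (simp add: G_translate[OF eR_Dr] psum_right antipode_R flip: assoc)
  also have "\<dots> x = G (\<lambda>y. \<Sum>i<n. P (\<beta> i) (S (a \<odot> b i) \<odot> y)) x" for x
    by (subst P_expand[OF eR_Dr]) (simp add: S_mult assoc)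
  also have "\<dots> x = (\<Sum>i<n. G (\<lambda>y. P (\<beta> i) (S (a \<odot> b i) \<odot> y)) x)" for x
    by (rule G_sum) (rule P_Dr')
  finally have "\<Phi> (eL a \<odot> x) = (\<Sum>i<n. \<Phi> (G (\<lambda>y. P (\<beta> i) (S (a \<odot> b i) \<odot> y)) x))" for x
    by (simp add: sum_hom[of \<Phi>] \<Phi>_D)
  moreover have "(\<lambda>x. \<Phi> (G (\<lambda>y. P (\<beta> i) (S (a \<odot> b i) \<odot> y)) x)) \<in> Dr" for i
    by (rule right_dualI) (simp_all add: \<Phi>_D G_add[OF P_Dr'] G_C_right[OF P_Dr'])
  ultimately have "P (\<lambda>x. \<Phi> (eL a \<odot> x)) x' = (\<Sum>i<n. P (\<beta> i) (S (\<Phi> (a \<odot> b i)) \<odot> x'))"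
    by (simp add: P_sum P_compose[OF P_intOn[OF beta_dual] \<Phi>])
  also have "\<dots> = (\<Sum>i<n. P (\<lambda>x. \<Phi> (a \<odot> b i) \<odot> \<beta> i x) x')"
    by (simp add: P_C_mult[OF beta_dual] \<Phi>_D)
  also have "\<dots> = P (\<lambda>x. \<Sum>i<n. \<Phi> (a \<odot> b i) \<odot> \<beta> i x) x'"
  proof (rule P_sum[symmetric])
    show "(\<lambda>x. \<Phi> (a \<odot> b i) \<odot> \<beta> i x) \<in> Dr" for i
      by (rule right_dualI) (simp_all add: \<Phi>_D right_dualD[OF beta_dual] distl assoc)
  qed
  also have "\<dots> = P (\<lambda>x. \<Phi> (a \<odot> x)) x'"
    by (simp flip: right_expand[OF Dr_S[OF \<Phi>, of a]])
  finally show ?thesis .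
qed

end

section \<open>Frobenius functionals and nondegenerate integrals\<close>

lemma frobenius_formD:
  assumes "frobenius_form m C \<psi>"
  shows "\<psi> \<in> right_dual m C" "c \<in> C \<Longrightarrow> \<psi> (m c x) = m c (\<psi> x)"
  using assms by (simp_all add: frobenius_form_def)

context hopf begin

definition nondeg_on where
  "nondeg_on \<Lambda> \<longleftrightarrow> \<Lambda> \<in> intOn \<and> bij_betw (\<lambda>a x. \<Lambda> (a \<odot> x)) UNIV Dr"

definition nondeg_in where
  "nondeg_in l \<longleftrightarrow> l \<in> intIn \<and> bij_betw (\<lambda>\<Phi>. G \<Phi> l) Dr UNIV"

definition free_intOn where
  "free_intOn \<longleftrightarrow> (\<exists>\<Lambda>\<in>intOn. bij_betw (\<lambda>b x. \<Lambda> (b \<odot> x)) B intOn)"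

end

section \<open>Between dual pairs, nondegeneracy, freeness and Frobenius forms\<close>

context hopf_fgp begin

text \<open>The elements representing the coordinate functionals complete \<open>b\<close> to a
  Frobenius system. One identity is the dual basis property; the other holds after applying
  \<Lambda>(- x) for every x, hence holds by injectivity.\<close>

lemma frobenius_form_of_nondeg:
  assumes "nondeg_on \<Lambda>"
  shows "frobenius_form m C \<Lambda>"
proof -
  have \<Lambda>: "\<Lambda> \<in> intOn" and bij: "bij_betw (\<lambda>a x. \<Lambda> (a \<odot> x)) UNIV Dr"
    using assms by (simp_all add: nondeg_on_def)
  note \<Lambda>_D = right_dualD[OF intOn_Dr[OF \<Lambda>]]
  have "\<beta> i \<in> range (\<lambda>a x. \<Lambda> (a \<odot> x))" for i
    using bij beta_dual by (simp add: bij_betw_def)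
  then have "\<exists>v. \<forall>i. \<beta> i = (\<lambda>x. \<Lambda> (v i \<odot> x))"
    by (intro choice) auto
  then obtain v where v: "\<And>i x. \<beta> i x = \<Lambda> (v i \<odot> x)"
    by metis
  have basis: "(\<Sum>i<n. b i \<odot> \<Lambda> (v i \<odot> a)) = a" for a
    using right_basis[of a] by (simp add: v)
  have "(\<Sum>i<n. \<Lambda> (a \<odot> b i) \<odot> v i) = a" for a
  proof -
    have "\<Lambda> ((\<Sum>i<n. \<Lambda> (a \<odot> b i) \<odot> v i) \<odot> x) = \<Lambda> (a \<odot> x)" for x
    proof -
      have "\<Lambda> ((\<Sum>i<n. \<Lambda> (a \<odot> b i) \<odot> v i) \<odot> x) = (\<Sum>i<n. \<Lambda> (a \<odot> (b i \<odot> \<Lambda> (v i \<odot> x))))"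
      proof -
        have "\<Lambda> (a \<odot> (y \<odot> \<Lambda> z)) = \<Lambda> (a \<odot> y) \<odot> \<Lambda> z" for y z
          using \<Lambda>_D(3)[of "\<Lambda> z" "a \<odot> y"] by (simp add: assoc \<Lambda>_D)
        then show ?thesis
          by (subst sum_hom[of "\<lambda>w. \<Lambda> (w \<odot> x)"])
            (simp_all add: distr \<Lambda>_D intOn_C_left[OF \<Lambda>] assoc)
      qed
      also have "\<dots> = \<Lambda> (a \<odot> (\<Sum>i<n. b i \<odot> \<Lambda> (v i \<odot> x)))"
        by (rule sum_hom[symmetric, of "\<lambda>w. \<Lambda> (a \<odot> w)"]) (simp add: distl \<Lambda>_D)
      finally show ?thesis
        by (simp add: basis)
    qed
    then show ?thesis
      using bij by (auto simp: bij_betw_def inj_on_def fun_eq_iff)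
  qed
  moreover have "psum (map (\<lambda>i. (b i, v i)) [0..<n]) f = (\<Sum>i<n. f (b i) (v i))" for f :: "'a \<Rightarrow> 'a \<Rightarrow> 'a"
    by (simp add: psum_def comp_def interv_sum_list_conv_sum_set_nat atLeast0LessThan)
  ultimately show ?thesis
    unfolding frobenius_form_def
    using basis intOn_Dr[OF \<Lambda>] intOn_C_left[OF \<Lambda>]
    by (intro conjI exI[of _ "map (\<lambda>i. (b i, v i)) [0..<n]"]) simp_all
qed

lemma dual_pair_of_frobenius_form:
  assumes "frobenius_form m C \<psi>"
  shows "\<exists>\<Lambda> l. dual_pair \<Lambda> l"
proof -
  obtain uv where uv: "\<And>a. psum uv (\<lambda>u v. \<psi> (a \<odot> u) \<odot> v) = a" "\<And>a. psum uv (\<lambda>u v. u \<odot> \<psi> (v \<odot> a)) = a"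
    using assms by (auto simp: frobenius_form_def)
  note \<psi>_Dr = frobenius_formD(1)[OF assms]
  note \<psi>_D = right_dualD[OF \<psi>_Dr] frobenius_formD(2)[OF assms]
  \<comment> \<open>The element that represents t_L \<pi>_L through \<psi>: by
    \<open>collapse\<close>, \<psi>(a l) = \<open>iC (eL a)\<close>.\<close>
  define l where "l = psum uv (\<lambda>u v. u \<odot> iC (eL v))"
  have iC_eL: "iC (eL (c \<odot> v)) = c \<odot> iC (eL v)" if "c \<in> C" for c v
    using that by (simp add: eps_C iC_mult)
  have collapse: "psum uv (\<lambda>u v. \<psi> (a \<odot> u) \<odot> iC (eL v)) = iC (eL a)" for a
    using psum_hom[of "\<lambda>w. iC (eL w)" uv "\<lambda>u v. \<psi> (a \<odot> u) \<odot> v"]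
    by (simp add: eps_add iC_add uv iC_eL \<psi>_D)
  have a_l: "a \<odot> l = psum uv (\<lambda>u v. u \<odot> iC (eL (v \<odot> a)))" for a
  proof -
    have "a \<odot> l = psum uv (\<lambda>u v. psum uv (\<lambda>u' v'. u' \<odot> \<psi> (v' \<odot> (a \<odot> u))) \<odot> iC (eL v))"
      by (simp add: uv l_def assoc psum_left)
    also have "\<dots> = psum uv (\<lambda>u' v'. u' \<odot> psum uv (\<lambda>u v. \<psi> ((v' \<odot> a) \<odot> u) \<odot> iC (eL v)))"
      unfolding psum_right[symmetric] psum_left[symmetric]
      by (subst psum_commute) (simp only: assoc)
    finally show ?thesis
      by (simp only: collapse)
  qed
  \<comment> \<open>The formula for \<open>a \<odot> l\<close> involves \<open>a\<close> only
    through \<open>eL (v \<odot> a)\<close>, and this is unchanged when \<open>a\<close> is replaced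
    by \<open>eL a\<close>.\<close>
  have l: "l \<in> intIn"
    by (simp add: intIn_def a_l eps_mult_B)
  have \<psi>_l: "\<psi> l = \<one>"
    using collapse[of \<one>] by (simp add: l_def psum_hom[of \<psi>] \<psi>_D)
  have P_\<psi>: "P (\<lambda>x. \<psi> (v \<odot> x)) x = P \<psi> (S (iC (eL v)) \<odot> x)" for v x
  proof -
    \<comment> \<open>By \<open>P_eL\<close> only the counit of \<open>v\<close> matters, so
      \<open>v\<close> can be replaced by \<open>iC (eL v)\<close>, which lies in \<open>C\<close>
      and comes out of \<psi>.\<close>
    have "P (\<lambda>x. \<psi> (v \<odot> x)) x = P (\<lambda>x. \<psi> (iC (eL v) \<odot> x)) x"
      using P_eL[OF \<psi>_Dr, of v x] P_eL[OF \<psi>_Dr, of "iC (eL v)" x] by simp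
    also have "\<dots> = P \<psi> (S (iC (eL v)) \<odot> x)"
      using P_C_mult[OF \<psi>_Dr, of "iC (eL v)" x] by (simp add: \<psi>_D)
    finally show ?thesis .
  qed
  note \<Lambda> = P_intOn[OF \<psi>_Dr]
  note \<Lambda>_D = right_dualD[OF P_Dr]
  have \<Lambda>_S_l: "P \<psi> (S l \<odot> x) = eR x" for x
  proof -
    \<comment> \<open>Each b_i is rewritten by the Frobenius system. The coefficients \<psi>(v b_i)
      then combine with the \<beta>_i into the functional \<psi>(v -).\<close>
    have expand: "P (\<beta> i) (S (b i) \<odot> x) = psum uv (\<lambda>u v. P (\<lambda>x. \<psi> (v \<odot> b i) \<odot> \<beta> i x) (S u \<odot> x))" for i
    proof -
      have "P (\<beta> i) (S (b i) \<odot> x) = P (\<beta> i) (S (psum uv (\<lambda>u v. u \<odot> \<psi> (v \<odot> b i))) \<odot> x)"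
        by (simp add: uv)
      also have "\<dots> = psum uv (\<lambda>u v. P (\<beta> i) (S (u \<odot> \<psi> (v \<odot> b i)) \<odot> x))"
        by (rule psum_hom[of "\<lambda>w. P (\<beta> i) (S w \<odot> x)"]) (simp add: S_add distr \<Lambda>_D[OF beta_dual])
      finally show ?thesis
        by (simp add: P_C_mult[OF beta_dual] \<psi>_D S_mult assoc)
    qed
    have "eR x = (\<Sum>i<n. P (\<beta> i) (S (b i) \<odot> x))"
      by (subst P_expand[OF eR_Dr]) simp
    also have "\<dots> = psum uv (\<lambda>u v. \<Sum>i<n. P (\<lambda>x. \<psi> (v \<odot> b i) \<odot> \<beta> i x) (S u \<odot> x))"
      by (simp add: expand psum_sum)
    also have "\<dots> = psum uv (\<lambda>u v. P (\<lambda>x. \<Sum>i<n. \<psi> (v \<odot> b i) \<odot> \<beta> i x) (S u \<odot> x))"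
    proof -
      have "(\<lambda>x. \<psi> (v \<odot> b i) \<odot> \<beta> i x) \<in> Dr" for i v
        by (rule right_dualI) (simp_all add: \<psi>_D right_dualD[OF beta_dual] distl assoc)
      from P_sum[OF this] show ?thesis
        by simp
    qed
    also have "\<dots> = psum uv (\<lambda>u v. P \<psi> (S (u \<odot> iC (eL v)) \<odot> x))"
      by (simp add: P_\<psi> S_mult assoc flip: right_expand[OF Dr_S[OF \<psi>_Dr]])
    also have "\<dots> = P \<psi> (S l \<odot> x)"
      unfolding l_def
      by (rule psum_hom[symmetric, of "\<lambda>w. P \<psi> (S w \<odot> x)"]) (simp add: S_add distr \<Lambda>_D[OF \<psi>_Dr])
    finally show ?thesis ..
  qed
  \<comment> \<open>The normalisation: the dual basis identity evaluated at \<open>l\<close> reads l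
    = l \<Lambda>(l) with \<Lambda> = \<open>P \<psi>\<close>, and applying \<psi>, which is 1 on
    \<open>l\<close>, gives \<Lambda>(l) = 1.\<close>
  have "P \<psi> (S y \<odot> l) = eR y \<odot> P \<psi> l" for y
    by (subst intIn_D'[OF l]) (simp add: eL_S intOn_C_left[OF \<Lambda>])
  then have "l = DR l (\<lambda>x y. x \<odot> eR y) \<odot> P \<psi> l"
    using intOn_dual_basis[OF \<Lambda> \<Lambda>_S_l, of l] by (simp add: psum_right flip: assoc)
  then have "\<psi> l = \<psi> (l \<odot> P \<psi> l)"
    by (simp add: counitR_right)
  then have "P \<psi> l = \<one>"
    by (simp add: \<psi>_D \<psi>_l \<Lambda>_D[OF \<psi>_Dr])
  then have "dual_pair (P \<psi>) l"
    by (simp add: dual_pair_def \<Lambda> l \<Lambda>_S_l)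
  then show ?thesis
    by blast
qed

lemma dual_pair_of_free:
  assumes free_intOn
  shows "\<exists>\<Lambda> l. dual_pair \<Lambda> l"
proof -
  obtain \<Lambda> where \<Lambda>: "\<Lambda> \<in> intOn" and bij: "bij_betw (\<lambda>b x. \<Lambda> (b \<odot> x)) B intOn"
    using assms by (auto simp: free_intOn_def)
  note \<Lambda>_Dr = intOn_Dr[OF \<Lambda>]
  note \<Lambda>_D = right_dualD[OF \<Lambda>_Dr]
  have "P (\<beta> i) \<in> (\<lambda>b x. \<Lambda> (b \<odot> x)) ` B" for i
    using bij P_intOn[OF beta_dual] by (simp add: bij_betw_def)
  then have "\<exists>w. \<forall>i. w i \<in> B \<and> P (\<beta> i) = (\<lambda>x. \<Lambda> (w i \<odot> x))"
    by (intro choice) blast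
  then obtain w where w: "\<And>i. w i \<in> B" "\<And>i x. P (\<beta> i) x = \<Lambda> (w i \<odot> x)"
    by metis
  \<comment> \<open>Chosen so that \<open>S l\<close> is the sum of the
    \<open>w i \<odot> S (b i)\<close>; then \<Lambda>(S(l) -) is the expansion of \<open>eR\<close>
    given by \<open>P_expand\<close>.\<close>
  define l where "l = (\<Sum>i<n. b i \<odot> iC (w i))"
  have \<Lambda>_S_l: "\<Lambda> (S l \<odot> x) = eR x" for x
  proof -
    have "eR x = (\<Sum>i<n. \<Lambda> (S (b i \<odot> iC (w i)) \<odot> x))"
      by (subst P_expand[OF eR_Dr]) (simp add: w S_mult assoc)
    also have "\<dots> = \<Lambda> (S l \<odot> x)"
      unfolding l_def
      by (rule sum_hom[symmetric, of "\<lambda>w. \<Lambda> (S w \<odot> x)"]) (simp add: S_add distr \<Lambda>_D)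
    finally show ?thesis ..
  qed
  \<comment> \<open>Injectivity of a \<mapsto> \<Lambda>(S(a) -) is not among the hypotheses, which
    only give it on \<open>B\<close>. \<open>P_compose\<close> reduces to that case: each
    S(\<beta>_i(a)) lies in \<open>B\<close> and annihilates \<Lambda>, so all coordinates of
    \<open>a\<close> vanish.\<close>
  have zero: "a = 0" if a: "\<And>x. \<Lambda> (S a \<odot> x) = 0" for a
  proof -
    have "\<beta> i a = 0" for i
    proof -
      have "\<Lambda> (S (\<beta> i a) \<odot> x) = \<Lambda> (0 \<odot> x)" for x
        using P_compose[OF \<Lambda> beta_dual, of i a x, symmetric] \<Lambda>_D(1)[of 0 0]
          right_dualD(1)[OF beta_dual, of i 0 0]
        by (simp add: a)
      then have "S (\<beta> i a) = 0"
        using bij by (auto simp: bij_betw_def inj_on_def fun_eq_iff right_dualD[OF beta_dual])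
      then show ?thesis
        using inj_onD[OF S_inj_C, of "\<beta> i a" 0] by (simp add: right_dualD[OF beta_dual])
    qed
    then show ?thesis
      using right_basis[of a] by simp
  qed
  have eqI: "a = a'" if "\<And>x. \<Lambda> (S a \<odot> x) = \<Lambda> (S a' \<odot> x)" for a a'
  proof -
    have "\<Lambda> (S (a - a') \<odot> x) = 0" for x
      using that[of x] S_add[of "a - a'" a'] \<Lambda>_D(1)[of "S (a - a') \<odot> x" "S a' \<odot> x"]
      by (simp flip: distr)
    then show ?thesis
      using zero[of "a - a'"] by simp
  qed
  have "a \<odot> l = eL a \<odot> l" for a
  proof (rule eqI)
    show "\<Lambda> (S (a \<odot> l) \<odot> x) = \<Lambda> (S (eL a \<odot> l) \<odot> x)" for x
      using eR_eR[of "S a" x] by (simp add: S_mult assoc \<Lambda>_S_l eR_S)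
  qed
  then have l: "l \<in> intIn"
    by (simp add: intIn_def)
  have "G \<Lambda> l = \<one>"
    by (rule eqI) (simp add: intOn_S_G[OF \<Lambda> \<Lambda>_S_l \<Lambda>_Dr])
  then have "\<Lambda> l = \<one>"
    by (simp add: G_intOn[OF \<Lambda>])
  then show ?thesis
    using \<Lambda> l \<Lambda>_S_l by (auto simp: dual_pair_def)
qed

lemma dual_pair_of_nondeg_in:
  assumes "nondeg_in l"
  shows "\<exists>\<Lambda>. dual_pair \<Lambda> l"
proof -
  have l: "l \<in> intIn" and bij: "bij_betw (\<lambda>\<Phi>. G \<Phi> l) Dr UNIV"
    using assms by (simp_all add: nondeg_in_def)
  have inj: "\<Phi> = \<Psi>" if "\<Phi> \<in> Dr" "\<Psi> \<in> Dr" "G \<Phi> l = G \<Psi> l" for \<Phi> \<Psi>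
    using bij that by (simp add: bij_betw_def inj_on_def)
  have "\<one> \<in> (\<lambda>\<Phi>. G \<Phi> l) ` Dr"
    using bij by (simp add: bij_betw_def)
  \<comment> \<open>The only candidate: for an integral, \<open>G \<Lambda> l\<close> is the value
    of \<Lambda> on \<open>l\<close>.\<close>
  then obtain \<Lambda> where \<Lambda>_Dr: "\<Lambda> \<in> Dr" and G_l: "G \<Lambda> l = \<one>"
    by auto
  note \<Lambda>_D = right_dualD[OF \<Lambda>_Dr]
  have G_Dr: "(\<lambda>x. \<Psi> (G \<Lambda> x)) \<in> Dr" if "\<Psi> \<in> Dr" for \<Psi>
    using right_dualD[OF that]
    by (intro right_dualI) (simp_all add: G_add[OF \<Lambda>_Dr] G_C_right[OF \<Lambda>_Dr])
  \<comment> \<open>As \<open>G \<Lambda> l\<close> is 1, the functional \<Psi>(G \<Lambda>(-)) and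
    the multiple of \<Lambda> by \<Psi>(1) have the same image under the bijection at
    \<open>l\<close>, so they are equal.\<close>
  have commute: "\<Psi> (G \<Lambda> x) = \<Psi> (\<Lambda> x)" if \<Psi>: "\<Psi> \<in> Dr" for \<Psi> x
  proof -
    note \<Psi>_D = right_dualD[OF \<Psi>]
    have "(\<lambda>x. \<Psi> (G \<Lambda> x)) = (\<lambda>x. \<Psi> \<one> \<odot> \<Lambda> x)"
    proof (rule inj[OF G_Dr[OF \<Psi>]])
      show "(\<lambda>x. \<Psi> \<one> \<odot> \<Lambda> x) \<in> Dr"
        by (rule right_dualI) (simp_all add: \<Psi>_D \<Lambda>_D distl assoc)
      have "G (\<lambda>x. \<Psi> (G \<Lambda> x)) l = DR (G \<Lambda> l) (\<lambda>x y. y \<odot> iB (\<Psi> x))"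
        unfolding gR_G[OF \<Lambda>_Dr bal_G[OF \<Psi>]] by (rule G_def)
      also have "\<dots> = G \<Lambda> l \<odot> iB (\<Psi> \<one>)"
        by (simp add: G_l gR_of_C[OF bal_G[OF \<Psi>]])
      also have "\<dots> = G (\<lambda>x. \<Psi> \<one> \<odot> \<Lambda> x) l"
        by (simp add: G_def iB_mult \<Psi>_D \<Lambda>_D flip: psum_right assoc)
      finally show "G (\<lambda>x. \<Psi> (G \<Lambda> x)) l = G (\<lambda>x. \<Psi> \<one> \<odot> \<Lambda> x) l" .
    qed
    from fun_cong[OF this, of x] show ?thesis
      using \<Psi>_D(3)[of "\<Lambda> x" \<one>] by (simp add: \<Lambda>_D)
  qed
  \<comment> \<open>The coordinate functionals separate points.\<close>
  have "G \<Lambda> x = \<Lambda> x" for x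
    using right_basis[of "G \<Lambda> x"] unfolding commute[OF beta_dual] right_basis by simp
  then have \<Lambda>: "\<Lambda> \<in> intOn"
    by (simp add: intOn_iff \<Lambda>_Dr)
  then have \<Lambda>_l: "\<Lambda> l = \<one>"
    using G_l G_intOn by simp
  \<comment> \<open>Both functionals are sent to \<open>l\<close> by the bijection.\<close>
  have "(\<lambda>x. \<Lambda> (S l \<odot> x)) = eR"
    by (rule inj[OF Dr_S[OF \<Lambda>_Dr] eR_Dr]) (simp add: G_translate_l[OF \<Lambda> l \<Lambda>_l])
  then show ?thesis
    using \<Lambda> l \<Lambda>_l by (auto simp: dual_pair_def fun_eq_iff)
qed

text \<open>Nondegeneracy and surjectivity of \<open>S\<close> write any integral as \<Lambda>(S(a)
  -). It remains to see that the integral property forces \<open>S a\<close> into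
  \<open>B\<close>.\<close>

lemma free_of_dual_pair:
  assumes "dual_pair \<Lambda> l"
  shows free_intOn
proof -
  note \<Lambda> = \<Lambda>_intOn[OF assms]
  note \<Lambda>_D = right_dualD[OF intOn_Dr[OF \<Lambda>]]
  have nondeg: "nondeg_on \<Lambda>"
    by (simp add: nondeg_on_def \<Lambda> bij_\<Lambda>[OF assms])
  have inj: "inj (\<lambda>a x. \<Lambda> (a \<odot> x))" and surj: "range (\<lambda>a x. \<Lambda> (a \<odot> x)) = Dr"
    using bij_\<Lambda>[OF assms] by (simp_all add: bij_betw_def)
  obtain uv where uv: "\<And>a. psum uv (\<lambda>u v. \<Lambda> (a \<odot> u) \<odot> v) = a"
    using frobenius_form_of_nondeg[OF nondeg] by (auto simp: frobenius_form_def)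
  have "\<Lambda>' \<in> (\<lambda>b x. \<Lambda> (b \<odot> x)) ` B" if \<Lambda>': "\<Lambda>' \<in> intOn" for \<Lambda>'
  proof -
    have "\<Lambda>' \<in> range (\<lambda>a x. \<Lambda> (a \<odot> x))"
      using intOn_Dr[OF \<Lambda>'] surj by simp
    moreover have "surj S"
      using antipode_bij[OF \<Lambda> l_intIn[OF assms] \<Lambda>_l[OF assms]] by (rule bij_is_surj)
    ultimately obtain a where a: "\<Lambda>' = (\<lambda>x. \<Lambda> (S a \<odot> x))"
      by (metis (no_types, lifting) rangeE surjD)
    \<comment> \<open>The integral property of \<open>\<Lambda>'\<close>, rewritten by
      \<open>G_translate\<close>. Evaluated on the Frobenius system of \<Lambda> it becomes
      \<open>eL a = S a\<close>.\<close>
    have "DR a (\<lambda>p q. p \<odot> \<Lambda> (S q \<odot> x)) = \<Lambda> (S a \<odot> x)" for x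
      using G_translate[OF intOn_Dr[OF \<Lambda>], of a x] G_intOn[OF \<Lambda>', of x]
      by (simp add: G_intOn[OF \<Lambda>] a)
    then have "psum uv (\<lambda>u v. DR a (\<lambda>p q. p \<odot> \<Lambda> (S q \<odot> u)) \<odot> v) = S a"
      by (simp add: uv)
    moreover have "psum uv (\<lambda>u v. DR a (\<lambda>p q. p \<odot> \<Lambda> (S q \<odot> u)) \<odot> v) =
        DR a (\<lambda>p q. p \<odot> psum uv (\<lambda>u v. \<Lambda> (S q \<odot> u) \<odot> v))"
      unfolding psum_right[symmetric] psum_left[symmetric] psum_commute[of uv] by (simp only: assoc)
    ultimately have "S a = eL a"
      by (simp add: uv antipode_R)
    then show ?thesis
      using a by auto
  qed
  then have "(\<lambda>b x. \<Lambda> (b \<odot> x)) ` B = intOn"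
    using intOn_B_left[OF _ \<Lambda>] by auto
  moreover have "inj_on (\<lambda>b x. \<Lambda> (b \<odot> x)) B"
    using inj by (rule inj_on_subset) simp
  ultimately show ?thesis
    unfolding free_intOn_def bij_betw_def using \<Lambda> by blast
qed

lemma nondeg_on_of_dual_pair: "dual_pair \<Lambda> l \<Longrightarrow> nondeg_on \<Lambda>"
  by (simp add: nondeg_on_def \<Lambda>_intOn bij_\<Lambda>)

lemma nondeg_in_of_dual_pair: "dual_pair \<Lambda> l \<Longrightarrow> nondeg_in l"
  by (simp add: nondeg_in_def l_intIn bij_G_l)

lemma frobenius_iff_nondeg_on: "(\<exists>\<psi>. frobenius_form m C \<psi>) \<longleftrightarrow> (\<exists>\<Lambda>. nondeg_on \<Lambda>)"
  by (blast dest: dual_pair_of_frobenius_form nondeg_on_of_dual_pair frobenius_form_of_nondeg)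

lemma frobenius_iff_free: "(\<exists>\<psi>. frobenius_form m C \<psi>) \<longleftrightarrow> free_intOn"
  by (blast dest: dual_pair_of_frobenius_form free_of_dual_pair dual_pair_of_free
    nondeg_on_of_dual_pair frobenius_form_of_nondeg)

lemma frobenius_iff_nondeg_in: "(\<exists>\<psi>. frobenius_form m C \<psi>) \<longleftrightarrow> (\<exists>l. nondeg_in l)"
  by (blast dest: dual_pair_of_frobenius_form nondeg_in_of_dual_pair dual_pair_of_nondeg_in
    nondeg_on_of_dual_pair frobenius_form_of_nondeg)

lemma frobenius_antipode_bij: "frobenius_form m C \<psi> \<Longrightarrow> bij S"
  by (blast dest: dual_pair_of_frobenius_form intro: antipode_bij \<Lambda>_intOn l_intIn \<Lambda>_l)

lemma frobenius_common_nondeg_in: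
  assumes "frobenius_form m C \<psi>"
  shows "\<exists>l. nondeg_in l \<and> bij_betw (\<lambda>\<omega>. DR l (\<lambda>x y. x \<odot> S (\<omega> y))) (right_dual m B) UNIV"
  using dual_pair_of_frobenius_form[OF assms] nondeg_in_of_dual_pair bij_right_B by blast

end

section \<open>Duality and dual bases\<close>

text \<open>Exchanging the legs exchanges source and target, so the inverse of \<open>S\<close>
  replaces \<open>S\<close> and the counit becomes t_L \<pi>_L. Anti-multiplicativity of
  \<open>S\<close> is a hypothesis here because a left bialgebroid alone does not give it.\<close>

lemma (in left_bialg) coopposite:
  assumes bij: "bij S" and S_mult: "\<And>x y. S (x \<odot> y) = S y \<odot> S x"
  shows "left_bialg m u C B (inv S) (\<lambda>a. map prod.swap (g a)) (\<lambda>a. iC (\<epsilon> a))"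
proof -
  have TS [simp]: "inv S (S x) = x" and ST [simp]: "S (inv S x) = x" for x
    using bij by (simp_all add: bij_is_inj bij_is_surj surj_f_inv_f)
  have T_eqI: "inv S x = y" if "S y = x" for x y
    using that TS by metis
  have T_add: "inv S (x + y) = inv S x + inv S y" for x y
    by (rule T_eqI) (simp add: S_add)
  have T_mult: "inv S (x \<odot> y) = inv S y \<odot> inv S x" for x y
    by (rule T_eqI) (simp add: S_mult)
  have T_C [simp]: "inv S c = iB c" if "c \<in> C" for c
    by (rule T_eqI) (simp add: that)
  have T_B [simp]: "inv S b = iC b" if "b \<in> B" for b
    by (rule T_eqI) (simp add: that)
  have inj_T: "inj_on (inv S) X" for X
    by (metis ST inj_onI)
  have TS_image: "inv S ` S ` X = X" for X
    by (simp add: image_image)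
  have image_T: "inv S ` C = B" "inv S ` B = C"
    using TS_image[of B] TS_image[of C] by (simp_all add: S_image_B S_image_C)
  have T_one: "inv S \<one> = \<one>"
    by (rule T_eqI) simp
  interpret T: base_pair m u C B "inv S"
    by unfold_locales
      (simp_all add: assoc distl distr T_add T_one image_T inj_T comm T_mult del: T_B T_C)
  have inv_into_T: "inv_into B (inv S) c = S c" if "c \<in> C" for c
    by (rule inv_into_f_eq) (simp_all add: inj_T that del: T_B)
  have bal: "bal (\<lambda>x y. f y x)" if "balanced m B (inv S) f" for f
  proof (rule balI)
    show "f y (c \<odot> x) = f (S c \<odot> y) x" if "c \<in> C" for c x y
      using \<open>balanced m B (inv S) f\<close> that unfolding balanced_def by (metis S_C TS)
  qed (use that in \<open>simp_all add: balanced_def biadditive_def\<close>)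
  show ?thesis
  proof unfold_locales
    show "psum (map prod.swap (g a)) (\<lambda>x y. psum (map prod.swap (g x)) (\<lambda>x' x''. h x' x'' y)) =
        psum (map prod.swap (g a)) (\<lambda>x y. psum (map prod.swap (g y)) (h x))"
      if h: "balanced_LL m B (inv S) h" for h a
    proof -
      have "h z (c \<odot> y) x = h (S c \<odot> z) y x" "h z y (c \<odot> x) = h z (S c \<odot> y) x" if "c \<in> C" for c x y z
        using h that unfolding balanced_LL_def by (metis S_C TS)+
      moreover have "triadditive h"
        using h by (simp add: balanced_LL_def)
      ultimately have "balanced_LL m C S (\<lambda>x y z. h z y x)"
        unfolding balanced_LL_def triadditive_def by simp
      from coassoc[OF this] show ?thesis
        by (simp add: psum_swap)
    qed
    show "psum (map prod.swap (g a)) (\<lambda>x y. f (x \<odot> c) y) = psum (map prod.swap (g a)) (\<lambda>x y. f x (y \<odot> inv S c))"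
      if "balanced m B (inv S) f" "c \<in> B" for f c a
      using takeuchi[OF bal[OF that(1)], of "iC c" a] that(2) by (simp add: psum_swap)
  qed (simp_all add: psum_swap bal g_add g_B_left g_C_left eps_add iC_add iC_mult eps_B eps_C
      counit_left counit_right inv_into_T g_one g_mult eps_mult_B eps_mult_C)
qed

context hopf begin

lemma coopposite:
  assumes bij: "bij S"
  shows "hopf m u C B (inv S) (\<lambda>a. map prod.swap (gL a)) (\<lambda>a. map prod.swap (hR a))
    (\<lambda>a. iC (eL a)) (\<lambda>a. iB (eR a))"
proof -
  have TS: "inv S (S x) = x" and ST: "S (inv S x) = x" for x
    using bij by (simp_all add: bij_is_inj bij_is_surj surj_f_inv_f)
  have T_eqI: "inv S x = y" if "S y = x" for x y
    using that TS by metis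
  have T_add: "inv S (x + y) = inv S x + inv S y" for x y
    by (rule T_eqI) (simp add: S_add ST)
  have T_mult: "inv S (x \<odot> y) = inv S y \<odot> inv S x" for x y
    by (rule T_eqI) (simp add: S_mult ST)
  have T_C: "inv S c = iB c" if "c \<in> C" for c
    by (rule T_eqI) (simp add: that)
  have T_B: "inv S b = iC b" if "b \<in> B" for b
    by (rule T_eqI) (simp add: that)
  interpret L': left_bialg m u C B "inv S" "\<lambda>a. map prod.swap (gL a)" "\<lambda>a. iC (eL a)"
    by (rule left_bialg.coopposite[OF left_bialg_axioms bij S_mult])
  have "left_bialg (\<lambda>x y. y \<odot> x) u B C (inv S) (\<lambda>a. map prod.swap (hR a)) (\<lambda>a. R.iC (eR a))"
    by (rule R.coopposite[OF bij]) (rule S_mult)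
  then interpret R': left_bialg "\<lambda>x y. y \<odot> x" u B C "inv S" "\<lambda>a. map prod.swap (hR a)" "\<lambda>a. iB (eR a)"
    by (simp only: R.iC_def iB_def)
  show ?thesis
  proof unfold_locales
    fix h a assume h: "balanced_LR m C B (inv S) h"
    have "h z y (x \<odot> S b) = h z (y \<odot> b) x" if "b \<in> B" for b x y z
      using h that unfolding balanced_LR_def by (metis S_B TS)
    moreover have "h z (c \<odot> y) x = h (S c \<odot> z) y x" if "c \<in> C" for c x y z
      using h that unfolding balanced_LR_def by (metis S_C TS)
    moreover have "triadditive h"
      using h by (simp add: balanced_LR_def)
    ultimately have "balanced_RL m B C S (\<lambda>x y z. h z y x)"
      unfolding balanced_RL_def triadditive_def by simp
    from mixed_RL[OF this, of a]
    show "psum (map prod.swap (hR a)) (\<lambda>y x. psum (map prod.swap (gL x)) (\<lambda>x' x''. h x' x'' y)) =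
        psum (map prod.swap (gL a)) (\<lambda>x y. psum (map prod.swap (hR y)) (\<lambda>y'' y'. h x y' y''))"
      by (simp add: psum_swap)
  next
    fix h a assume h: "balanced_RL m C B (inv S) h"
    have "h z (y \<odot> S b) x = h (z \<odot> b) y x" if "b \<in> B" for b x y z
      using h that unfolding balanced_RL_def by (metis S_B TS)
    moreover have "h z y (c \<odot> x) = h z (S c \<odot> y) x" if "c \<in> C" for c x y z
      using h that unfolding balanced_RL_def by (metis S_C TS)
    moreover have "triadditive h"
      using h by (simp add: balanced_RL_def)
    ultimately have "balanced_LR m B C S (\<lambda>x y z. h z y x)"
      unfolding balanced_LR_def triadditive_def by simp
    from mixed_LR[OF this, of a]
    show "psum (map prod.swap (gL a)) (\<lambda>x y. psum (map prod.swap (hR x)) (\<lambda>x'' x'. h x' x'' y)) =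
        psum (map prod.swap (hR a)) (\<lambda>y x. psum (map prod.swap (gL y)) (\<lambda>y' y''. h x y' y''))"
      by (simp add: psum_swap)
  next
    fix a
    have "D a (\<lambda>x y. inv S y \<odot> x) = inv S (D a (\<lambda>x y. S x \<odot> y))"
      by (simp add: psum_hom[of "inv S"] T_add T_mult TS)
    then show "psum (map prod.swap (gL a)) (\<lambda>x y. inv S x \<odot> y) = iB (eR a)"
      by (simp add: psum_swap antipode_L T_C)
  next
    fix a
    have "DR a (\<lambda>x y. y \<odot> inv S x) = inv S (DR a (\<lambda>x y. x \<odot> S y))"
      by (simp add: psum_hom[of "inv S"] T_add T_mult TS)
    then show "psum (map prod.swap (hR a)) (\<lambda>y x. x \<odot> inv S y) = iC (eL a)"
      by (simp add: psum_swap antipode_R T_B)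
  qed
qed

text \<open>Conjugation by a bijective \<open>S\<close> transports a Frobenius form over
  \<open>C\<close> to one over \<open>B\<close>; since \<open>S\<close> reverses products, the two
  members of each pair of the system change places.\<close>

lemma frobenius_form_antipode:
  assumes bij: "bij S" and \<psi>: "frobenius_form m C \<psi>"
  shows "frobenius_form m B (\<lambda>x. S (\<psi> (inv S x)))"
proof -
  have TS: "inv S (S x) = x" and ST: "S (inv S x) = x" for x
    using bij by (simp_all add: bij_is_inj bij_is_surj surj_f_inv_f)
  have T_eqI: "inv S x = y" if "S y = x" for x y
    using that TS by metis
  have T_add: "inv S (x + y) = inv S x + inv S y" for x y
    by (rule T_eqI) (simp add: S_add ST)
  have T_mult: "inv S (x \<odot> y) = inv S y \<odot> inv S x" for x y
    by (rule T_eqI) (simp add: S_mult ST)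
  have T_B: "inv S b = iC b" if "b \<in> B" for b
    by (rule T_eqI) (simp add: that)
  obtain uv where uv: "\<And>a. psum uv (\<lambda>u v. \<psi> (a \<odot> u) \<odot> v) = a" "\<And>a. psum uv (\<lambda>u v. u \<odot> \<psi> (v \<odot> a)) = a"
    using \<psi> by (auto simp: frobenius_form_def)
  note D = right_dualD[OF frobenius_formD(1)[OF \<psi>]] frobenius_formD(2)[OF \<psi>]
  have map: "psum (map (\<lambda>(u, v). (S v, S u)) uv) f = psum uv (\<lambda>u v. f (S v) (S u))" for f :: "'a \<Rightarrow> 'a \<Rightarrow> 'a"
    by (simp add: psum_def comp_def case_prod_unfold)
  have "psum uv (\<lambda>u v. S (\<psi> (inv S (a \<odot> S v))) \<odot> S u) = S (psum uv (\<lambda>u v. u \<odot> \<psi> (v \<odot> inv S a)))"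
    "psum uv (\<lambda>u v. S v \<odot> S (\<psi> (inv S (S u \<odot> a)))) = S (psum uv (\<lambda>u v. \<psi> (inv S a \<odot> u) \<odot> v))" for a
    by (simp_all add: T_mult TS S_mult flip: psum_S)
  then show ?thesis
    unfolding frobenius_form_def
    by (intro conjI right_dualI exI[of _ "map (\<lambda>(u, v). (S v, S u)) uv"])
      (simp_all add: map uv ST T_add T_mult T_B D S_add S_mult)
qed

end

lemma frobenius_form_opposite:
  "frobenius_form (\<lambda>x y. m y x) B \<psi> \<longleftrightarrow> frobenius_form m B \<psi>"
proof -
  have *: "frobenius_form (\<lambda>x y. m y x) B \<psi>" if \<psi>: "frobenius_form m B \<psi>" for m and \<psi> :: "'a::ab_group_add \<Rightarrow> 'a"
  proof -
    obtain uv where uv: "\<And>a. psum uv (\<lambda>u v. m (\<psi> (m a u)) v) = a" "\<And>a. psum uv (\<lambda>u v. m u (\<psi> (m v a))) = a"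
      using \<psi> by (auto simp: frobenius_form_def)
    show ?thesis
      using frobenius_formD[OF \<psi>] right_dualD[OF frobenius_formD(1)[OF \<psi>]]
      unfolding frobenius_form_def
      by (intro conjI right_dualI exI[of _ "map prod.swap uv"]) (simp_all add: psum_swap uv)
  qed
  show ?thesis
    using *[of m \<psi>] *[of "\<lambda>x y. m y x" \<psi>] by blast
qed

definition dual_basis :: "('a \<Rightarrow> 'a \<Rightarrow> 'a) \<Rightarrow> 'a set \<Rightarrow> nat \<Rightarrow> (nat \<Rightarrow> 'a::ab_group_add) \<Rightarrow> (nat \<Rightarrow> 'a \<Rightarrow> 'a) \<Rightarrow> bool"
  where "dual_basis m C n b \<beta> \<longleftrightarrow> (\<forall>i. \<beta> i \<in> right_dual m C) \<and> (\<forall>a. (\<Sum>i<n. m (b i) (\<beta> i a)) = a)"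

lemma dual_basis_mono:
  assumes "dual_basis m C n b \<beta>" "n \<le> k" "\<And>x. m 0 x = 0"
  shows "dual_basis m C k (\<lambda>i. if i < n then b i else 0) \<beta>"
proof -
  have "(\<Sum>i<k. m (if i < n then b i else 0) (\<beta> i a)) = (\<Sum>i<n. m (b i) (\<beta> i a))" for a
    by (rule sum.mono_neutral_cong_right) (use assms(2,3) in auto)
  then show ?thesis
    using assms(1) by (simp add: dual_basis_def)
qed

lemma (in hopf) hopf_fgpI:
  assumes b: "dual_basis m C n1 b \<beta>" and e: "dual_basis (\<lambda>x y. y \<odot> x) C n2 e F"
  shows "\<exists>n b \<beta> e F. hopf_fgp m u B C S gL hR eL eR n b \<beta> e F"
proof -
  define k where "k = max n1 n2"
  have "dual_basis m C k (\<lambda>i. if i < n1 then b i else 0) \<beta>"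
    "dual_basis (\<lambda>x y. y \<odot> x) C k (\<lambda>i. if i < n2 then e i else 0) F"
    using dual_basis_mono[OF b, of k] dual_basis_mono[OF e, of k] by (simp_all add: k_def)
  then have "hopf_fgp m u B C S gL hR eL eR k (\<lambda>i. if i < n1 then b i else 0) \<beta> (\<lambda>i. if i < n2 then e i else 0) F"
    by unfold_locales (auto simp: dual_basis_def)
  then show ?thesis
    by blast
qed

section \<open>Passage from the definitions\<close>

lemma formal_sum_eq_sum_list:
  fixes f :: "'x \<Rightarrow> 'z::ab_group_add"
  assumes "formal_sum_eq E xs ys" "\<And>xs ys. E xs ys \<Longrightarrow> sum_list (map f xs) = sum_list (map f ys)"
  shows "sum_list (map f xs) = sum_list (map f ys)"
  using assms(1) by induction (simp_all add: assms(2) add.commute)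

lemma tensor_eq_iff: "tensor ra la xs = tensor ra la ys \<longleftrightarrow> formal_sum_eq (tensor_rel ra la) xs ys"
  unfolding tensor_def by (blast intro: formal_sum_eq.intros)

lemma tensor3_eq_iff:
  "tensor3 ra la ra' la' xs = tensor3 ra la ra' la' ys \<longleftrightarrow> formal_sum_eq (tensor3_rel ra la ra' la') xs ys"
  unfolding tensor3_def by (blast intro: formal_sum_eq.intros)

lemma tensor_sw: "tensor ra la (sw (tensor ra la xs)) = tensor ra la xs"
proof -
  have "sw (tensor ra la xs) \<in> tensor ra la xs"
    unfolding sw_def by (rule someI[of _ xs]) (simp add: tensor_def formal_sum_eq.refl)
  then show ?thesis
    unfolding tensor_eq_iff by (simp add: tensor_def formal_sum_eq.sym)
qed

lemma biadditive_zero: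
  assumes "biadditive f"
  shows "f 0 y = 0" "f x 0 = 0"
  using assms[unfolded biadditive_def, THEN conjunct1, rule_format, of 0 0 y]
    assms[unfolded biadditive_def, THEN conjunct2, rule_format, of x 0 0] by simp_all

text \<open>The universal property of the tensor product; it makes sums over a representative chosen
  by \<open>sw\<close> independent of the choice.\<close>

lemma tensor_psum:
  fixes f :: "'a::ab_group_add \<Rightarrow> 'a \<Rightarrow> 'a"
  assumes eq: "tensor ra la xs = tensor ra la ys"
    and f: "biadditive f" "\<And>b x y. f (ra b x) y = f x (la b y)"
  shows "psum xs f = psum ys f"
proof -
  have "sum_list (map (\<lambda>(x, y). f x y) xs) = sum_list (map (\<lambda>(x, y). f x y) ys)"
  proof (rule formal_sum_eq_sum_list[OF eq[unfolded tensor_eq_iff]])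
    fix xs ys assume "tensor_rel ra la xs ys"
    then show "sum_list (map (\<lambda>(x, y). f x y) xs) = sum_list (map (\<lambda>(x, y). f x y) ys)"
      by cases (use f biadditive_zero[OF f(1)] in \<open>simp_all add: biadditive_def\<close>)
  qed
  then show ?thesis
    by (simp add: psum_def)
qed

lemma triadditive_zero:
  assumes "triadditive f"
  shows "f 0 y z = 0" "f x 0 z = 0" "f x y 0 = 0"
  using assms[unfolded triadditive_def, THEN conjunct1, rule_format, of 0 0 y z]
    assms[unfolded triadditive_def, THEN conjunct2, THEN conjunct1, rule_format, of x 0 0 z]
    assms[unfolded triadditive_def, THEN conjunct2, THEN conjunct2, rule_format, of x y 0 0] by simp_all

lemma tensor3_sum_list:
  fixes f :: "'a::ab_group_add \<Rightarrow> 'a \<Rightarrow> 'a \<Rightarrow> 'a"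
  assumes eq: "tensor3 ra la ra' la' xs = tensor3 ra la ra' la' ys"
    and f: "triadditive f" "\<And>b x y z. f (ra b x) y z = f x (la b y) z"
      "\<And>b x y z. f x (ra' b y) z = f x y (la' b z)"
  shows "(\<Sum>(x, y, z)\<leftarrow>xs. f x y z) = (\<Sum>(x, y, z)\<leftarrow>ys. f x y z)"
proof (rule formal_sum_eq_sum_list[OF eq[unfolded tensor3_eq_iff]])
  fix xs ys assume "tensor3_rel ra la ra' la' xs ys"
  then show "(\<Sum>(x, y, z)\<leftarrow>xs. f x y z) = (\<Sum>(x, y, z)\<leftarrow>ys. f x y z)"
    by cases (use f triadditive_zero[OF f(1)] in \<open>simp_all add: triadditive_def\<close>)
qed

lemma psum_append: "psum (xs @ ys) f = psum xs f + psum ys f"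
  by (simp add: psum_def)

lemma psum_map: "psum [(p x y, q x y). (x, y) \<leftarrow> xs] f = psum xs (\<lambda>x y. f (p x y) (q x y))"
  by (induction xs) (auto simp: psum_Cons)

lemma psum_concat:
  "psum [(p x y x' y', q x y x' y'). (x, y) \<leftarrow> xs, (x', y') \<leftarrow> ys x y] f =
   psum xs (\<lambda>x y. psum (ys x y) (\<lambda>x' y'. f (p x y x' y') (q x y x' y')))"
  by (induction xs) (auto simp: psum_Cons psum_append psum_map)

lemma sum_list3_left:
  fixes f :: "'a \<Rightarrow> 'a \<Rightarrow> 'a \<Rightarrow> 'z::ab_group_add"
  shows "(\<Sum>(x, y, z)\<leftarrow>[(x', x'', y). (x, y) \<leftarrow> xs, (x', x'') \<leftarrow> g x]. f x y z) =
    psum xs (\<lambda>x y. psum (g x) (\<lambda>x' x''. f x' x'' y))"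
  by (induction xs) (auto simp: psum_def comp_def case_prod_unfold)

lemma sum_list3_right:
  fixes f :: "'a \<Rightarrow> 'a \<Rightarrow> 'a \<Rightarrow> 'z::ab_group_add"
  shows "(\<Sum>(x, y, z)\<leftarrow>[(x, y', y''). (x, y) \<leftarrow> xs, (y', y'') \<leftarrow> g y]. f x y z) =
    psum xs (\<lambda>x y. psum (g y) (\<lambda>y' y''. f x y' y''))"
  by (induction xs) (auto simp: psum_def comp_def case_prod_unfold)

section \<open>Bialgebroids expressed through the ranges of source and target\<close>

lemma algebra_homD:
  assumes "algebra_hom kB kA s"
  shows "s (x + y) = s x + s y" "s (x * y) = s x * s y" "s 1 = 1" "s (- x) = - s x" "s 0 = 0"
proof -
  show add: "s (x + y) = s x + s y" for x y
    using assms by (simp add: algebra_hom_def)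
  show zero: "s 0 = 0"
    using add[of 0 0] by simp
  show "s (- x) = - s x"
    using add[of x "- x"] zero by (simp add: eq_neg_iff_add_eq_0 add.commute)
qed (use assms in \<open>simp_all add: algebra_hom_def\<close>)

lemma algebra_hom_oppD:
  assumes "algebra_hom kB kA (t \<circ> unopp)"
  shows "t (x + y) = t x + t y" "t (x * y) = t y * t x" "t 1 = 1" "t (- x) = - t x" "t 0 = 0"
  using algebra_homD(1)[OF assms, of "Opp x" "Opp y"] algebra_homD(2)[OF assms, of "Opp y" "Opp x"]
    algebra_homD(3)[OF assms] algebra_homD(4)[OF assms, of "Opp x"] algebra_homD(5)[OF assms]
  by (simp_all add: plus_opp_def times_opp_def one_opp_def uminus_opp_def zero_opp_def)

lemma left_bialg_of_bialgebroid:
  fixes s t :: "'l::{ring,monoid_mult} \<Rightarrow> 'a::{ring,monoid_mult}"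
  assumes bi: "left_bialgebroid kA kL s t \<gamma> \<pi>"
    and base: "base_pair (*) 1 (range s) (range t) S" and S_t: "\<And>l. S (t l) = s l"
  shows "left_bialg (*) 1 (range s) (range t) S (\<lambda>a. sw (\<gamma> a)) (\<lambda>a. s (\<pi> a))"
proof -
  interpret base_pair "(*)" 1 "range s" "range t" S
    by (rule base)
  have s_hom: "algebra_hom kL kA s" and t_hom: "algebra_hom (k_opp kL) kA (t \<circ> unopp)"
    using bi by (simp_all add: left_bialgebroid_def)
  note s = algebra_homD[OF s_hom] and t = algebra_hom_oppD[OF t_hom]
  have psum_eq: "psum (sw (\<gamma> a)) f = psum xs f"
    if f: "balanced (*) (range t) S f" and eq: "\<gamma> a = tensorL s t xs" for f a xs
    using that unfolding tensorL_def balanced_def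
    by (intro tensor_psum[of "\<lambda>l x. t l * x" "\<lambda>l y. s l * y"]) (auto simp: tensor_sw S_t)
  have psum_eq': "psum xs f = psum ys f"
    if f: "balanced (*) (range t) S f" and eq: "tensorL s t xs = tensorL s t ys" for f xs ys
    using that unfolding tensorL_def balanced_def
    by (intro tensor_psum[of "\<lambda>l x. t l * x" "\<lambda>l y. s l * y"]) (auto simp: S_t)
  have iC: "inv_into (range t) S (s l) = t l" for l
    using iC_S[of "t l"] by (simp add: iC_def S_t)
  show ?thesis
  proof unfold_locales
    fix f a a' assume f: "balanced (*) (range t) S f"
    have "\<gamma> (a + a') = tensorL s t (sw (\<gamma> a) @ sw (\<gamma> a'))"
      using bi unfolding left_bialgebroid_def by iprover
    from psum_eq[OF f this]
    show "psum (sw (\<gamma> (a + a'))) f = psum (sw (\<gamma> a)) f + psum (sw (\<gamma> a')) f"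
      by (simp add: psum_append)
    have "\<gamma> (a * a') = tensorL s t [(x * x', y * y'). (x, y) \<leftarrow> sw (\<gamma> a), (x', y') \<leftarrow> sw (\<gamma> a')]"
      using bi unfolding left_bialgebroid_def by iprover
    from psum_eq[OF f this]
    show "psum (sw (\<gamma> (a * a'))) f = psum (sw (\<gamma> a)) (\<lambda>x y. psum (sw (\<gamma> a')) (\<lambda>x' y'. f (x * x') (y * y')))"
      by (simp add: psum_concat)
    have "\<gamma> 1 = tensorL s t [(1, 1)]"
      using bi unfolding left_bialgebroid_def by iprover
    from psum_eq[OF f this] show "psum (sw (\<gamma> 1)) f = f 1 1"
      by (simp add: psum_Cons)
    have lin: "\<gamma> (s l * t l' * a) = tensorL s t [(s l * x, t l' * y). (x, y) \<leftarrow> sw (\<gamma> a)]" for l l'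
      using bi unfolding left_bialgebroid_def by iprover
    show "psum (sw (\<gamma> (b * a))) f = psum (sw (\<gamma> a)) (\<lambda>x y. f (b * x) y)" if "b \<in> range s" for b
      using psum_eq[OF f lin[of _ 1]] that by (auto simp: psum_map t)
    show "psum (sw (\<gamma> (c * a))) f = psum (sw (\<gamma> a)) (\<lambda>x y. f x (c * y))" if "c \<in> range t" for c
      using psum_eq[OF f lin[of 1]] that by (auto simp: psum_map s)
    show "psum (sw (\<gamma> a)) (\<lambda>x y. f (x * c) y) = psum (sw (\<gamma> a)) (\<lambda>x y. f x (y * S c))"
      if c: "c \<in> range t" for c
    proof -
      obtain l where l: "c = t l"
        using c by auto
      have "tensorL s t [(x * t l, y). (x, y) \<leftarrow> sw (\<gamma> a)] = tensorL s t [(x, y * s l). (x, y) \<leftarrow> sw (\<gamma> a)]"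
        using bi unfolding left_bialgebroid_def by iprover
      from psum_eq'[OF f this] show ?thesis
        by (simp add: psum_map l S_t)
    qed
  next
    fix h a assume h: "balanced_LL (*) (range t) S h"
    have "tensor3 (\<lambda>l x. t l * x) (\<lambda>l y. s l * y) (\<lambda>l x. t l * x) (\<lambda>l y. s l * y)
        [(x', x'', y). (x, y) \<leftarrow> sw (\<gamma> a), (x', x'') \<leftarrow> sw (\<gamma> x)] =
      tensor3 (\<lambda>l x. t l * x) (\<lambda>l y. s l * y) (\<lambda>l x. t l * x) (\<lambda>l y. s l * y)
        [(x, y', y''). (x, y) \<leftarrow> sw (\<gamma> a), (y', y'') \<leftarrow> sw (\<gamma> y)]"
      using bi unfolding left_bialgebroid_def by iprover
    from tensor3_sum_list[OF this, of h]
    show "psum (sw (\<gamma> a)) (\<lambda>x y. psum (sw (\<gamma> x)) (\<lambda>x' x''. h x' x'' y)) =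
        psum (sw (\<gamma> a)) (\<lambda>x y. psum (sw (\<gamma> y)) (h x))"
      using h unfolding balanced_LL_def sum_list3_left sum_list3_right by (simp add: S_t)
  next
    have \<pi>: "\<pi> (s l * t l' * a) = l * \<pi> a * l'" for l l' a
      using bi unfolding left_bialgebroid_def by iprover
    show "s (\<pi> (b * a)) = b * s (\<pi> a)" if "b \<in> range s" for a b
      using \<pi>[of _ 1 a] that by (auto simp: s t)
    show "s (\<pi> (c * a)) = s (\<pi> a) * S c" if "c \<in> range t" for a c
      using \<pi>[of 1 _ a] that by (auto simp: s S_t)
    show "psum (sw (\<gamma> a)) (\<lambda>x y. s (\<pi> x) * y) = a"
      "psum (sw (\<gamma> a)) (\<lambda>x y. inv_into (range t) S (s (\<pi> y)) * x) = a" for a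
      using bi by (simp_all add: left_bialgebroid_def iC psum_def)
  qed (use bi in \<open>simp_all add: left_bialgebroid_def iC s\<close>)
qed

lemma left_bialg_of_right_bialgebroid:
  fixes s t :: "'r::{ring,monoid_mult} \<Rightarrow> 'a::{ring,monoid_mult}"
  assumes bi: "right_bialgebroid kA kR s t \<gamma> \<pi>"
    and base: "base_pair (*) 1 (range t) (range s) S" and S_t: "\<And>r. S (t r) = s r"
  shows "left_bialg (\<lambda>x y. y * x) 1 (range s) (range t) S (\<lambda>a. map prod.swap (sw (\<gamma> a))) (\<lambda>a. s (\<pi> a))"
proof -
  interpret base_pair "(*)" 1 "range t" "range s" S
    by (rule base)
  interpret O: base_pair "\<lambda>x y. y * x" 1 "range s" "range t" S
    by (rule opposite)
  have s_hom: "algebra_hom kR kA s" and t_hom: "algebra_hom (k_opp kR) kA (t \<circ> unopp)"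
    using bi by (simp_all add: right_bialgebroid_def)
  note s = algebra_homD[OF s_hom] and t = algebra_hom_oppD[OF t_hom]
  have psum_eq: "psum (sw (\<gamma> a)) (\<lambda>x y. f y x) = psum xs (\<lambda>x y. f y x)"
    if f: "balanced (\<lambda>x y. y * x) (range t) S f" and eq: "\<gamma> a = tensorR s t xs" for f a xs
    using that unfolding tensorR_def balanced_def biadditive_def
    by (intro tensor_psum[of "\<lambda>l x. x * s l" "\<lambda>l y. y * t l"]) (auto simp: tensor_sw S_t biadditive_def)
  have psum_eq': "psum xs (\<lambda>x y. f y x) = psum ys (\<lambda>x y. f y x)"
    if f: "balanced (\<lambda>x y. y * x) (range t) S f" and eq: "tensorR s t xs = tensorR s t ys" for f xs ys
    using that unfolding tensorR_def balanced_def biadditive_def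
    by (intro tensor_psum[of "\<lambda>l x. x * s l" "\<lambda>l y. y * t l"]) (auto simp: S_t biadditive_def)
  have iC: "inv_into (range t) S (s l) = t l" for l
    using iB_S[of "t l"] by (simp add: iB_def S_t)
  show ?thesis
  proof unfold_locales
    fix f a a' assume f: "balanced (\<lambda>x y. y * x) (range t) S f"
    have "\<gamma> (a + a') = tensorR s t (sw (\<gamma> a) @ sw (\<gamma> a'))"
      using bi unfolding right_bialgebroid_def by iprover
    from psum_eq[OF f this]
    show "psum (map prod.swap (sw (\<gamma> (a + a')))) f =
        psum (map prod.swap (sw (\<gamma> a))) f + psum (map prod.swap (sw (\<gamma> a'))) f"
      by (simp add: psum_append psum_swap)
    have "\<gamma> (a' * a) = tensorR s t [(x * x', y * y'). (x, y) \<leftarrow> sw (\<gamma> a'), (x', y') \<leftarrow> sw (\<gamma> a)]"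
      using bi unfolding right_bialgebroid_def by iprover
    from psum_eq[OF f this]
    show "psum (map prod.swap (sw (\<gamma> (a' * a)))) f = psum (map prod.swap (sw (\<gamma> a)))
        (\<lambda>x y. psum (map prod.swap (sw (\<gamma> a'))) (\<lambda>x' y'. f (x' * x) (y' * y)))"
      by (simp add: psum_concat psum_swap psum_commute[of "sw (\<gamma> a)"])
    have "\<gamma> 1 = tensorR s t [(1, 1)]"
      using bi unfolding right_bialgebroid_def by iprover
    from psum_eq[OF f this] show "psum (map prod.swap (sw (\<gamma> 1))) f = f 1 1"
      by (simp add: psum_Cons psum_swap)
    have lin: "\<gamma> (a * s r' * t r) = tensorR s t [(x * t r, y * s r'). (x, y) \<leftarrow> sw (\<gamma> a)]" for r r'
      using bi unfolding right_bialgebroid_def by iprover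
    show "psum (map prod.swap (sw (\<gamma> (a * b)))) f = psum (map prod.swap (sw (\<gamma> a))) (\<lambda>x y. f (x * b) y)"
      if "b \<in> range s" for b
      using psum_eq[OF f lin[of _ 1]] that by (auto simp: psum_map psum_swap t)
    show "psum (map prod.swap (sw (\<gamma> (a * c)))) f = psum (map prod.swap (sw (\<gamma> a))) (\<lambda>x y. f x (y * c))"
      if "c \<in> range t" for c
      using psum_eq[OF f lin[of 1]] that by (auto simp: psum_map psum_swap s)
    show "psum (map prod.swap (sw (\<gamma> a))) (\<lambda>x y. f (c * x) y) =
        psum (map prod.swap (sw (\<gamma> a))) (\<lambda>x y. f x (S c * y))"
      if c: "c \<in> range t" for c
    proof -
      obtain r where r: "c = t r"
        using c by auto
      have "tensorR s t [(s r * x, y). (x, y) \<leftarrow> sw (\<gamma> a)] = tensorR s t [(x, t r * y). (x, y) \<leftarrow> sw (\<gamma> a)]"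
        using bi unfolding right_bialgebroid_def by iprover
      from psum_eq'[OF f this] show ?thesis
        by (simp add: psum_map psum_swap r S_t)
    qed
  next
    fix h a assume h: "balanced_LL (\<lambda>x y. y * x) (range t) S h"
    have "tensor3 (\<lambda>r x. x * s r) (\<lambda>r y. y * t r) (\<lambda>r x. x * s r) (\<lambda>r y. y * t r)
        [(x', x'', y). (x, y) \<leftarrow> sw (\<gamma> a), (x', x'') \<leftarrow> sw (\<gamma> x)] =
      tensor3 (\<lambda>r x. x * s r) (\<lambda>r y. y * t r) (\<lambda>r x. x * s r) (\<lambda>r y. y * t r)
        [(x, y', y''). (x, y) \<leftarrow> sw (\<gamma> a), (y', y'') \<leftarrow> sw (\<gamma> y)]"
      using bi unfolding right_bialgebroid_def by iprover
    from tensor3_sum_list[OF this, of "\<lambda>x y z. h z y x"]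
    show "psum (map prod.swap (sw (\<gamma> a))) (\<lambda>x y. psum (map prod.swap (sw (\<gamma> x))) (\<lambda>x' x''. h x' x'' y)) =
        psum (map prod.swap (sw (\<gamma> a))) (\<lambda>x y. psum (map prod.swap (sw (\<gamma> y))) (h x))"
      using h unfolding balanced_LL_def triadditive_def sum_list3_left sum_list3_right
      by (simp add: S_t psum_swap)
  next
    have \<pi>: "\<pi> (a * s r' * t r) = r * \<pi> a * r'" for r r' a
      using bi unfolding right_bialgebroid_def by iprover
    show "s (\<pi> (a * b)) = s (\<pi> a) * b" if "b \<in> range s" for a b
      using \<pi>[of a _ 1] that by (auto simp: s t)
    show "s (\<pi> (a * c)) = S c * s (\<pi> a)" if "c \<in> range t" for a c
      using \<pi>[of a 1] that by (auto simp: s S_t)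
    show "psum (map prod.swap (sw (\<gamma> a))) (\<lambda>x y. y * s (\<pi> x)) = a"
      "psum (map prod.swap (sw (\<gamma> a))) (\<lambda>x y. x * inv_into (range t) S (s (\<pi> y))) = a" for a
      using bi by (simp_all add: right_bialgebroid_def iC psum_def case_prod_unfold comp_def)
  qed (use bi in \<open>simp_all add: right_bialgebroid_def iC s\<close>)
qed

section \<open>Hopf algebroids expressed through the common ranges\<close>

locale hopf_algebroid_data =
  fixes kA :: "'k::{comm_ring,monoid_mult} \<Rightarrow> 'a::{ring,monoid_mult} \<Rightarrow> 'a"
    and kL :: "'k \<Rightarrow> 'l::{ring,monoid_mult} \<Rightarrow> 'l"
    and kR :: "'k \<Rightarrow> 'r::{ring,monoid_mult} \<Rightarrow> 'r"
    and sL tL :: "'l \<Rightarrow> 'a" and \<gamma>L :: "'a \<Rightarrow> ('a \<times> 'a) list set" and \<pi>L :: "'a \<Rightarrow> 'l"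
    and sR tR :: "'r \<Rightarrow> 'a" and \<gamma>R :: "'a \<Rightarrow> ('a \<times> 'a) list set" and \<pi>R :: "'a \<Rightarrow> 'r"
    and S :: "'a \<Rightarrow> 'a"
  assumes hopf_algebroid: "hopf_algebroid kA kL kR sL tL \<gamma>L \<pi>L sR tR \<gamma>R \<pi>R S"
begin

lemma bialgebroids: "left_bialgebroid kA kL sL tL \<gamma>L \<pi>L" "right_bialgebroid kA kR sR tR \<gamma>R \<pi>R"
  using hopf_algebroid by (simp_all add: hopf_algebroid_def)

lemma homs: "algebra_hom kL kA sL" "algebra_hom (k_opp kL) kA (tL \<circ> unopp)"
  "algebra_hom kR kA sR" "algebra_hom (k_opp kR) kA (tR \<circ> unopp)"
  using bialgebroids by (simp_all add: left_bialgebroid_def right_bialgebroid_def)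

lemmas sL = algebra_homD[OF homs(1)] and tL = algebra_hom_oppD[OF homs(2)]
  and sR = algebra_homD[OF homs(3)] and tR = algebra_hom_oppD[OF homs(4)]

lemma pi_left_inverse [simp]: "\<pi>L (sL l) = l" "\<pi>L (tL l) = l" "\<pi>R (sR r) = r" "\<pi>R (tR r) = r"
proof -
  have L: "\<pi>L (sL l * tL l' * a) = l * \<pi>L a * l'" "\<pi>L 1 = 1" for l l' a
    using bialgebroids(1) unfolding left_bialgebroid_def by iprover+
  have R: "\<pi>R (a * sR r' * tR r) = r * \<pi>R a * r'" "\<pi>R 1 = 1" for r r' a
    using bialgebroids(2) unfolding right_bialgebroid_def by iprover+
  show "\<pi>L (sL l) = l" "\<pi>L (tL l) = l"
    using L(1)[of l 1 1] L(1)[of 1 l 1] by (simp_all add: L sL tL)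
  show "\<pi>R (sR r) = r" "\<pi>R (tR r) = r"
    using R(1)[of 1 r 1] R(1)[of 1 1 r] by (simp_all add: R sR tR)
qed

lemma inj_bases: "inj sL" "inj tL" "inj sR" "inj tR"
  by (metis injI pi_left_inverse)+

lemma mixed_pi: "sL (\<pi>L (tR r)) = tR r" "tL (\<pi>L (sR r)) = sR r"
  "sR (\<pi>R (tL l)) = tL l" "tR (\<pi>R (sL l)) = sL l"
  using hopf_algebroid by (simp_all add: hopf_algebroid_def fun_eq_iff)

lemma ranges: "range tR = range sL" "range sR = range tL"
  by (metis (no_types, lifting) mixed_pi rangeE rangeI subsetI subset_antisym)+

lemma S_add: "S (a + a') = S a + S a'"
  using hopf_algebroid by (simp add: hopf_algebroid_def)

lemma S_lin: "S (tL l' * a * tL l) = sL l * S a * sL l'" "S (tR r' * a * tR r) = sR r * S a * sR r'"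
  using hopf_algebroid by (simp_all add: hopf_algebroid_def)

lemma antipode: "psum (sw (\<gamma>L a)) (\<lambda>x y. S x * y) = sR (\<pi>R a)"
  "psum (sw (\<gamma>R a)) (\<lambda>x y. x * S y) = sL (\<pi>L a)"
  using hopf_algebroid by (simp_all add: hopf_algebroid_def psum_def)

text \<open>Evaluate the antipode axiom at 1, whose left coproduct is trivial. The linearity axioms
  make \<open>S x * y\<close> balanced, so the chosen representative may be replaced by the pair of
  ones.\<close>

lemma S_one: "S 1 = 1"
proof -
  have "\<gamma>L 1 = tensorL sL tL [(1, 1)]"
    using bialgebroids(1) by (simp add: left_bialgebroid_def)
  then have "psum (sw (\<gamma>L 1)) (\<lambda>x y. S x * y) = psum [(1, 1)] (\<lambda>x y. S x * y)"
    using S_lin(1)[of _ _ 1]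
    by (intro tensor_psum[of "\<lambda>l x. tL l * x" "\<lambda>l y. sL l * y"])
      (simp_all add: tensorL_def tensor_sw biadditive_def S_add tL sL algebra_simps)
  moreover have "\<pi>R 1 = 1"
    using bialgebroids(2) by (simp add: right_bialgebroid_def)
  ultimately show ?thesis
    by (simp add: antipode psum_Cons sR)
qed

lemma S_tL [simp]: "S (tL l) = sL l" and S_tR [simp]: "S (tR r) = sR r"
  using S_lin(1)[of l 1 1] S_lin(2)[of r 1 1] by (simp_all add: S_one sL tL sR tR)

lemma base_pair: "base_pair (*) 1 (range sL) (range tL) S"
proof
  have "sL l * tL l' = tL l' * sL l" for l l'
    using bialgebroids(1) by (simp add: left_bialgebroid_def)
  then show "b * c = c * b" if "b \<in> range sL" "c \<in> range tL" for b c
    using that by auto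
  \<comment> \<open>The values of \<open>S\<close> on this range are accessible only by writing its
    elements as tR(r), where \<open>S\<close> gives sR(r).\<close>
  show "inj_on S (range sL)"
    unfolding ranges(1)[symmetric] by (auto intro!: inj_onI dest: injD[OF inj_bases(3)])
  show "inj_on S (range tL)"
    by (auto intro!: inj_onI dest: injD[OF inj_bases(1)])
  show "S ` range sL = range tL"
    unfolding ranges[symmetric] by (simp add: image_image)
  show "S ` range tL = range sL"
    by (simp add: image_image)
  show "S (c' * a * c) = S c * S a * S c'" if "c \<in> range tL" "c' \<in> range tL" for a c c'
    using that by (auto simp: S_lin)
  show "S (b' * a * b) = S b * S a * S b'" if "b \<in> range sL" "b' \<in> range sL" for a b b'
    using that unfolding ranges(1)[symmetric] by (auto simp: S_lin)
  show "1 \<in> range sL" "1 \<in> range tL"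
    by (metis rangeI sL(3) tL(3))+
qed (auto simp: distrib_left distrib_right mult.assoc S_add S_one simp flip: sL(1,2,4) tL(1,2,4))

end

lemma (in hopf_algebroid_data) hopf:
  "hopf (*) 1 (range sL) (range tL) S (\<lambda>a. sw (\<gamma>L a)) (\<lambda>a. map prod.swap (sw (\<gamma>R a)))
    (\<lambda>a. sL (\<pi>L a)) (\<lambda>a. sR (\<pi>R a))"
proof -
  interpret L: left_bialg "(*)" 1 "range sL" "range tL" S "\<lambda>a. sw (\<gamma>L a)" "\<lambda>a. sL (\<pi>L a)"
    by (rule left_bialg_of_bialgebroid[OF bialgebroids(1) base_pair S_tL])
  interpret R: left_bialg "\<lambda>x y. y * x" 1 "range tL" "range sL" S "\<lambda>a. map prod.swap (sw (\<gamma>R a))"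
      "\<lambda>a. sR (\<pi>R a)"
    using left_bialg_of_right_bialgebroid[OF bialgebroids(2) _ S_tR] base_pair by (simp add: ranges)
  show ?thesis
  proof unfold_locales
    fix h a assume h: "balanced_LR (*) (range sL) (range tL) S h"
    have eq: "tensor3 (\<lambda>l x. tL l * x) (\<lambda>l y. sL l * y) (\<lambda>r x. x * sR r) (\<lambda>r y. y * tR r)
        [(x', x'', y). (x, y) \<leftarrow> sw (\<gamma>R a), (x', x'') \<leftarrow> sw (\<gamma>L x)] =
      tensor3 (\<lambda>l x. tL l * x) (\<lambda>l y. sL l * y) (\<lambda>r x. x * sR r) (\<lambda>r y. y * tR r)
        [(x, y', y''). (x, y) \<leftarrow> sw (\<gamma>L a), (y', y'') \<leftarrow> sw (\<gamma>R y)]"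
      using hopf_algebroid unfolding hopf_algebroid_def by iprover
    have "h x (y * sR r) z = h x y (z * tR r)" for x y z r
      using h ranges(1) unfolding balanced_LR_def by (metis S_tR rangeI)
    then show "psum (map prod.swap (sw (\<gamma>R a))) (\<lambda>y x. psum (sw (\<gamma>L x)) (\<lambda>x' x''. h x' x'' y)) =
        psum (sw (\<gamma>L a)) (\<lambda>x y. psum (map prod.swap (sw (\<gamma>R y))) (\<lambda>y'' y'. h x y' y''))"
      using tensor3_sum_list[OF eq, of h] h
      unfolding balanced_LR_def sum_list3_left sum_list3_right by (simp add: psum_swap)
  next
    fix h a assume h: "balanced_RL (*) (range sL) (range tL) S h"
    have eq: "tensor3 (\<lambda>r x. x * sR r) (\<lambda>r y. y * tR r) (\<lambda>l x. tL l * x) (\<lambda>l y. sL l * y)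
        [(x', x'', y). (x, y) \<leftarrow> sw (\<gamma>L a), (x', x'') \<leftarrow> sw (\<gamma>R x)] =
      tensor3 (\<lambda>r x. x * sR r) (\<lambda>r y. y * tR r) (\<lambda>l x. tL l * x) (\<lambda>l y. sL l * y)
        [(x, y', y''). (x, y) \<leftarrow> sw (\<gamma>R a), (y', y'') \<leftarrow> sw (\<gamma>L y)]"
      using hopf_algebroid unfolding hopf_algebroid_def by iprover
    have "h (x * sR r) y z = h x (y * tR r) z" for x y z r
      using h ranges(1) unfolding balanced_RL_def by (metis S_tR rangeI)
    then show "psum (sw (\<gamma>L a)) (\<lambda>x y. psum (map prod.swap (sw (\<gamma>R x))) (\<lambda>x'' x'. h x' x'' y)) =
        psum (map prod.swap (sw (\<gamma>R a))) (\<lambda>y x. psum (sw (\<gamma>L y)) (\<lambda>y' y''. h x y' y''))"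
      using tensor3_sum_list[OF eq, of h] h
      unfolding balanced_RL_def sum_list3_left sum_list3_right by (simp add: psum_swap)
  qed (simp_all add: antipode psum_swap)
qed

section \<open>Dual bases of finitely generated projective modules\<close>

lemma sum_hom_set:
  fixes h :: "'b::ab_group_add \<Rightarrow> 'c::ab_group_add"
  assumes "\<And>x y. h (x + y) = h x + h y"
  shows "h (\<Sum>i\<in>I. f i) = (\<Sum>i\<in>I. h (f i))"
proof -
  have "h 0 = 0"
    using assms[of 0 0] by simp
  then show ?thesis
    by (induction I rule: infinite_finite_induct) (simp_all add: assms)
qed

lemma lookup_scale:
  "Poly_Mapping.lookup (Poly_Mapping.map ((*) b) z) x = b * Poly_Mapping.lookup z x" for b :: "'b::ring"
  by (simp add: Poly_Mapping.map.rep_eq when_def)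

lemma dual_basis_of_projective:
  fixes act :: "'b::{ring,monoid_mult} \<Rightarrow> 'm \<Rightarrow> 'm::ab_group_add"
  assumes fg: "finitely_generated act" and proj: "projective act"
  shows "\<exists>(n::nat) b f. (\<forall>i. module_map act (*) (f i)) \<and> (\<forall>a. (\<Sum>i<n. act (f i a) (b i)) = a)"
proof -
  obtain i :: "'m \<Rightarrow> ('m \<Rightarrow>\<^sub>0 'b)" and p where
    i: "\<And>x y. i (x + y) = i x + i y" "\<And>b x. i (act b x) = Poly_Mapping.map ((*) b) (i x)"
    and p: "\<And>x y. p (x + y) = p x + p y" "\<And>b x. p (Poly_Mapping.map ((*) b) x) = act b (p x)"
    and pi: "\<And>m. p (i m) = m"
    using proj unfolding projective_def module_map_def by blast
  obtain g where g: "finite g" "\<And>m. \<exists>c. m = (\<Sum>x\<in>g. act (c x) x)"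
    using fg unfolding finitely_generated_def by blast
  \<comment> \<open>Every element is a combination of the generators, so only the finitely many
    coordinates that occur in the images of the generators can be nonzero.\<close>
  define X where "X = (\<Union>x\<in>g. Poly_Mapping.keys (i x))"
  have X: "finite X"
    by (simp add: X_def g)
  have supp: "Poly_Mapping.lookup (i m) x = 0" if "x \<notin> X" for m x
  proof -
    obtain c where c: "m = (\<Sum>x\<in>g. act (c x) x)"
      using g(2) by blast
    have "Poly_Mapping.lookup (i m) x = (\<Sum>y\<in>g. c y * Poly_Mapping.lookup (i y) x)"
      by (simp add: c sum_hom_set[of i] i lookup_sum lookup_scale)
    also have "\<dots> = 0"
      using that by (intro sum.neutral) (auto simp: X_def in_keys_iff)
    finally show ?thesis .
  qed
  have expand: "(\<Sum>x\<in>X. act (Poly_Mapping.lookup (i m) x) (p (Poly_Mapping.single x 1))) = m" for m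
  proof -
    have "i m = (\<Sum>x\<in>X. Poly_Mapping.map ((*) (Poly_Mapping.lookup (i m) x)) (Poly_Mapping.single x 1))"
    proof (rule poly_mapping_eqI)
      fix y
      have "(\<Sum>x\<in>X. Poly_Mapping.lookup (i m) x when x = y) = (\<Sum>x\<in>X. if x = y then Poly_Mapping.lookup (i m) x else 0)"
        by (rule sum.cong) (auto simp: when_def)
      also have "\<dots> = Poly_Mapping.lookup (i m) y"
        using supp[of y m] by (simp add: X)
      finally show "Poly_Mapping.lookup (i m) y =
          Poly_Mapping.lookup (\<Sum>x\<in>X. Poly_Mapping.map ((*) (Poly_Mapping.lookup (i m) x)) (Poly_Mapping.single x 1)) y"
        by (simp add: lookup_sum lookup_scale lookup_single)
    qed
    then have "m = p (\<Sum>x\<in>X. Poly_Mapping.map ((*) (Poly_Mapping.lookup (i m) x)) (Poly_Mapping.single x 1))"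
      using pi[of m] by simp
    then show ?thesis
      by (simp add: sum_hom_set[of p] p del: map_single)
  qed
  obtain h and n :: nat where h: "bij_betw h {..<n} X"
    using ex_bij_betw_nat_finite[OF X] by (auto simp: atLeast0LessThan)
  show ?thesis
  proof (intro exI[of _ n] exI[of _ "\<lambda>k. p (Poly_Mapping.single (h k) 1)"] exI[of _ "\<lambda>k m. Poly_Mapping.lookup (i m) (h k)"]
      conjI allI)
    show "module_map act (*) (\<lambda>m. Poly_Mapping.lookup (i m) (h k))" for k
      by (simp add: module_map_def i lookup_add lookup_scale)
    show "(\<Sum>k<n. act (Poly_Mapping.lookup (i m) (h k)) (p (Poly_Mapping.single (h k) 1))) = m" for m
      using sum.reindex_bij_betw[OF h, of "\<lambda>x. act (Poly_Mapping.lookup (i m) x) (p (Poly_Mapping.single x 1))"]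
      by (simp add: expand)
  qed
qed

text \<open>The hypothesis on \<tau> turns a left module over \<open>'b\<close> into a right module
  over the subring \<open>X\<close> for the product \<open>m\<close>. The choice of \<open>m\<close>
  and of the opposite ring covers left and right modules alike.\<close>

lemma dual_basis_of_module:
  fixes act :: "'b::{ring,monoid_mult} \<Rightarrow> 'a \<Rightarrow> 'a::ab_group_add"
  assumes "finitely_generated act" "projective act"
    and \<tau>: "\<And>x y. \<tau> (x + y) = \<tau> x + \<tau> y" "\<And>x y. \<tau> (x * y) = m (\<tau> y) (\<tau> x)" "range \<tau> = X"
    and act: "\<And>b a. act b a = m a (\<tau> b)"
  shows "\<exists>n b \<beta>. dual_basis m X n b \<beta>"
proof -
  obtain n :: nat and b f where f: "\<And>i. module_map act (*) (f i)" and b: "\<And>a. (\<Sum>i<n. act (f i a) (b i)) = a"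
    using dual_basis_of_projective[OF assms(1,2)] by blast
  have "(\<lambda>a. \<tau> (f i a)) \<in> right_dual m X" for i
    using f[of i] unfolding \<tau>(3)[symmetric]
    by (intro right_dualI) (auto simp: module_map_def \<tau>(1,2) simp flip: act)
  then have "dual_basis m X n b (\<lambda>i a. \<tau> (f i a))"
    using b by (simp add: dual_basis_def act)
  then show ?thesis
    by blast
qed

lemma projective_of_dual_list:
  fixes act :: "'b::{ring,monoid_mult} \<Rightarrow> 'm \<Rightarrow> 'm::ab_group_add"
  assumes act: "\<And>b x y. act b (x + y) = act b x + act b y" "\<And>b c x. act (b + c) x = act b x + act c x"
      "\<And>b c x. act (b * c) x = act b (act c x)"
    and f: "\<And>u. module_map act (*) (f u)"
    and basis: "\<And>m. psum uv (\<lambda>u v. act (f u m) v) = m"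
  shows "finitely_generated act" "projective act"
proof -
  have act_zero: "act 0 x = 0" "act b 0 = 0" for b x
    using act(1)[of b 0 0] act(2)[of 0 0 x] by simp_all
  show "finitely_generated act"
    unfolding finitely_generated_def
  proof (intro exI[of _ "snd ` set uv"] conjI allI)
    fix m
    have "\<exists>c. psum xs (\<lambda>u v. act (f u m) v) = (\<Sum>g\<in>snd ` set uv. act (c g) g)"
      if "set xs \<subseteq> set uv" for xs
      using that
    proof (induction xs)
      case (Cons p xs)
      obtain u v where p: "p = (u, v)"
        by (cases p)
      obtain c where c: "psum xs (\<lambda>u v. act (f u m) v) = (\<Sum>g\<in>snd ` set uv. act (c g) g)"
        using Cons by auto
      \<comment> \<open>The same \<open>v\<close> may occur several times in the list, so its
        coefficients accumulate.\<close>
      have "(\<Sum>g\<in>snd ` set uv. act ((c(v := f u m + c v)) g) g) =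
          (\<Sum>g\<in>snd ` set uv. (if g = v then act (f u m) v else 0) + act (c g) g)"
        by (rule sum.cong) (auto simp: act)
      also have "\<dots> = psum (p # xs) (\<lambda>u v. act (f u m) v)"
        using Cons.prems p by (force simp: sum.distrib psum_Cons c)
      finally show ?case
        by metis
    qed (use act_zero in \<open>auto intro: exI[of _ "\<lambda>_. 0"]\<close>)
    from this[of uv] show "\<exists>c. m = (\<Sum>g\<in>snd ` set uv. act (c g) g)"
      by (simp add: basis)
  qed simp
  define i where "i m = psum uv (\<lambda>u v. Poly_Mapping.single v (f u m))" for m
  define p where "p z = (\<Sum>x\<in>Poly_Mapping.keys z. act (Poly_Mapping.lookup z x) x)" for z
  have p: "p z = (\<Sum>x\<in>X. act (Poly_Mapping.lookup z x) x)" if "finite X" "Poly_Mapping.keys z \<subseteq> X" for z X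
    unfolding p_def by (rule sum.mono_neutral_left) (use that act_zero in \<open>auto simp: in_keys_iff\<close>)
  have p_add: "p (z + z') = p z + p z'" for z z'
    using p[of "Poly_Mapping.keys z \<union> Poly_Mapping.keys z'"] keys_add[of z z']
    by (simp add: lookup_add act sum.distrib)
  have p_scale: "p (Poly_Mapping.map ((*) b) z) = act b (p z)" for b z
  proof -
    have "Poly_Mapping.keys (Poly_Mapping.map ((*) b) z) \<subseteq> Poly_Mapping.keys z"
      by (auto simp: in_keys_iff lookup_scale)
    then show ?thesis
      using p[of "Poly_Mapping.keys z"] by (simp add: lookup_scale act sum_hom_set[of "act b"])
  qed
  have i_scale: "Poly_Mapping.map ((*) b) (psum xs h) = psum xs (\<lambda>u v. Poly_Mapping.map ((*) b) (h u v))"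
    for b and h :: "'c \<Rightarrow> 'm \<Rightarrow> 'm \<Rightarrow>\<^sub>0 'b" and xs
    by (rule psum_hom) (rule poly_mapping_eqI, simp add: lookup_scale lookup_add distrib_left)
  have scale_single: "Poly_Mapping.map ((*) b) (Poly_Mapping.single v c) = Poly_Mapping.single v (b * c)" for b c :: 'b and v :: 'm
    by (rule poly_mapping_eqI) (simp add: lookup_scale lookup_single when_def del: map_single)
  show "projective act"
    unfolding projective_def
  proof (intro exI[of _ i] exI[of _ p] conjI allI)
    show "module_map act (\<lambda>b. Poly_Mapping.map ((*) b)) i"
      using f by (simp add: module_map_def i_def single_add psum_add i_scale scale_single)
    show "module_map (\<lambda>b. Poly_Mapping.map ((*) b)) act p"
      by (simp add: module_map_def p_add p_scale)
    have "p (Poly_Mapping.single v c) = act c v" for v c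
      using p[of "{v}" "Poly_Mapping.single v c"] by (simp add: lookup_single)
    then show "p (i m) = m" for m
      by (simp add: i_def psum_hom[of p] p_add basis)
  qed
qed

section \<open>Frobenius extensions and Frobenius forms\<close>

context
  fixes kB :: "'k::{comm_ring,monoid_mult} \<Rightarrow> 'b::{ring,monoid_mult} \<Rightarrow> 'b"
    and kA :: "'k \<Rightarrow> 'a::{ring,monoid_mult} \<Rightarrow> 'a" and s :: "'b \<Rightarrow> 'a"
  assumes hom: "algebra_hom kB kA s" and inj: "inj s"
begin

lemmas s = algebra_homD[OF hom]

lemma frobenius_functional_iff: "frobenius_functional s \<psi> \<longleftrightarrow> frobenius_form (*) (range s) (\<lambda>x. s (\<psi> x))"
proof -
  have s_eq: "s x = s y \<longleftrightarrow> x = y" for x y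
    using inj by (auto dest: injD)
  show ?thesis
  proof
    assume *: "frobenius_functional s \<psi>"
    have lin: "\<psi> (s b * x * s b') = b * \<psi> x * b'" for b x b'
      using * by (simp add: frobenius_functional_def)
    have "\<psi> (x * s b) = \<psi> x * b" "\<psi> (s b * x) = b * \<psi> x" for x b
      using lin[of 1 x b] lin[of b x 1] by (simp_all add: s)
    then show "frobenius_form (*) (range s) (\<lambda>x. s (\<psi> x))"
      using * by (auto simp: frobenius_form_def frobenius_functional_def psum_def s right_dual_def)
  next
    assume *: "frobenius_form (*) (range s) (\<lambda>x. s (\<psi> x))"
    then have "s (\<psi> (x + y)) = s (\<psi> x + \<psi> y)" "s (\<psi> (x * s b)) = s (\<psi> x * b)" "s (\<psi> (s b * x)) = s (b * \<psi> x)"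
      for x y b
      by (simp_all add: frobenius_form_def right_dual_def s)
    then have "\<psi> (x + y) = \<psi> x + \<psi> y" "\<psi> (x * s b) = \<psi> x * b" "\<psi> (s b * x) = b * \<psi> x" for x y b
      by (simp_all only: s_eq)
    then show "frobenius_functional s \<psi>"
      using * by (auto simp: frobenius_form_def frobenius_functional_def psum_def)
  qed
qed

lemma frobenius_extension_of_functional:
  assumes "frobenius_functional s \<psi>"
  shows "frobenius_extension kB kA s"
proof -
  have add: "\<psi> (x + y) = \<psi> x + \<psi> y" and lin: "\<psi> (s b * x * s b') = b * \<psi> x * b'" for x y b b'
    using assms by (simp_all add: frobenius_functional_def)
  have right: "\<psi> (x * s b) = \<psi> x * b" and left: "\<psi> (s b * x) = b * \<psi> x" for x b
    using lin[of 1 x b] lin[of b x 1] by (simp_all add: s)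
  obtain uv where uv: "\<And>a. psum uv (\<lambda>u v. s (\<psi> (a * u)) * v) = a" "\<And>a. psum uv (\<lambda>u v. u * s (\<psi> (v * a))) = a"
    using assms unfolding frobenius_functional_def psum_def by blast
  have f: "module_map (\<lambda>b x. s b * x) (*) (\<lambda>x. \<psi> (x * u))" for u
    by (simp add: module_map_def distrib_right add left mult.assoc)
  have \<psi>_psum: "\<psi> (psum xs h) = psum xs (\<lambda>u v. \<psi> (h u v))" for xs :: "('a \<times> 'a) list" and h
    by (rule psum_hom) (rule add)
  have mult_psum: "x * psum xs h = psum xs (\<lambda>u v. x * h u v)" for x :: 'a and xs :: "('a \<times> 'a) list" and h
    by (rule psum_hom) (rule distrib_left)
  have bij: "bij_betw (\<lambda>x z. \<psi> (z * x)) UNIV {\<phi>. module_map (\<lambda>b a. s b * a) (*) \<phi>}"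
  proof (rule bij_betw_byWitness[of _ "\<lambda>\<phi>. psum uv (\<lambda>u v. u * s (\<phi> v))"])
    show "\<forall>x\<in>UNIV. psum uv (\<lambda>u v. u * s (\<psi> (v * x))) = x"
      by (simp add: uv)
    show "\<forall>\<phi>\<in>{\<phi>. module_map (\<lambda>b a. s b * a) (*) \<phi>}. (\<lambda>z. \<psi> (z * psum uv (\<lambda>u v. u * s (\<phi> v)))) = \<phi>"
    proof (intro ballI ext)
      fix \<phi> z assume "\<phi> \<in> {\<phi>. module_map (\<lambda>b a. s b * a) (*) \<phi>}"
      then have \<phi>: "\<phi> (x + y) = \<phi> x + \<phi> y" "\<phi> (s b * x) = b * \<phi> x" for x y b
        by (simp_all add: module_map_def)
      have "\<psi> (z * psum uv (\<lambda>u v. u * s (\<phi> v))) = psum uv (\<lambda>u v. \<phi> (s (\<psi> (z * u)) * v))"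
        by (simp add: mult_psum \<psi>_psum right \<phi> flip: mult.assoc)
      also have "\<dots> = \<phi> z"
        by (simp add: uv flip: psum_hom[of \<phi>] \<phi>(1))
      finally show "\<psi> (z * psum uv (\<lambda>u v. u * s (\<phi> v))) = \<phi> z" .
    qed
  qed (use f in auto)
  have "finitely_generated (\<lambda>b a. s b * a)" "projective (\<lambda>b a. s b * a)"
    by (rule projective_of_dual_list[of _ "\<lambda>u x. \<psi> (x * u)" uv];
      simp add: distrib_left distrib_right s mult.assoc f uv)+
  then show ?thesis
    unfolding frobenius_extension_def using hom inj bij
    by (intro conjI exI[of _ "\<lambda>x z. \<psi> (z * x)"])
      (simp_all add: distrib_left add right mult.assoc[symmetric])
qed

text \<open>The Frobenius functional is the image of 1 under the bimodule isomorphism, and the u_i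
  are the preimages of the coordinate functionals of a dual basis. The second identity of the system
  follows from injectivity of the isomorphism.\<close>

lemma functional_of_frobenius_extension:
  assumes "frobenius_extension kB kA s"
  shows "\<exists>\<psi>. frobenius_functional s \<psi>"
proof -
  obtain \<Phi> where bij: "bij_betw \<Phi> UNIV {\<phi>. module_map (\<lambda>b a. s b * a) (*) \<phi>}"
    and \<Phi>: "\<And>a x b. \<Phi> (a * x * s b) = (\<lambda>z. \<Phi> x (z * a) * b)"
    using assms unfolding frobenius_extension_def by blast
  define \<psi> where "\<psi> = \<Phi> 1"
  have \<Phi>_eq: "\<Phi> a = (\<lambda>z. \<psi> (z * a))" for a
    using \<Phi>[of a 1 1] by (simp add: \<psi>_def s)
  have "module_map (\<lambda>b a. s b * a) (*) \<psi>"
    using bij unfolding \<psi>_def bij_betw_def by blast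
  then have add: "\<psi> (x + y) = \<psi> x + \<psi> y" and left: "\<psi> (s b * x) = b * \<psi> x" for x y b
    by (simp_all add: module_map_def)
  have right: "\<psi> (x * s b) = \<psi> x * b" for x b
    using \<Phi>[of 1 1 b] fun_cong[OF \<Phi>_eq[of "s b"], of x] by (simp add: \<psi>_def)
  have "finitely_generated (\<lambda>b a. s b * a)" "projective (\<lambda>b a. s b * a)"
    using assms by (simp_all add: frobenius_extension_def)
  from dual_basis_of_projective[OF this] obtain n :: nat and v f
    where f: "\<And>i. module_map (\<lambda>b a. s b * a) (*) (f i)" and v: "\<And>a. (\<Sum>i<n. s (f i a) * v i) = a"
    by blast
  have "f i \<in> range \<Phi>" for i
    using f[of i] bij by (simp add: bij_betw_def)
  then have "\<exists>u. \<forall>i. f i = \<Phi> (u i)"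
    by (intro choice) blast
  then obtain u where u: "\<And>i. f i = \<Phi> (u i)"
    by blast
  have v': "(\<Sum>i<n. s (\<psi> (a * u i)) * v i) = a" for a
    using v[of a] by (simp add: u \<Phi>_eq)
  have \<psi>_sum: "\<psi> (\<Sum>i<n. h i) = (\<Sum>i<n. \<psi> (h i))" for h
    by (rule sum_hom_set) (rule add)
  have "(\<Sum>i<n. u i * s (\<psi> (v i * a))) = a" for a
  proof -
    have "\<psi> (z * (\<Sum>i<n. u i * s (\<psi> (v i * a)))) = \<psi> (z * a)" for z
    proof -
      have "\<psi> (z * (\<Sum>i<n. u i * s (\<psi> (v i * a)))) = (\<Sum>i<n. \<psi> (s (\<psi> (z * u i)) * v i * a))"
      proof -
        have "\<psi> (z * (x * s b)) = \<psi> (z * x) * b" for x b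
          by (simp add: right flip: mult.assoc)
        then show ?thesis
          by (simp add: sum_distrib_left \<psi>_sum left mult.assoc)
      qed
      also have "\<dots> = \<psi> ((\<Sum>i<n. s (\<psi> (z * u i)) * v i) * a)"
        by (simp add: sum_distrib_right \<psi>_sum)
      finally show ?thesis
        by (simp add: v')
    qed
    then have "\<Phi> (\<Sum>i<n. u i * s (\<psi> (v i * a))) = \<Phi> a"
      by (simp add: \<Phi>_eq)
    then show ?thesis
      using bij by (auto simp: bij_betw_def dest: injD)
  qed
  moreover have "(\<Sum>(u, v)\<leftarrow>map (\<lambda>i. (u i, v i)) [0..<n]. g u v) = (\<Sum>i<n. g (u i) (v i))" for g :: "'a \<Rightarrow> 'a \<Rightarrow> 'a"
    by (simp add: comp_def interv_sum_list_conv_sum_set_nat atLeast0LessThan)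
  ultimately have "frobenius_functional s \<psi>"
    unfolding frobenius_functional_def
    by (intro conjI exI[of _ "map (\<lambda>i. (u i, v i)) [0..<n]"]) (simp_all add: add left right v')
  then show ?thesis
    by blast
qed

lemma frobenius_extension_iff: "frobenius_extension kB kA s \<longleftrightarrow> (\<exists>\<psi>. frobenius_form (*) (range s) \<psi>)"
proof
  assume "frobenius_extension kB kA s"
  then show "\<exists>\<psi>. frobenius_form (*) (range s) \<psi>"
    using functional_of_frobenius_extension frobenius_functional_iff by blast
next
  assume "\<exists>\<psi>. frobenius_form (*) (range s) \<psi>"
  then obtain \<psi> where \<psi>: "frobenius_form (*) (range s) \<psi>" ..
  have "s (inv s (\<psi> x)) = \<psi> x" for x
    using right_dualD(2)[OF frobenius_formD(1)[OF \<psi>]] by (rule f_inv_into_f)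
  then have "frobenius_functional s (\<lambda>x. inv s (\<psi> x))"
    using \<psi> by (simp add: frobenius_functional_iff)
  then show "frobenius_extension kB kA s"
    by (rule frobenius_extension_of_functional)
qed

end

section \<open>The four families of conditions\<close>

lemma bij_betw_inj_comp:
  assumes "inj J" "J ` X = Y"
  shows "bij_betw (\<lambda>x. J (f x)) A Y \<longleftrightarrow> bij_betw f A X"
proof -
  have "inj_on (\<lambda>x. J (f x)) A \<longleftrightarrow> inj_on f A"
    using assms(1) by (auto simp: inj_on_def)
  moreover have "(\<lambda>x. J (f x)) ` A = J ` X \<longleftrightarrow> f ` A = X"
    using inj_image_eq_iff[OF assms(1), of "f ` A" X] by (simp add: image_image)
  ultimately show ?thesis
    unfolding bij_betw_def assms(2)[symmetric] by simp
qed

lemma image_dual: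
  assumes \<tau>: "inj \<tau>" "\<And>x y. \<tau> (x + y) = \<tau> x + \<tau> y" "\<And>x r. \<tau> (mul x r) = m (\<tau> x) (\<tau> r)"
  shows "(\<lambda>\<phi> a. \<tau> (\<phi> a)) ` {\<phi>. (\<forall>a b. \<phi> (a + b) = \<phi> a + \<phi> b) \<and> (\<forall>r a. \<phi> (m a (\<tau> r)) = mul (\<phi> a) r)} =
    right_dual m (range \<tau>)" (is "?J ` ?D = _")
proof
  show "?J ` ?D \<subseteq> right_dual m (range \<tau>)"
    by (auto intro!: right_dualI simp: \<tau>)
  show "right_dual m (range \<tau>) \<subseteq> ?J ` ?D"
  proof
    fix \<Phi> assume \<Phi>: "\<Phi> \<in> right_dual m (range \<tau>)"
    define \<phi> where "\<phi> a = inv \<tau> (\<Phi> a)" for a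
    have \<tau>\<phi>: "\<tau> (\<phi> a) = \<Phi> a" for a
      unfolding \<phi>_def by (rule f_inv_into_f) (rule right_dualD[OF \<Phi>])
    have "\<tau> (\<phi> (a + b)) = \<tau> (\<phi> a + \<phi> b)" "\<tau> (\<phi> (m a (\<tau> r))) = \<tau> (mul (\<phi> a) r)" for a b r
      by (simp_all add: \<tau>\<phi> \<tau> right_dualD[OF \<Phi>])
    then have "\<phi> \<in> ?D"
      using injD[OF \<tau>(1)] by simp
    then show "\<Phi> \<in> ?J ` ?D"
      by (rule image_eqI[rotated]) (simp add: \<tau>\<phi>)
  qed
qed

context hopf_fgp begin

context
  fixes \<tau> :: "'b \<Rightarrow> 'a" and \<sigma> :: "'c \<Rightarrow> 'a" and Dset Mset :: "('a \<Rightarrow> 'b) set"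
  assumes \<tau>: "inj \<tau>" and Dset: "(\<lambda>\<phi> a. \<tau> (\<phi> a)) ` Dset = Dr"
    and Mset: "\<And>\<phi>. \<phi> \<in> Mset \<longleftrightarrow> \<phi> \<in> Dset \<and> (\<forall>a. DR a (\<lambda>x y. y \<odot> iB (\<tau> (\<phi> x))) = \<tau> (\<phi> a))"
    and \<sigma>: "inj \<sigma>" "range \<sigma> = B"
begin

abbreviation (input) J where "J \<phi> \<equiv> \<lambda>a. \<tau> (\<phi> a)"

lemma inj_J: "inj J"
  using \<tau> by (auto simp: inj_on_def fun_eq_iff)

lemma J_Mset_iff: "\<phi> \<in> Mset \<longleftrightarrow> J \<phi> \<in> intOn"
proof -
  have "\<phi> \<in> Dset \<longleftrightarrow> J \<phi> \<in> Dr"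
    unfolding Dset[symmetric] using inj_image_mem_iff[OF inj_J] by blast
  then show ?thesis
    by (simp add: Mset intOn_def)
qed

lemma J_Mset: "J ` Mset = intOn"
proof
  show "J ` Mset \<subseteq> intOn"
    by (rule image_subsetI) (simp add: J_Mset_iff)
  show "intOn \<subseteq> J ` Mset"
  proof
    fix \<Lambda> assume \<Lambda>: "\<Lambda> \<in> intOn"
    then have "\<Lambda> \<in> J ` Dset"
      by (simp add: Dset intOn_def)
    then obtain \<phi> where \<phi>: "\<Lambda> = J \<phi>"
      by blast
    then have "\<phi> \<in> Mset"
      using \<Lambda> by (simp add: J_Mset_iff)
    then show "\<Lambda> \<in> J ` Mset"
      unfolding \<phi> by (rule imageI)
  qed
qed

lemma nondeg_transfer:
  "\<Lambda> \<in> Mset \<and> bij_betw (\<lambda>a b. \<Lambda> (a \<odot> b)) UNIV Dset \<longleftrightarrow> nondeg_on (J \<Lambda>)"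
  using bij_betw_inj_comp[OF inj_J Dset, of "\<lambda>a b. \<Lambda> (a \<odot> b)" UNIV]
  by (simp add: nondeg_on_def J_Mset_iff)

lemma nondeg_frobenius:
  "\<Lambda> \<in> Mset \<Longrightarrow> bij_betw (\<lambda>a b. \<Lambda> (a \<odot> b)) UNIV Dset \<Longrightarrow> frobenius_form m C (J \<Lambda>)"
  by (rule frobenius_form_of_nondeg) (simp flip: nondeg_transfer)

lemma nondeg_iff:
  "(\<exists>\<Lambda>. \<Lambda> \<in> Mset \<and> bij_betw (\<lambda>a b. \<Lambda> (a \<odot> b)) UNIV Dset) \<longleftrightarrow> (\<exists>\<psi>. frobenius_form m C \<psi>)"
proof -
  have "\<exists>\<Lambda>'. nondeg_on (J \<Lambda>')" if "nondeg_on \<Lambda>" for \<Lambda>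
  proof -
    have "\<Lambda> \<in> J ` Mset"
      using that by (simp add: nondeg_on_def J_Mset)
    then show ?thesis
      using that by blast
  qed
  then show ?thesis
    unfolding frobenius_iff_nondeg_on nondeg_transfer by blast
qed

lemma free_iff:
  "free_rank_one (\<lambda>l \<Lambda> a. \<Lambda> (\<sigma> l \<odot> a)) Mset \<longleftrightarrow> (\<exists>\<psi>. frobenius_form m C \<psi>)"
proof -
  have bij_\<sigma>: "bij_betw \<sigma> UNIV B"
    using \<sigma> by (simp add: bij_betw_def)
  have "bij_betw (\<lambda>l a. \<Lambda> (\<sigma> l \<odot> a)) UNIV Mset \<longleftrightarrow> bij_betw (\<lambda>b x. \<tau> (\<Lambda> (b \<odot> x))) B intOn" for \<Lambda>
    using bij_betw_inj_comp[OF inj_J J_Mset, of "\<lambda>l a. \<Lambda> (\<sigma> l \<odot> a)" UNIV]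
      bij_betw_comp_iff[OF bij_\<sigma>, of "\<lambda>b x. \<tau> (\<Lambda> (b \<odot> x))" intOn]
    by (simp add: comp_def)
  then have "free_rank_one (\<lambda>l \<Lambda> a. \<Lambda> (\<sigma> l \<odot> a)) Mset \<longleftrightarrow>
      (\<exists>\<Lambda>\<in>Mset. bij_betw (\<lambda>b x. J \<Lambda> (b \<odot> x)) B intOn)"
    by (simp add: free_rank_one_def)
  also have "\<dots> \<longleftrightarrow> free_intOn"
    unfolding free_intOn_def J_Mset[symmetric] by simp
  finally show ?thesis
    by (simp add: frobenius_iff_free)
qed

lemma nondeg_in_transfer:
  "l \<in> intIn \<and> bij_betw (\<lambda>\<phi>. DR l (\<lambda>x y. y \<odot> iB (\<tau> (\<phi> x)))) Dset UNIV \<longleftrightarrow> nondeg_in l"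
proof -
  have "bij_betw J Dset Dr"
    using inj_J Dset by (auto simp: bij_betw_def intro: inj_on_subset)
  from bij_betw_comp_iff[OF this, of "\<lambda>\<Phi>. G \<Phi> l" UNIV] show ?thesis
    by (simp add: nondeg_in_def comp_def G_def)
qed

lemma nondeg_in_iff:
  "(\<exists>l. l \<in> intIn \<and> bij_betw (\<lambda>\<phi>. DR l (\<lambda>x y. y \<odot> iB (\<tau> (\<phi> x)))) Dset UNIV) \<longleftrightarrow>
   (\<exists>\<psi>. frobenius_form m C \<psi>)"
  unfolding nondeg_in_transfer frobenius_iff_nondeg_in ..

end

end

text \<open>One statement for all four families. \<open>\<tau>\<close> embeds the base ring in which
  the functionals take values, \<open>\<sigma>\<close> the other base ring, over which the integrals
  form a module; \<open>Q\<close> is the action \<open>G\<close> as it is written in the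
  definitions.\<close>

lemma (in hopf) transfer:
  fixes \<tau> :: "'b \<Rightarrow> 'a" and \<sigma> :: "'c \<Rightarrow> 'a" and Dset Mset :: "('a \<Rightarrow> 'b) set"
  assumes bases: "\<exists>n b \<beta>. dual_basis m C n b \<beta>" "\<exists>n b \<beta>. dual_basis (\<lambda>x y. y \<odot> x) C n b \<beta>"
    and \<tau>: "inj \<tau>" and Dset: "(\<lambda>\<phi> a. \<tau> (\<phi> a)) ` Dset = Dr"
    and \<sigma>: "inj \<sigma>" "range \<sigma> = B"
    and Q: "\<And>a \<phi>. DR a (\<lambda>x y. y \<odot> iB (\<tau> (\<phi> x))) = Q a \<phi>"
    and Mset: "Mset = {\<phi> \<in> Dset. \<forall>a. Q a \<phi> = \<tau> (\<phi> a)}"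
  shows "free_rank_one (\<lambda>l \<Lambda> a. \<Lambda> (\<sigma> l \<odot> a)) Mset \<longleftrightarrow> (\<exists>\<psi>. frobenius_form m C \<psi>)"
    and "(\<exists>\<Lambda>. \<Lambda> \<in> Mset \<and> bij_betw (\<lambda>a b. \<Lambda> (a \<odot> b)) UNIV Dset) \<longleftrightarrow> (\<exists>\<psi>. frobenius_form m C \<psi>)"
    and "(\<exists>l. l \<in> intIn \<and> bij_betw (Q l) Dset UNIV) \<longleftrightarrow> (\<exists>\<psi>. frobenius_form m C \<psi>)"
    and "\<Lambda> \<in> Mset \<Longrightarrow> bij_betw (\<lambda>a b. \<Lambda> (a \<odot> b)) UNIV Dset \<Longrightarrow>
      frobenius_form m C (\<lambda>a. \<tau> (\<Lambda> a))"
    and "\<exists>\<psi>. frobenius_form m C \<psi> \<Longrightarrow> bij S"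
    and "\<exists>\<psi>. frobenius_form m C \<psi> \<Longrightarrow> \<exists>l. l \<in> intIn \<and> bij_betw (Q l) Dset UNIV \<and>
      bij_betw (\<lambda>\<omega>. DR l (\<lambda>x y. x \<odot> S (\<omega> y))) (right_dual m B) UNIV"
proof -
  obtain n b \<beta> e F where "hopf_fgp m u B C S gL hR eL eR n b \<beta> e F"
    using bases hopf_fgpI by metis
  then interpret hopf_fgp m u B C S gL hR eL eR n b \<beta> e F .
  have "\<phi> \<in> Mset \<longleftrightarrow> \<phi> \<in> Dset \<and> (\<forall>a. DR a (\<lambda>x y. y \<odot> iB (\<tau> (\<phi> x))) = \<tau> (\<phi> a))" for \<phi>
    by (simp add: Mset Q)
  note args = \<tau> Dset this \<sigma>
  have Q': "Q l = (\<lambda>\<phi>. DR l (\<lambda>x y. y \<odot> iB (\<tau> (\<phi> x))))" for l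
    by (simp add: Q)
  show "free_rank_one (\<lambda>l \<Lambda> a. \<Lambda> (\<sigma> l \<odot> a)) Mset \<longleftrightarrow> (\<exists>\<psi>. frobenius_form m C \<psi>)"
    by (rule free_iff[OF args])
  show "(\<exists>\<Lambda>. \<Lambda> \<in> Mset \<and> bij_betw (\<lambda>a b. \<Lambda> (a \<odot> b)) UNIV Dset) \<longleftrightarrow> (\<exists>\<psi>. frobenius_form m C \<psi>)"
    by (rule nondeg_iff[OF args])
  show "(\<exists>l. l \<in> intIn \<and> bij_betw (Q l) Dset UNIV) \<longleftrightarrow> (\<exists>\<psi>. frobenius_form m C \<psi>)"
    unfolding Q' by (rule nondeg_in_iff[OF args])
  show "\<Lambda> \<in> Mset \<Longrightarrow> bij_betw (\<lambda>a b. \<Lambda> (a \<odot> b)) UNIV Dset \<Longrightarrow> frobenius_form m C (\<lambda>a. \<tau> (\<Lambda> a))"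
    by (rule nondeg_frobenius[OF args])
  show "\<exists>\<psi>. frobenius_form m C \<psi> \<Longrightarrow> bij S"
    using frobenius_antipode_bij by blast
  show "\<exists>l. l \<in> intIn \<and> bij_betw (Q l) Dset UNIV \<and>
      bij_betw (\<lambda>\<omega>. DR l (\<lambda>x y. x \<odot> S (\<omega> y))) (right_dual m B) UNIV"
    if "\<exists>\<psi>. frobenius_form m C \<psi>"
    using that frobenius_common_nondeg_in unfolding Q' nondeg_in_transfer[OF args, symmetric] by blast
qed

lemma range_unopp: "range (\<lambda>x. f (unopp x)) = range f"
proof -
  have "range unopp = UNIV"
    by (metis opp.sel surjI)
  then show ?thesis
    by (metis image_image)
qed

section \<open>The four versions of one Hopf algebroid\<close>

locale hopf_algebroid_fgp = hopf_algebroid_data +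
  assumes dual_bases: "\<exists>n b \<beta>. dual_basis (*) (range tL) n b \<beta>" "\<exists>n b \<beta>. dual_basis (*) (range sL) n b \<beta>"
    "\<exists>n b \<beta>. dual_basis (\<lambda>x y. y * x) (range tL) n b \<beta>"
    "\<exists>n b \<beta>. dual_basis (\<lambda>x y. y * x) (range sL) n b \<beta>"
begin

abbreviation "frobenius_L \<equiv> \<exists>\<psi>. frobenius_form (*) (range sL) \<psi>"
abbreviation "frobenius_R \<equiv> \<exists>\<psi>. frobenius_form (*) (range tL) \<psi>"

sublocale A: hopf "(*)" 1 "range sL" "range tL" S "\<lambda>a. sw (\<gamma>L a)" "\<lambda>a. map prod.swap (sw (\<gamma>R a))"
    "\<lambda>a. sL (\<pi>L a)" "\<lambda>a. sR (\<pi>R a)"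
  by (rule hopf)

lemma iB_sR [simp]: "A.iB (sR r) = tR r"
  using ranges by (intro A.iB_eqI) auto

lemma iC_sL [simp]: "A.iC (sL l) = tL l"
  by (rule A.iC_eqI) auto

lemma image_duals:
  "(\<lambda>\<phi> a. sR (\<phi> a)) ` upper_right_dual sR = right_dual (*) (range tL)"
  "(\<lambda>\<phi> a. tR (\<phi> a)) ` upper_left_dual tR = right_dual (*) (range sL)"
  "(\<lambda>\<phi> a. sL (\<phi> a)) ` lower_left_dual sL = right_dual (\<lambda>x y. y * x) (range sL)"
  "(\<lambda>\<phi> a. tL (\<phi> a)) ` lower_right_dual tL = right_dual (\<lambda>x y. y * x) (range tL)"
  unfolding upper_right_dual_def upper_left_dual_def lower_left_dual_def lower_right_dual_def
  using image_dual[OF inj_bases(3), of "\<lambda>x r. x * r" "(*)"] image_dual[OF inj_bases(4), of "\<lambda>x r. r * x" "(*)"]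
    image_dual[OF inj_bases(1), of "\<lambda>x r. r * x" "\<lambda>x y. y * x"]
    image_dual[OF inj_bases(2), of "\<lambda>x r. x * r" "\<lambda>x y. y * x"]
  by (simp_all add: sL tL sR tR ranges)

lemma bij_betw_duals:
  "bij_betw (\<lambda>\<phi> a. tR (\<phi> a)) (upper_left_dual tR) (right_dual (*) (range sL))"
  "bij_betw (\<lambda>\<phi> a. tL (\<phi> a)) (lower_right_dual tL) (right_dual (\<lambda>x y. y * x) (range tL))"
  using inj_bases(2,4) image_duals(2,4) by (auto simp: bij_betw_def inj_on_def fun_eq_iff)

lemma intIn_A: "A.intIn = left_integrals sL \<pi>L"
  by (simp add: A.intIn_def left_integrals_def)

lemma DR_A: "A.DR a (\<lambda>x y. y * A.iB (sR (\<phi> x))) = (\<Sum>(x, y)\<leftarrow>sw (\<gamma>R a). y * tR (\<phi> x))"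
  by (simp add: psum_swap flip: psum_def)

lemmas case_a = A.transfer[OF dual_bases(1,3) inj_bases(3) image_duals(1) inj_bases(1) HOL.refl
  DR_A upper_right_integrals_def, unfolded intIn_A]

lemma common_left_integral: "\<exists>\<iota>. \<iota> \<in> left_integrals sL \<pi>L \<and>
    bij_betw (\<lambda>\<phi>. \<Sum>(x, y)\<leftarrow>sw (\<gamma>R \<iota>). y * tR (\<phi> x)) (upper_right_dual sR) UNIV \<and>
    bij_betw (\<lambda>\<phi>. \<Sum>(x, y)\<leftarrow>sw (\<gamma>R \<iota>). x * sR (\<phi> y)) (upper_left_dual tR) UNIV" if frobenius_R
proof -
  have "bij_betw (\<lambda>\<omega>. A.DR \<iota> (\<lambda>x y. x * S (\<omega> y))) (right_dual (*) (range sL)) UNIV \<longleftrightarrow>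
      bij_betw (\<lambda>\<phi>. \<Sum>(x, y)\<leftarrow>sw (\<gamma>R \<iota>). x * sR (\<phi> y)) (upper_left_dual tR) UNIV" for \<iota>
    using bij_betw_comp_iff[OF bij_betw_duals(1), of "\<lambda>\<omega>. A.DR \<iota> (\<lambda>x y. x * S (\<omega> y))" UNIV]
    by (simp add: comp_def psum_swap flip: psum_def)
  then show ?thesis
    using case_a(6)[OF that] by simp
qed

sublocale C: hopf "\<lambda>x y. y * x" 1 "range tL" "range sL" S "\<lambda>a. map prod.swap (sw (\<gamma>R a))" "\<lambda>a. sw (\<gamma>L a)"
    "\<lambda>a. sR (\<pi>R a)" "\<lambda>a. sL (\<pi>L a)"
  by (rule A.opposite)

lemma iB_C_sL [simp]: "A.R.iB (sL l) = tL l"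
  by (rule A.R.iB_eqI) auto

lemma iC_C_sR [simp]: "A.R.iC (sR r) = tR r"
  using ranges by (intro A.R.iC_eqI) auto

lemma intIn_C: "C.intIn = right_integrals sR \<pi>R"
  by (simp add: C.intIn_def right_integrals_def)

lemma DR_C: "C.DR a (\<lambda>x y. A.R.iB (sL (\<phi> x)) * y) = (\<Sum>(x, y)\<leftarrow>sw (\<gamma>L a). tL (\<phi> y) * x)"
  by (simp flip: psum_def)

lemmas case_c = C.transfer[OF dual_bases(4,2) inj_bases(1) image_duals(3) inj_bases(3) ranges(2)
  DR_C lower_left_integrals_def, unfolded intIn_C frobenius_form_opposite[of "(*)"]]

lemma common_right_integral: "\<exists>\<kappa>. \<kappa> \<in> right_integrals sR \<pi>R \<and>
    bij_betw (\<lambda>\<phi>. \<Sum>(x, y)\<leftarrow>sw (\<gamma>L \<kappa>). tL (\<phi> y) * x) (lower_left_dual sL) UNIV \<and>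
    bij_betw (\<lambda>\<phi>. \<Sum>(x, y)\<leftarrow>sw (\<gamma>L \<kappa>). sL (\<phi> x) * y) (lower_right_dual tL) UNIV" if frobenius_L
proof -
  have "bij_betw (\<lambda>\<omega>. C.DR \<kappa> (\<lambda>x y. S (\<omega> y) * x)) (right_dual (\<lambda>x y. y * x) (range tL)) UNIV \<longleftrightarrow>
      bij_betw (\<lambda>\<phi>. \<Sum>(x, y)\<leftarrow>sw (\<gamma>L \<kappa>). sL (\<phi> x) * y) (lower_right_dual tL) UNIV" for \<kappa>
    using bij_betw_comp_iff[OF bij_betw_duals(2), of "\<lambda>\<omega>. C.DR \<kappa> (\<lambda>x y. S (\<omega> y) * x)" UNIV]
    by (simp add: comp_def flip: psum_def)
  then show ?thesis
    using case_c(6)[OF that] by simp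
qed

text \<open>Either condition makes \<open>S\<close> bijective, the second one through the opposite
  structure, and then conjugation by \<open>S\<close> exchanges the two.\<close>

lemma frobenius_L_iff_R: "frobenius_L \<longleftrightarrow> frobenius_R"
proof
  assume frobenius_R
  then show frobenius_L
    using A.frobenius_form_antipode case_a(5) by blast
next
  assume frobenius_L
  then obtain \<psi> where "frobenius_form (\<lambda>x y. y * x) (range sL) \<psi>"
    unfolding frobenius_form_opposite[of "(*)"] by blast
  from C.frobenius_form_antipode[OF case_c(5)[OF \<open>frobenius_L\<close>] this] show frobenius_R
    unfolding frobenius_form_opposite[of "(*)"] by blast
qed

context
  assumes bij: "bij S"
begin

lemma inv_S: "inv S (S x) = x"
  using bij by (simp add: bij_is_inj)

interpretation B: hopf "(*)" 1 "range tL" "range sL" "inv S" "\<lambda>a. map prod.swap (sw (\<gamma>L a))"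
    "\<lambda>a. map prod.swap (map prod.swap (sw (\<gamma>R a)))" "\<lambda>a. A.iC (sL (\<pi>L a))" "\<lambda>a. A.iB (sR (\<pi>R a))"
  by (rule A.coopposite[OF bij])

lemma iB_B_tR: "B.iB (tR r) = sR r"
  using ranges inv_S[of "tR r"] inv_S[of "sR r"] by (intro B.iB_eqI) auto

text \<open>The coopposite counit is t_L \<pi>_L; by \<open>intIn_D'\<close> a left integral may be
  defined with it just as well as with s_L \<pi>_L.\<close>

lemma intIn_B: "B.intIn = left_integrals sL \<pi>L"
proof -
  have "l \<in> B.intIn \<Longrightarrow> l \<in> A.intIn" for l
    unfolding B.intIn_def A.intIn_def mem_Collect_eq
    by (metis A.eps_in A.eps_of_B)
  moreover have "l \<in> A.intIn \<Longrightarrow> l \<in> B.intIn" for l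
    unfolding B.intIn_def using A.intIn_D' by blast
  ultimately show ?thesis
    unfolding intIn_A[symmetric] by blast
qed

lemma DR_B: "B.DR a (\<lambda>x y. y * B.iB (tR (\<phi> x))) = (\<Sum>(x, y)\<leftarrow>sw (\<gamma>R a). x * sR (\<phi> y))"
  by (simp add: psum_swap iB_B_tR flip: psum_def)

lemmas case_b = B.transfer[OF dual_bases(2,4) inj_bases(4) image_duals(2) inj_bases(2) HOL.refl
  DR_B upper_left_integrals_def, unfolded intIn_B]

interpretation D: hopf "\<lambda>x y. y * x" 1 "range sL" "range tL" "inv S"
    "\<lambda>a. map prod.swap (map prod.swap (sw (\<gamma>R a)))" "\<lambda>a. map prod.swap (sw (\<gamma>L a))"
    "\<lambda>a. A.R.iC (sR (\<pi>R a))" "\<lambda>a. A.R.iB (sL (\<pi>L a))"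
  by (rule C.coopposite[OF bij])

lemma iB_D_tL: "B.R.iB (tL l) = sL l"
  using inv_S[of "tL l"] by (intro B.R.iB_eqI) auto

lemma intIn_D: "D.intIn = right_integrals sR \<pi>R"
proof -
  have "l \<in> D.intIn \<Longrightarrow> l \<in> C.intIn" for l
    unfolding D.intIn_def C.intIn_def mem_Collect_eq
    by (metis A.R.eps_in A.R.eps_of_B)
  moreover have "l \<in> C.intIn \<Longrightarrow> l \<in> D.intIn" for l
    unfolding D.intIn_def using C.intIn_D' by blast
  ultimately show ?thesis
    unfolding intIn_C[symmetric] by blast
qed

lemma DR_D: "D.DR a (\<lambda>x y. B.R.iB (tL (\<phi> x)) * y) = (\<Sum>(x, y)\<leftarrow>sw (\<gamma>L a). sL (\<phi> x) * y)"
  by (simp add: psum_swap iB_D_tL flip: psum_def)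

lemmas case_d = D.transfer[OF dual_bases(3,1) inj_bases(2) image_duals(4) inj_bases(4) ranges(1)
  DR_D lower_right_integrals_def, unfolded intIn_D frobenius_form_opposite[of "(*)"]]

end

lemma inj_opp: "inj (tL \<circ> unopp)" "inj (tR \<circ> unopp)"
  using inj_bases(2,4) by (auto simp: inj_on_def opp.expand)

lemma extension_iff:
  "frobenius_extension kR kA sR \<longleftrightarrow> frobenius_R"
  "frobenius_extension (k_opp kR) kA (tR \<circ> unopp) \<longleftrightarrow> frobenius_R"
  "frobenius_extension kL kA sL \<longleftrightarrow> frobenius_R"
  "frobenius_extension (k_opp kL) kA (tL \<circ> unopp) \<longleftrightarrow> frobenius_R"
  using frobenius_extension_iff[OF homs(3) inj_bases(3)] frobenius_extension_iff[OF homs(4) inj_opp(2)]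
    frobenius_extension_iff[OF homs(1) inj_bases(1)] frobenius_extension_iff[OF homs(2) inj_opp(1)]
  by (simp_all add: range_unopp ranges frobenius_L_iff_R)

lemma functional_iff:
  "frobenius_functional sR \<Lambda> \<longleftrightarrow> frobenius_form (*) (range tL) (\<lambda>a. sR (\<Lambda> a))"
  "frobenius_functional (tR \<circ> unopp) (Opp \<circ> \<Lambda>) \<longleftrightarrow> frobenius_form (*) (range sL) (\<lambda>a. tR (\<Lambda> a))"
  "frobenius_functional sL \<rho> \<longleftrightarrow> frobenius_form (*) (range sL) (\<lambda>a. sL (\<rho> a))"
  "frobenius_functional (tL \<circ> unopp) (Opp \<circ> \<rho>) \<longleftrightarrow> frobenius_form (*) (range tL) (\<lambda>a. tL (\<rho> a))"
  using frobenius_functional_iff[OF homs(3) inj_bases(3)] frobenius_functional_iff[OF homs(4) inj_opp(2)]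
    frobenius_functional_iff[OF homs(1) inj_bases(1)] frobenius_functional_iff[OF homs(2) inj_opp(1)]
  by (simp_all add: range_unopp ranges)

text \<open>Bijectivity of \<open>S\<close> follows from the Frobenius condition, so in b) and d) it
  may be assumed while the equivalence is proved.\<close>

lemma bij_S_conj_iff: "(bij S \<Longrightarrow> X \<longleftrightarrow> frobenius_R) \<Longrightarrow> bij S \<and> X \<longleftrightarrow> frobenius_R"
  using case_a(5) by blast

end

theorem theorem4p7:
  fixes kA :: "'k::{comm_ring,monoid_mult} \<Rightarrow> 'a::{ring,monoid_mult} \<Rightarrow> 'a"
    and kL :: "'k \<Rightarrow> 'l::{ring,monoid_mult} \<Rightarrow> 'l"
    and kR :: "'k \<Rightarrow> 'r::{ring,monoid_mult} \<Rightarrow> 'r"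
    and sL tL :: "'l \<Rightarrow> 'a" and \<gamma>L :: "'a \<Rightarrow> ('a \<times> 'a) list set" and \<pi>L :: "'a \<Rightarrow> 'l"
    and sR tR :: "'r \<Rightarrow> 'a" and \<gamma>R :: "'a \<Rightarrow> ('a \<times> 'a) list set" and \<pi>R :: "'a \<Rightarrow> 'r"
    and S :: "'a \<Rightarrow> 'a"
  defines "C1a \<equiv> frobenius_extension kR kA sR"
    and "C1b \<equiv> frobenius_extension (k_opp kR) kA (tR \<circ> unopp)"
    and "C1c \<equiv> frobenius_extension kL kA sL"
    and "C1d \<equiv> frobenius_extension (k_opp kL) kA (tL \<circ> unopp)"
    and "C2a \<equiv> free_rank_one (\<lambda>l \<Lambda> a. \<Lambda> (sL l * a)) (upper_right_integrals sR tR \<gamma>R)"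
    and "C2b \<equiv> bij S \<and> free_rank_one (\<lambda>l \<Lambda> a. \<Lambda> (tL l * a)) (upper_left_integrals sR tR \<gamma>R)"
    and "C2c \<equiv> free_rank_one (\<lambda>r \<rho> a. \<rho> (a * sR r)) (lower_left_integrals sL tL \<gamma>L)"
    and "C2d \<equiv> bij S \<and> free_rank_one (\<lambda>r \<rho> a. \<rho> (a * tR r)) (lower_right_integrals sL tL \<gamma>L)"
    and "nondeg_a \<equiv> \<lambda>\<Lambda>. \<Lambda> \<in> upper_right_integrals sR tR \<gamma>R \<and>
           bij_betw (\<lambda>a b. \<Lambda> (a * b)) UNIV (upper_right_dual sR)"
    and "nondeg_b \<equiv> \<lambda>\<Lambda>. bij S \<and> \<Lambda> \<in> upper_left_integrals sR tR \<gamma>R \<and>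
           bij_betw (\<lambda>a b. \<Lambda> (a * b)) UNIV (upper_left_dual tR)"
    and "nondeg_c \<equiv> \<lambda>\<rho>. \<rho> \<in> lower_left_integrals sL tL \<gamma>L \<and>
           bij_betw (\<lambda>a b. \<rho> (b * a)) UNIV (lower_left_dual sL)"
    and "nondeg_d \<equiv> \<lambda>\<rho>. bij S \<and> \<rho> \<in> lower_right_integrals sL tL \<gamma>L \<and>
           bij_betw (\<lambda>a b. \<rho> (b * a)) UNIV (lower_right_dual tL)"
    and "nondeg_in_a \<equiv> \<lambda>\<iota>. \<iota> \<in> left_integrals sL \<pi>L \<and>
           bij_betw (\<lambda>\<phi>. \<Sum>(x, y)\<leftarrow>sw (\<gamma>R \<iota>). y * tR (\<phi> x)) (upper_right_dual sR) UNIV"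
    and "nondeg_in_b \<equiv> \<lambda>\<iota>. bij S \<and> \<iota> \<in> left_integrals sL \<pi>L \<and>
           bij_betw (\<lambda>\<phi>. \<Sum>(x, y)\<leftarrow>sw (\<gamma>R \<iota>). x * sR (\<phi> y)) (upper_left_dual tR) UNIV"
    and "nondeg_in_c \<equiv> \<lambda>\<kappa>. \<kappa> \<in> right_integrals sR \<pi>R \<and>
           bij_betw (\<lambda>\<phi>. \<Sum>(x, y)\<leftarrow>sw (\<gamma>L \<kappa>). tL (\<phi> y) * x) (lower_left_dual sL) UNIV"
    and "nondeg_in_d \<equiv> \<lambda>\<kappa>. bij S \<and> \<kappa> \<in> right_integrals sR \<pi>R \<and>
           bij_betw (\<lambda>\<phi>. \<Sum>(x, y)\<leftarrow>sw (\<gamma>L \<kappa>). sL (\<phi> x) * y) (lower_right_dual tL) UNIV"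
  assumes "hopf_algebroid kA kL kR sL tL \<gamma>L \<pi>L sR tR \<gamma>R \<pi>R S"
    and "finitely_generated (\<lambda>(r::'r opp) a. a * sR (unopp r))"
        "projective (\<lambda>(r::'r opp) a. a * sR (unopp r))"
    and "finitely_generated (\<lambda>r a. a * tR r)" "projective (\<lambda>r a. a * tR r)"
    and "finitely_generated (\<lambda>(l::'l opp) a. tL (unopp l) * a)"
        "projective (\<lambda>(l::'l opp) a. tL (unopp l) * a)"
    and "finitely_generated (\<lambda>l a. sL l * a)" "projective (\<lambda>l a. sL l * a)"
  shows "(C1a \<longleftrightarrow> C1b) \<and> (C1a \<longleftrightarrow> C1c) \<and> (C1a \<longleftrightarrow> C1d) \<and>
         (C1a \<longleftrightarrow> C2a) \<and> (C1a \<longleftrightarrow> C2b) \<and> (C1a \<longleftrightarrow> C2c) \<and> (C1a \<longleftrightarrow> C2d) \<and>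
         (C1a \<longleftrightarrow> (\<exists>\<Lambda>. nondeg_a \<Lambda>)) \<and> (C1a \<longleftrightarrow> (\<exists>\<Lambda>. nondeg_b \<Lambda>)) \<and>
         (C1a \<longleftrightarrow> (\<exists>\<rho>. nondeg_c \<rho>)) \<and> (C1a \<longleftrightarrow> (\<exists>\<rho>. nondeg_d \<rho>)) \<and>
         (C1a \<longleftrightarrow> (\<exists>\<iota>. nondeg_in_a \<iota>)) \<and> (C1a \<longleftrightarrow> (\<exists>\<iota>. nondeg_in_b \<iota>)) \<and>
         (C1a \<longleftrightarrow> (\<exists>\<kappa>. nondeg_in_c \<kappa>)) \<and> (C1a \<longleftrightarrow> (\<exists>\<kappa>. nondeg_in_d \<kappa>)) \<and>
         (\<forall>\<Lambda>. nondeg_a \<Lambda> \<longrightarrow> frobenius_functional sR \<Lambda>) \<and>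
         (\<forall>\<Lambda>. nondeg_b \<Lambda> \<longrightarrow> frobenius_functional (tR \<circ> unopp) (Opp \<circ> \<Lambda>)) \<and>
         (\<forall>\<rho>. nondeg_c \<rho> \<longrightarrow> frobenius_functional sL \<rho>) \<and>
         (\<forall>\<rho>. nondeg_d \<rho> \<longrightarrow> frobenius_functional (tL \<circ> unopp) (Opp \<circ> \<rho>)) \<and>
         (C1a \<longrightarrow> (\<exists>\<iota>. nondeg_in_a \<iota> \<and> nondeg_in_b \<iota>)) \<and>
         (C1a \<longrightarrow> (\<exists>\<kappa>. nondeg_in_c \<kappa> \<and> nondeg_in_d \<kappa>))"
proof -
  interpret hopf_algebroid_data kA kL kR sL tL \<gamma>L \<pi>L sR tR \<gamma>R \<pi>R S
    by unfold_locales (rule \<open>hopf_algebroid kA kL kR sL tL \<gamma>L \<pi>L sR tR \<gamma>R \<pi>R S\<close>)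
  \<comment> \<open>A right R-module is a left module over the opposite ring, so \<open>sR\<close>
    composed with \<open>unopp\<close> reverses products, as \<open>dual_basis_of_module\<close>
    requires.\<close>
  have "\<exists>n b \<beta>. dual_basis (*) (range tL) n b \<beta>"
    by (rule dual_basis_of_module[where \<tau> = "\<lambda>r. sR (unopp r)",
          OF \<open>finitely_generated (\<lambda>(r::'r opp) a. a * sR (unopp r))\<close>
             \<open>projective (\<lambda>(r::'r opp) a. a * sR (unopp r))\<close>])
      (simp_all add: plus_opp_def times_opp_def sR range_unopp ranges)
  moreover have "\<exists>n b \<beta>. dual_basis (*) (range sL) n b \<beta>"
    by (rule dual_basis_of_module[where \<tau> = tR,
          OF \<open>finitely_generated (\<lambda>r a. a * tR r)\<close> \<open>projective (\<lambda>r a. a * tR r)\<close>])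
      (simp_all add: tR ranges)
  moreover have "\<exists>n b \<beta>. dual_basis (\<lambda>x y. y * x) (range tL) n b \<beta>"
    by (rule dual_basis_of_module[where \<tau> = "\<lambda>l. tL (unopp l)",
          OF \<open>finitely_generated (\<lambda>(l::'l opp) a. tL (unopp l) * a)\<close>
             \<open>projective (\<lambda>(l::'l opp) a. tL (unopp l) * a)\<close>])
      (simp_all add: plus_opp_def times_opp_def tL range_unopp)
  moreover have "\<exists>n b \<beta>. dual_basis (\<lambda>x y. y * x) (range sL) n b \<beta>"
    by (rule dual_basis_of_module[where \<tau> = sL,
          OF \<open>finitely_generated (\<lambda>l a. sL l * a)\<close> \<open>projective (\<lambda>l a. sL l * a)\<close>])
      (simp_all add: sL)
  ultimately interpret hopf_algebroid_fgp kA kL kR sL tL \<gamma>L \<pi>L sR tR \<gamma>R \<pi>R S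
    by unfold_locales
  have ext: "C1a \<longleftrightarrow> frobenius_R" "C1b \<longleftrightarrow> frobenius_R" "C1c \<longleftrightarrow> frobenius_R" "C1d \<longleftrightarrow> frobenius_R"
    unfolding C1a_def C1b_def C1c_def C1d_def by (rule extension_iff)+
  have free: "C2a \<longleftrightarrow> frobenius_R" "C2b \<longleftrightarrow> frobenius_R" "C2c \<longleftrightarrow> frobenius_R" "C2d \<longleftrightarrow> frobenius_R"
    unfolding C2a_def C2b_def C2c_def C2d_def
    using case_a(1) case_c(1) bij_S_conj_iff[OF case_b(1)[unfolded frobenius_L_iff_R]]
      bij_S_conj_iff[OF case_d(1)]
    by (simp_all add: frobenius_L_iff_R)
  have nondeg: "(\<exists>\<Lambda>. nondeg_a \<Lambda>) \<longleftrightarrow> frobenius_R" "(\<exists>\<Lambda>. nondeg_b \<Lambda>) \<longleftrightarrow> frobenius_R"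
    "(\<exists>\<rho>. nondeg_c \<rho>) \<longleftrightarrow> frobenius_R" "(\<exists>\<rho>. nondeg_d \<rho>) \<longleftrightarrow> frobenius_R"
    unfolding nondeg_a_def nondeg_b_def nondeg_c_def nondeg_d_def
    using case_a(2) case_c(2) bij_S_conj_iff[OF case_b(2)[unfolded frobenius_L_iff_R]]
      bij_S_conj_iff[OF case_d(2)]
    by (simp_all add: frobenius_L_iff_R)
  have nondeg_in: "(\<exists>\<iota>. nondeg_in_a \<iota>) \<longleftrightarrow> frobenius_R" "(\<exists>\<iota>. nondeg_in_b \<iota>) \<longleftrightarrow> frobenius_R"
    "(\<exists>\<kappa>. nondeg_in_c \<kappa>) \<longleftrightarrow> frobenius_R" "(\<exists>\<kappa>. nondeg_in_d \<kappa>) \<longleftrightarrow> frobenius_R"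
    unfolding nondeg_in_a_def nondeg_in_b_def nondeg_in_c_def nondeg_in_d_def
    using case_a(3) case_c(3) bij_S_conj_iff[OF case_b(3)[unfolded frobenius_L_iff_R]]
      bij_S_conj_iff[OF case_d(3)]
    by (simp_all add: frobenius_L_iff_R)
  have functional: "nondeg_a \<Lambda> \<Longrightarrow> frobenius_functional sR \<Lambda>"
    "nondeg_b \<Lambda> \<Longrightarrow> frobenius_functional (tR \<circ> unopp) (Opp \<circ> \<Lambda>)"
    "nondeg_c \<rho> \<Longrightarrow> frobenius_functional sL \<rho>"
    "nondeg_d \<rho> \<Longrightarrow> frobenius_functional (tL \<circ> unopp) (Opp \<circ> \<rho>)" for \<Lambda> \<rho>
    unfolding nondeg_a_def nondeg_b_def nondeg_c_def nondeg_d_def functional_iff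
    using case_a(4) case_b(4) case_c(4) case_d(4) by simp_all
  have common: "frobenius_R \<Longrightarrow> \<exists>\<iota>. nondeg_in_a \<iota> \<and> nondeg_in_b \<iota>"
    "frobenius_R \<Longrightarrow> \<exists>\<kappa>. nondeg_in_c \<kappa> \<and> nondeg_in_d \<kappa>"
    unfolding nondeg_in_a_def nondeg_in_b_def nondeg_in_c_def nondeg_in_d_def
    using common_left_integral common_right_integral[unfolded frobenius_L_iff_R] case_a(5) by blast+
  show ?thesis
    unfolding ext free nondeg nondeg_in using functional common by blast
qed

end
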